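(* For every integer $c\ge 2$ there is a constant $K=K(c)>0$, depending only on $c$, such that for every sequence $\{G_n\}_{n\ge1}$ of finite simple graphs with $N(K_3,G_n)\ge 1$ for all $n$, and for every $n\ge 1$, $$\sup_{x\in\mathbb{R}}\left|\mathbb{P}(Z_3(G_n)\le x)-\Phi(x)\right|\le K\left[R_1^{1/4}+R_2\right]^{1/5},$$ where $$R_1=\frac{1+N(\triangle_4,G_n)}{\left(N(K_3,G_n)+N(\triangle_2,G_n)\right)^2},\qquad R_2=\frac{b(G_n)}{\left(N(K_3,G_n)+N(\triangle_2,G_n)\right)^2}.$$
   Context: $G_n=(V(G_n),E(G_n))$ is a deterministic finite simple graph with vertex set $\{1,2,\dots,|V(G_n)|\}$ and adjacency matrix $(a_{ij}(G_n))$, where $a_{ij}(G_n)=1$ if $(i,j)\in E(G_n)$ and $0$ otherwise. In a uniformly random $c$-coloring, the colors $X_v$, $v\in V(G_n)$, are independent and uniform on $\{1,\dots,c\}$. The number of monochromatic triangles is $$T_3(G_n)=\sum_{1\le s_1<s_2<s_3\le |V(G_n)|}a_{s_1s_2}(G_n)a_{s_2s_3}(G_n)a_{s_1s_3}(G_n)\mathbf 1\{X_{s_1}=X_{s_2}=X_{s_3}\},$$ and $Z_3(G_n)=\dfrac{T_3(G_n)-\mathbb{E}(T_3(G_n))}{\sqrt{\mathrm{Var}(T_3(G_n))}}$. $\Phi$ is the standard normal distribution function. For a fixed simple graph $H$, $N(H,G_n)$ is the number of copies (subgraphs, not necessarily induced) of $H$ in $G_n$. $K_3$ is the triangle. For $s\ge1$,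 the $s$-pyramid $\triangle_s$ is the graph formed by $s$ triangles all sharing one common edge (with $s$ distinct apex vertices), so $\triangle_1=K_3$. For distinct vertices $s_1,s_2$, $d_{s_1s_2}=\sum_{s_3\notin\{s_1,s_2\}}a_{s_1s_2}(G_n)a_{s_2s_3}(G_n)a_{s_3s_1}(G_n)$ is the number of triangles of $G_n$ having $(s_1,s_2)$ as an edge, and $$b(G_n)=\sum_{1\le s_1<s_2<s_3<s_4\le|V(G_n)|}\left(d_{s_1s_2}d_{s_2s_3}d_{s_3s_4}d_{s_4s_1}+d_{s_1s_2}d_{s_2s_4}d_{s_4s_3}d_{s_3s_1}+d_{s_1s_3}d_{s_3s_2}d_{s_2s_4}d_{s_4s_1}\right).$$ *)

theory Defs
  imports "HOL-Probability.Probability" "HOL-Probability.Product_PMF"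
    "Graph_Theory.Pair_Digraph" "Graph_Theory.Digraph_Component"
    "Graph_Theory.Digraph_Isomorphism"
begin

text \<open>Finite simple graphs are the \<^locale>\<open>pair_graph\<close>s of Graph Theory: the arc set is the symmetric
  and irreflexive set of all \<open>(i, j)\<close> such that \<open>{i, j}\<close> is an edge.\<close>

definition labelled_graph :: "nat pair_pre_digraph \<Rightarrow> bool" where
  "labelled_graph G \<longleftrightarrow> pair_graph G \<and> pverts G = {1..card (pverts G)}"

definition adj :: "nat pair_pre_digraph \<Rightarrow> nat \<Rightarrow> nat \<Rightarrow> nat" where
  "adj G i j = (if (i, j) \<in> parcs G then 1 else 0)"


subsection \<open>Subgraph counts\<close>

text \<open>The requirement \<^term>\<open>pair_graph S\<close> restricts the library's directed subgraphs to those that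
  contain both arcs or neither arc of an edge, i.e. to undirected subgraphs.\<close>

definition copies :: "nat pair_pre_digraph \<Rightarrow> nat pair_pre_digraph \<Rightarrow> nat pair_pre_digraph set" where
  "copies H G = {S. pair_graph S \<and> subgraph (with_proj S) (with_proj G) \<and>
                    digraph_iso (with_proj H) (with_proj S)}"

definition num_copies :: "nat pair_pre_digraph \<Rightarrow> nat pair_pre_digraph \<Rightarrow> nat" where
  "num_copies H G = card (copies H G)"

definition K3 :: "nat pair_pre_digraph" where
  "K3 = \<lparr>pverts = {1, 2, 3}, parcs = {(u, v). u \<in> {1, 2, 3} \<and> v \<in> {1, 2, 3} \<and> u \<noteq> v}\<rparr>"

text \<open>The common edge is \<open>{1, 2}\<close>; the apexes are \<open>3, \<dots>, s + 2\<close>.\<close>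

definition pyramid :: "nat \<Rightarrow> nat pair_pre_digraph" where
  "pyramid s = \<lparr>pverts = {1, 2} \<union> {3..s + 2},
     parcs = {(1, 2), (2, 1)} \<union> {1, 2} \<times> {3..s + 2} \<union> {3..s + 2} \<times> {1, 2}\<rparr>"

lemma pyramid_1: "pyramid 1 = K3"
  by (auto simp: pyramid_def K3_def)


subsection \<open>Monochromatic triangles\<close>

text \<open>The default value \<open>0\<close> is taken only outside the vertex set, where no color is read.\<close>

definition coloring :: "nat \<Rightarrow> nat pair_pre_digraph \<Rightarrow> (nat \<Rightarrow> nat) pmf" where
  "coloring c G = Pi_pmf (pverts G) 0 (\<lambda>_. pmf_of_set {1..c})"

definition T3 :: "nat pair_pre_digraph \<Rightarrow> (nat \<Rightarrow> nat) \<Rightarrow> real" where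
  "T3 G X = (\<Sum>(s1, s2, s3) \<in> {(s1, s2, s3). 1 \<le> s1 \<and> s1 < s2 \<and> s2 < s3 \<and> s3 \<le> card (pverts G)}.
     real (adj G s1 s2 * adj G s2 s3 * adj G s1 s3) *
     (if X s1 = X s2 \<and> X s2 = X s3 then 1 else 0))"

definition Z3 :: "nat \<Rightarrow> nat pair_pre_digraph \<Rightarrow> (nat \<Rightarrow> nat) \<Rightarrow> real" where
  "Z3 c G X = (T3 G X - measure_pmf.expectation (coloring c G) (T3 G)) /
     sqrt (measure_pmf.variance (coloring c G) (T3 G))"


subsection \<open>The error terms\<close>

definition tri_deg :: "nat pair_pre_digraph \<Rightarrow> nat \<Rightarrow> nat \<Rightarrow> nat" where
  "tri_deg G s1 s2 = (\<Sum>s3 \<in> pverts G - {s1, s2}. adj G s1 s2 * adj G s2 s3 * adj G s3 s1)"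

definition b_term :: "nat pair_pre_digraph \<Rightarrow> nat" where
  "b_term G = (let d = tri_deg G in
     \<Sum>(s1, s2, s3, s4) \<in> {(s1, s2, s3, s4).
         1 \<le> s1 \<and> s1 < s2 \<and> s2 < s3 \<and> s3 < s4 \<and> s4 \<le> card (pverts G)}.
       d s1 s2 * d s2 s3 * d s3 s4 * d s4 s1
     + d s1 s2 * d s2 s4 * d s4 s3 * d s3 s1
     + d s1 s3 * d s3 s2 * d s2 s4 * d s4 s1)"

definition R1 :: "nat pair_pre_digraph \<Rightarrow> real" where
  "R1 G = (1 + real (num_copies (pyramid 4) G)) /
     (real (num_copies K3 G) + real (num_copies (pyramid 2) G))\<^sup>2"

definition R2 :: "nat pair_pre_digraph \<Rightarrow> real" where
  "R2 G = real (b_term G) /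
     (real (num_copies K3 G) + real (num_copies (pyramid 2) G))\<^sup>2"

end

theory Submission
  imports Defs
begin

text \<open>
  Write \<open>T3\<close> minus its mean as a sum over edges and triangles \<open>S\<close> of multiples of the completely
  degenerate functions \<open>cmono S = (\<Sum>a. \<Prod>j\<in>S. of_bool (X j = a) - 1 / c)\<close>; the coefficient of an edge
  is its triangle degree up to the factor \<open>1 / c\<close>. These functions are orthogonal, so the variance is at
  least a constant times \<open>Q = (\<Sum>i j. d i j ^ 2)\<close>, which dominates \<open>N(K3) + N(pyramid 2)\<close>. Order the
  vertices by decreasing \<open>(\<Sum>j. d i j ^ 2)\<close> and let \<open>D i\<close> collect the terms with last vertex \<open>i\<close>.
  With \<open>L i = W - E_i W\<close>, \<open>E_i\<close> averaging over the color of \<open>i\<close>, Taylor's formula gives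
  \<open>E (W G(W)) = E (\<Gamma> G'(W))\<close> for \<open>\<Gamma> = (\<Sum>i. E_i (D i * L i))\<close>, up to an error of order
  \<open>\<Sum>i. |D i|_2 |L i|_4 ^ 2\<close>. Hypercontractivity and the choice of the order bound this error
  by a power of \<open>(max d)^4 / Q^2\<close>, which is at most a constant times \<open>R1\<close>; the variance of \<open>\<Gamma>\<close> is
  controlled by the weighted four-cycles, that is by \<open>R2\<close>, and by the same power of \<open>R1\<close>.
\<close>


subsection \<open>Random colorings\<close>

text \<open>The order of the vertices meets a real obstacle: one vertex can carry a constant
  fraction of the variance. With the hub in front its \<open>D\<close> is 0, and every error term
  contains a factor \<open>D\<close>: |D i|_2 is uniformly small, while |L i|_4 ^ 2 is by
  hypercontractivity at most a constant times the normalized influence of \<open>i\<close>, and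
  these sum to a constant. The same asymmetric pairing of \<open>D\<close> with \<open>L\<close>
  keeps the diagonal terms in the variance of \<Gamma> small. Exponents: for r = R1^(1/4) + R2 both
  the variance of \<Gamma> and the maximum of |D i|_2 ^ 2 are of order r, so Stein's error is of
  order r^(1/2); passing from smooth functions to indicators turns this into r^(1/5).\<close>

locale color_space =
  fixes V :: "'v set" and c :: nat
  assumes fin_V: "finite V" and c_ge_2: "2 \<le> c"
begin

text \<open>Outside \<open>V\<close> every coloring is fixed to 0, the default value used in
  \<open>coloring\<close>. The set is therefore finite, and the uniform law on it is the law of the
  random coloring.\<close>

definition colorings :: "('v \<Rightarrow> nat) set" where
  "colorings = PiE_dflt V 0 (\<lambda>_. {1..c})"

definition avg :: "(('v \<Rightarrow> nat) \<Rightarrow> real) \<Rightarrow> real" where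
  "avg f = (\<Sum>X\<in>colorings. f X) / real (card colorings)"

text \<open>The conditional expectation given the colors of all vertices other than
  \<open>i\<close>.\<close>

definition cavg :: "'v \<Rightarrow> (('v \<Rightarrow> nat) \<Rightarrow> real) \<Rightarrow> ('v \<Rightarrow> nat) \<Rightarrow> real" where
  "cavg i f X = (\<Sum>a\<in>{1..c}. f (X(i := a))) / real c"

definition depends :: "'v set \<Rightarrow> (('v \<Rightarrow> nat) \<Rightarrow> real) \<Rightarrow> bool" where
  "depends U f \<longleftrightarrow> (\<forall>X\<in>colorings. \<forall>Y\<in>colorings. (\<forall>j\<in>U. X j = Y j) \<longrightarrow> f X = f Y)"

lemma c_pos: "real c > 0" "c > 0" "{1..c} \<noteq> {}" "real c \<ge> 2"
  using c_ge_2 by auto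

lemma finite_colorings: "finite colorings"
  unfolding colorings_def using fin_V by (intro finite_PiE_dflt) auto

lemma colorings_nonempty: "colorings \<noteq> {}"
  unfolding colorings_def using c_pos by (subst PiE_dflt_empty_iff) auto

lemma card_colorings_pos: "real (card colorings) > 0"
  using finite_colorings colorings_nonempty by (simp add: card_gt_0_iff)

lemma coloring_upd: "X \<in> colorings \<Longrightarrow> i \<in> V \<Longrightarrow> a \<in> {1..c} \<Longrightarrow> X(i := a) \<in> colorings"
  by (auto simp: colorings_def PiE_dflt_def)

lemma coloring_range: "X \<in> colorings \<Longrightarrow> i \<in> V \<Longrightarrow> X i \<in> {1..c}"
  by (auto simp: colorings_def PiE_dflt_def)

lemma avg_cong: "(\<And>X. X \<in> colorings \<Longrightarrow> f X = g X) \<Longrightarrow> avg f = avg g"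
  unfolding avg_def by (simp cong: sum.cong)

lemma avg_add: "avg (\<lambda>X. f X + g X) = avg f + avg g"
  unfolding avg_def by (simp add: sum.distrib add_divide_distrib)

lemma avg_diff: "avg (\<lambda>X. f X - g X) = avg f - avg g"
  unfolding avg_def by (simp add: sum_subtractf diff_divide_distrib)

lemma avg_mult_left: "avg (\<lambda>X. k * f X) = k * avg f"
  unfolding avg_def by (simp add: sum_distrib_left)

lemma avg_sum: "avg (\<lambda>X. \<Sum>p\<in>P. f p X) = (\<Sum>p\<in>P. avg (f p))"
  unfolding avg_def by (subst sum.swap) (simp add: sum_divide_distrib)

lemma avg_const: "avg (\<lambda>_. k) = k"
  unfolding avg_def using card_colorings_pos by simp

lemma avg_mono: "(\<And>X. X \<in> colorings \<Longrightarrow> f X \<le> g X) \<Longrightarrow> avg f \<le> avg g"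
  unfolding avg_def using card_colorings_pos by (intro divide_right_mono sum_mono) auto

lemma avg_nonneg: "(\<And>X. X \<in> colorings \<Longrightarrow> 0 \<le> f X) \<Longrightarrow> 0 \<le> avg f"
  using avg_mono[of "\<lambda>_. 0" f] by (simp add: avg_const)

lemma avg_abs: "\<bar>avg f\<bar> \<le> avg (\<lambda>X. \<bar>f X\<bar>)"
  unfolding avg_def using card_colorings_pos
  by (simp add: divide_right_mono sum_abs)

lemma avg_cauchy: "(avg (\<lambda>X. f X * g X))\<^sup>2 \<le> avg (\<lambda>X. (f X)\<^sup>2) * avg (\<lambda>X. (g X)\<^sup>2)"
  unfolding avg_def using Cauchy_Schwarz_ineq_sum[of f g colorings] card_colorings_pos
  by (simp add: power_divide divide_right_mono power2_eq_square)

lemma avg_cauchy_sqrt: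
  "avg (\<lambda>X. f X * g X) \<le> sqrt (avg (\<lambda>X. (f X)\<^sup>2)) * sqrt (avg (\<lambda>X. (g X)\<^sup>2))"
  using real_le_rsqrt[OF avg_cauchy[of f g]] by (simp add: real_sqrt_mult)

lemma avg_abs_le_sqrt: "avg (\<lambda>X. \<bar>f X\<bar>) \<le> sqrt (avg (\<lambda>X. (f X)\<^sup>2))"
  using avg_cauchy_sqrt[of "\<lambda>X. \<bar>f X\<bar>" "\<lambda>_. 1"] by (simp add: avg_const)

lemma cavg_upd: "cavg i f (X(i := a)) = cavg i f X"
  unfolding cavg_def by simp

lemma cavg_add: "cavg i (\<lambda>X. f X + g X) X = cavg i f X + cavg i g X"
  unfolding cavg_def by (simp add: sum.distrib add_divide_distrib)

lemma cavg_diff: "cavg i (\<lambda>X. f X - g X) X = cavg i f X - cavg i g X"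
  unfolding cavg_def by (simp add: sum_subtractf diff_divide_distrib)

lemma cavg_sum: "cavg i (\<lambda>X. \<Sum>p\<in>P. f p X) X = (\<Sum>p\<in>P. cavg i (f p) X)"
  unfolding cavg_def by (subst sum.swap) (simp add: sum_divide_distrib)

lemma cavg_mult:
  "(\<And>a. a \<in> {1..c} \<Longrightarrow> g (X(i := a)) = g X) \<Longrightarrow>
    cavg i (\<lambda>X. g X * f X) X = g X * cavg i f X"
  unfolding cavg_def times_divide_eq_right sum_distrib_left
  by (intro arg_cong2[where f = "(/)"] sum.cong) simp_all

lemma cavg_mult_left: "cavg i (\<lambda>X. k * f X) X = k * cavg i f X"
  by (rule cavg_mult) simp

lemma cavg_const: "(\<And>a. a \<in> {1..c} \<Longrightarrow> f (X(i := a)) = k) \<Longrightarrow> cavg i f X = k"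
proof -
  assume *: "\<And>a. a \<in> {1..c} \<Longrightarrow> f (X(i := a)) = k"
  have "(\<Sum>a\<in>{1..c}. f (X(i := a))) = (\<Sum>a\<in>{1..c}. k)"
    by (rule sum.cong[OF refl *])
  then show ?thesis unfolding cavg_def using c_pos by simp
qed

lemma cavg_abs: "\<bar>cavg i f X\<bar> \<le> cavg i (\<lambda>X. \<bar>f X\<bar>) X"
  unfolding cavg_def by (simp add: divide_right_mono sum_abs)

text \<open>The map \<open>(X, a) \<mapsto> (X(i := a), X i)\<close> is an involution.\<close>

lemma avg_cavg:
  assumes "i \<in> V" shows "avg (cavg i f) = avg f"
proof -
  have "(\<Sum>(X, a)\<in>colorings \<times> {1..c}. f (X(i := a))) = (\<Sum>(X, a)\<in>colorings \<times> {1..c}. f X)"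
    by (rule sum.reindex_bij_witness[where i = "\<lambda>(X, a). (X(i := a), X i)"
          and j = "\<lambda>(X, a). (X(i := a), X i)"])
       (auto simp: coloring_upd[OF _ assms] dest: coloring_range[OF _ assms])
  then have "(\<Sum>X\<in>colorings. \<Sum>a\<in>{1..c}. f (X(i := a))) = real c * (\<Sum>X\<in>colorings. f X)"
    by (simp add: sum.cartesian_product[symmetric] sum_distrib_left)
  then show ?thesis
    unfolding avg_def cavg_def using c_pos
    by (simp add: sum_divide_distrib[symmetric])
qed

lemma dependsD:
  "depends U f \<Longrightarrow> X \<in> colorings \<Longrightarrow> Y \<in> colorings \<Longrightarrow> (\<And>j. j \<in> U \<Longrightarrow> X j = Y j) \<Longrightarrow> f X = f Y"
  unfolding depends_def by blast

lemma depends_upd: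
  "depends U f \<Longrightarrow> i \<notin> U \<Longrightarrow> X \<in> colorings \<Longrightarrow> i \<in> V \<Longrightarrow> a \<in> {1..c} \<Longrightarrow> f (X(i := a)) = f X"
  by (rule dependsD[where U = U], assumption, rule coloring_upd) auto

lemma depends_mono: "depends U f \<Longrightarrow> U \<subseteq> U' \<Longrightarrow> depends U' f"
  unfolding depends_def by blast

lemma depends_cavg:
  assumes "depends U f" "i \<in> V" shows "depends (U - {i}) (cavg i f)"
  unfolding depends_def cavg_def
proof (intro ballI impI)
  fix X Y assume "X \<in> colorings" "Y \<in> colorings" "\<forall>j\<in>U - {i}. X j = Y j"
  then have "f (X(i := a)) = f (Y(i := a))" if "a \<in> {1..c}" for a
    using that assms by (intro dependsD[OF assms(1)] coloring_upd) auto
  then show "(\<Sum>a = 1..c. f (X(i := a))) / real c = (\<Sum>a = 1..c. f (Y(i := a))) / real c"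
    by simp
qed

lemma cavg_zero_imp_avg_mult_zero:
  assumes "i \<in> V" "\<And>X. X \<in> colorings \<Longrightarrow> cavg i f X = 0"
    and "\<And>X a. X \<in> colorings \<Longrightarrow> a \<in> {1..c} \<Longrightarrow> g (X(i := a)) = g X"
  shows "avg (\<lambda>X. g X * f X) = 0"
proof -
  have "avg (\<lambda>X. g X * f X) = avg (cavg i (\<lambda>X. g X * f X))"
    using assms(1) by (simp add: avg_cavg)
  also have "\<dots> = avg (\<lambda>X. 0)"
    using assms by (intro avg_cong) (subst cavg_mult, auto)
  finally show ?thesis by (simp add: avg_const)
qed


subsection \<open>Degenerate functions\<close>

text \<open>The pure Hoeffding (Efron-Stein) components with index set \<open>U\<close>.\<close>

definition degenerate :: "'v set \<Rightarrow> (('v \<Rightarrow> nat) \<Rightarrow> real) \<Rightarrow> bool" where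
  "degenerate U f \<longleftrightarrow> U \<subseteq> V \<and> depends U f \<and> (\<forall>i\<in>U. \<forall>X\<in>colorings. cavg i f X = 0)"

text \<open>Take a vertex that lies in only one of the two index sets. Averaging over its color
  kills one factor and does not touch the other.\<close>

lemma degenerate_orthogonal:
  assumes "degenerate U f" "degenerate U' g" "U \<noteq> U'"
  shows "avg (\<lambda>X. f X * g X) = 0"
proof -
  have *: "avg (\<lambda>X. f X * g X) = 0"
    if fg: "degenerate U f" "degenerate U' g" "i \<in> U'" "i \<notin> U" for f g U U' i
  proof (rule cavg_zero_imp_avg_mult_zero)
    show "i \<in> V" using fg by (auto simp: degenerate_def)
    show "cavg i g X = 0" if "X \<in> colorings" for X
      using fg that by (auto simp: degenerate_def)
    show "f (X(i := a)) = f X" if "X \<in> colorings" "a \<in> {1..c}" for X a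
      using that fg \<open>i \<in> V\<close> by (auto simp: degenerate_def intro: depends_upd)
  qed
  consider i where "i \<in> U'" "i \<notin> U" | i where "i \<in> U" "i \<notin> U'" using assms(3) by blast
  then show ?thesis
  proof cases
    case 1 then show ?thesis using * assms by blast
  next
    case 2
    then have "avg (\<lambda>X. g X * f X) = 0" using * assms by blast
    then show ?thesis by (simp add: mult.commute)
  qed
qed

lemma degenerate_one: "degenerate {} (\<lambda>_. 1)"
  unfolding degenerate_def depends_def by simp

lemma degenerate_avg: "degenerate U f \<Longrightarrow> U \<noteq> {} \<Longrightarrow> avg f = 0"
  using degenerate_orthogonal[OF degenerate_one, of U f] by simp

text \<open>Orthogonality leaves only the products of terms with equal index sets. These need not be
  orthogonal, so they are split by 2xy \<le> x^2 + y^2, after which each coefficient occurs at most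
  \<open>m\<close> times.\<close>

lemma avg_degenerate_sum_square_le:
  assumes "finite P" and deg: "\<And>p. p \<in> P \<Longrightarrow> degenerate (U p) (f p)"
    and bd: "\<And>p X. p \<in> P \<Longrightarrow> X \<in> colorings \<Longrightarrow> \<bar>f p X\<bar> \<le> B"
    and mult: "\<And>p. p \<in> P \<Longrightarrow> card {q \<in> P. U q = U p} \<le> m"
  shows "avg (\<lambda>X. (\<Sum>p\<in>P. \<alpha> p * f p X)\<^sup>2) \<le> real m * B\<^sup>2 * (\<Sum>p\<in>P. (\<alpha> p)\<^sup>2)"
proof -
  define e where "e p q = (if U q = U p then (1::real) else 0)" for p q
  have "avg (\<lambda>X. (\<Sum>p\<in>P. \<alpha> p * f p X)\<^sup>2)
      = (\<Sum>p\<in>P. \<Sum>q\<in>P. avg (\<lambda>X. (\<alpha> p * f p X) * (\<alpha> q * f q X)))"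
    by (simp add: power2_eq_square sum_product avg_sum)
  also have "\<dots> \<le> (\<Sum>p\<in>P. \<Sum>q\<in>P. e p q * (B\<^sup>2 * ((\<alpha> p)\<^sup>2 + (\<alpha> q)\<^sup>2) / 2))"
  proof (intro sum_mono)
    fix p q assume pq: "p \<in> P" "q \<in> P"
    have split: "avg (\<lambda>X. (\<alpha> p * f p X) * (\<alpha> q * f q X)) = \<alpha> p * \<alpha> q * avg (\<lambda>X. f p X * f q X)"
      by (simp add: avg_mult_left[symmetric] mult_ac)
    show "avg (\<lambda>X. (\<alpha> p * f p X) * (\<alpha> q * f q X)) \<le> e p q * (B\<^sup>2 * ((\<alpha> p)\<^sup>2 + (\<alpha> q)\<^sup>2) / 2)"
    proof (cases "U q = U p")
      case False
      then have "avg (\<lambda>X. f p X * f q X) = 0"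
        using deg pq by (metis degenerate_orthogonal)
      then show ?thesis using False split by (simp add: e_def)
    next
      case True
      have "avg (\<lambda>X. (\<alpha> p * f p X) * (\<alpha> q * f q X)) \<le> avg (\<lambda>X. B\<^sup>2 * ((\<alpha> p)\<^sup>2 + (\<alpha> q)\<^sup>2) / 2)"
      proof (rule avg_mono)
        fix X assume X: "X \<in> colorings"
        have "(f p X)\<^sup>2 \<le> B\<^sup>2" "(f q X)\<^sup>2 \<le> B\<^sup>2"
          using bd[OF _ X] pq by (metis abs_ge_zero power2_abs power_mono)+
        then have "(\<alpha> p * f p X)\<^sup>2 \<le> B\<^sup>2 * (\<alpha> p)\<^sup>2" "(\<alpha> q * f q X)\<^sup>2 \<le> B\<^sup>2 * (\<alpha> q)\<^sup>2"
          by (simp_all add: power_mult_distrib mult.commute[of "B\<^sup>2"] mult_left_mono)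
        moreover have "2 * ((\<alpha> p * f p X) * (\<alpha> q * f q X)) \<le> (\<alpha> p * f p X)\<^sup>2 + (\<alpha> q * f q X)\<^sup>2"
          using sum_squares_bound[of "\<alpha> p * f p X" "\<alpha> q * f q X"] by (simp add: mult_ac)
        ultimately show "(\<alpha> p * f p X) * (\<alpha> q * f q X) \<le> B\<^sup>2 * ((\<alpha> p)\<^sup>2 + (\<alpha> q)\<^sup>2) / 2"
          by (simp add: algebra_simps)
      qed
      then show ?thesis using True by (simp add: avg_const e_def)
    qed
  qed
  also have "\<dots> = (\<Sum>p\<in>P. \<Sum>q\<in>P. e p q * (B\<^sup>2 * (\<alpha> p)\<^sup>2)/2) + (\<Sum>p\<in>P. \<Sum>q\<in>P. e p q * (B\<^sup>2 * (\<alpha> q)\<^sup>2)/2)"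
    by (simp add: sum.distrib[symmetric] algebra_simps add_divide_distrib)
  also have "(\<Sum>p\<in>P. \<Sum>q\<in>P. e p q * (B\<^sup>2 * (\<alpha> q)\<^sup>2)/2) = (\<Sum>p\<in>P. \<Sum>q\<in>P. e p q * (B\<^sup>2 * (\<alpha> p)\<^sup>2)/2)"
    by (subst sum.swap) (auto simp: e_def intro!: sum.cong)
  also have "(\<Sum>p\<in>P. \<Sum>q\<in>P. e p q * (B\<^sup>2 * (\<alpha> p)\<^sup>2)/2) + (\<Sum>p\<in>P. \<Sum>q\<in>P. e p q * (B\<^sup>2 * (\<alpha> p)\<^sup>2)/2)
     = (\<Sum>p\<in>P. real (card {q\<in>P. U q = U p}) * (B\<^sup>2 * (\<alpha> p)\<^sup>2))"
  proof -
    have "(\<Sum>q\<in>P. e p q) = real (card {q\<in>P. U q = U p})" for p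
      unfolding e_def using \<open>finite P\<close> by (simp add: sum.If_cases Int_def)
    then have "(\<Sum>q\<in>P. e p q * (B\<^sup>2 * (\<alpha> p)\<^sup>2)/2) = real (card {q\<in>P. U q = U p}) * (B\<^sup>2 * (\<alpha> p)\<^sup>2) / 2" for p
      by (simp only: sum_divide_distrib[symmetric] sum_distrib_right[symmetric])
    then show ?thesis by (simp only:) (simp add: sum_divide_distrib[symmetric])
  qed
  also have "\<dots> \<le> (\<Sum>p\<in>P. real m * (B\<^sup>2 * (\<alpha> p)\<^sup>2))"
    using mult by (intro sum_mono mult_right_mono) auto
  finally show ?thesis by (simp add: sum_distrib_left mult_ac)
qed

lemma avg_degenerate_sum_square:
  assumes "finite P" and deg: "\<And>p. p \<in> P \<Longrightarrow> degenerate p (f p)"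
  shows "avg (\<lambda>X. (\<Sum>p\<in>P. \<alpha> p * f p X)\<^sup>2) = (\<Sum>p\<in>P. (\<alpha> p)\<^sup>2 * avg (\<lambda>X. (f p X)\<^sup>2))"
proof -
  have "avg (\<lambda>X. (\<Sum>p\<in>P. \<alpha> p * f p X)\<^sup>2)
      = (\<Sum>p\<in>P. \<Sum>q\<in>P. avg (\<lambda>X. (\<alpha> p * f p X) * (\<alpha> q * f q X)))"
    by (simp add: power2_eq_square sum_product avg_sum)
  also have "\<dots> = (\<Sum>p\<in>P. \<Sum>q\<in>P. if q = p then (\<alpha> p)\<^sup>2 * avg (\<lambda>X. (f p X)\<^sup>2) else 0)"
  proof (intro sum.cong refl)
    fix p q assume pq: "p \<in> P" "q \<in> P"
    have split: "avg (\<lambda>X. (\<alpha> p * f p X) * (\<alpha> q * f q X)) = \<alpha> p * \<alpha> q * avg (\<lambda>X. f p X * f q X)"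
      by (simp add: avg_mult_left[symmetric] mult_ac)
    show "avg (\<lambda>X. (\<alpha> p * f p X) * (\<alpha> q * f q X)) = (if q = p then (\<alpha> p)\<^sup>2 * avg (\<lambda>X. (f p X)\<^sup>2) else 0)"
      unfolding split using degenerate_orthogonal[OF deg[OF pq(1)] deg[OF pq(2)]]
      by (auto simp: power2_eq_square)
  qed
  also have "\<dots> = (\<Sum>p\<in>P. (\<alpha> p)\<^sup>2 * avg (\<lambda>X. (f p X)\<^sup>2))"
    using assms(1) by simp
  finally show ?thesis .
qed


subsection \<open>Hypercontractivity\<close>

text \<open>Plays the role of polynomials of degree at most \<open>d\<close> in the coordinates of
  \<open>U\<close>. Closure under sums is a rule rather than a normal form, so that no decomposition
  has to be chosen and proofs run over the summands.\<close>

inductive low_degree :: "nat \<Rightarrow> 'v set \<Rightarrow> (('v \<Rightarrow> nat) \<Rightarrow> real) \<Rightarrow> bool" for d U where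
  base: "S \<subseteq> U \<Longrightarrow> card S \<le> d \<Longrightarrow> depends S f \<Longrightarrow> low_degree d U f"
| add: "low_degree d U f \<Longrightarrow> low_degree d U g \<Longrightarrow> low_degree d U (\<lambda>X. f X + g X)"

lemma low_degree_sum:
  "finite P \<Longrightarrow> (\<And>p. p \<in> P \<Longrightarrow> low_degree d U (f p)) \<Longrightarrow> low_degree d U (\<lambda>X. \<Sum>p\<in>P. f p X)"
proof (induction P rule: finite_induct)
  case empty
  show ?case by (rule low_degree.base[of "{}"]) (auto simp: depends_def)
next
  case (insert p P)
  then show ?case by (simp add: low_degree.add)
qed

lemma low_degree_cavg:
  assumes "low_degree d (insert n U) f" "n \<in> V" "finite U"
  shows "low_degree d U (cavg n f)"
  using assms(1)
proof induction
  case (base S f)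
  then have "card (S - {n}) \<le> d" by (meson card_Diff1_le le_trans)
  moreover have "S - {n} \<subseteq> U" using base by auto
  ultimately show ?case using base assms depends_cavg by (intro low_degree.base[of "S - {n}"]) auto
next
  case (add f g)
  have "cavg n (\<lambda>X. f X + g X) = (\<lambda>X. cavg n f X + cavg n g X)" by (simp add: cavg_add fun_eq_iff)
  then show ?case using add by (simp add: low_degree.add)
qed

text \<open>Summands without the coordinate \<open>n\<close> cancel, and the others lose
  \<open>n\<close> once it is fixed. This drop in degree is what drives the induction in
  \<open>hypercontractive\<close>.\<close>

lemma low_degree_difference:
  assumes "low_degree (Suc d) (insert n U) f" "n \<in> V" "finite U" "a \<in> {1..c}"
  shows "low_degree d U (\<lambda>X. f (X(n := a)) - cavg n f X)"
  using assms(1)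
proof induction
  case (base S f)
  have finS: "finite S" using base assms by (meson finite.insertI finite_subset)
  show ?case
  proof (cases "n \<in> S")
    case True
    have "depends (S - {n}) (\<lambda>X. f (X(n := a)))"
      unfolding depends_def
      using assms by (auto intro!: dependsD[OF base(3)] coloring_upd)
    then have "depends (S - {n}) (\<lambda>X. f (X(n := a)) - cavg n f X)"
      using depends_cavg[OF base(3) assms(2)] unfolding depends_def by (metis (no_types, lifting))
    moreover have "S - {n} \<subseteq> U" using base(1) by blast
    moreover have "card (S - {n}) \<le> d" using True base(2) finS by simp
    ultimately show ?thesis by (intro low_degree.base)
  next
    case False
    have "f (X(n := a)) - cavg n f X = 0" if "X \<in> colorings" for X
    proof -
      have *: "f (X(n := b)) = f X" if "b \<in> {1..c}" for b
        using depends_upd[OF base(3) False \<open>X \<in> colorings\<close> assms(2) that] .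
      show ?thesis using *[OF assms(4)] cavg_const[of f X n "f X"] * by simp
    qed
    then have "depends {} (\<lambda>X. f (X(n := a)) - cavg n f X)"
      unfolding depends_def by (metis (no_types, lifting))
    then show ?thesis by (intro low_degree.base[of "{}"]) (simp_all del: fun_upd_apply)
  qed
next
  case (add f g)
  have "(\<lambda>X. (f (X(n := a)) + g (X(n := a))) - cavg n (\<lambda>X. f X + g X) X)
     = (\<lambda>X. (f (X(n := a)) - cavg n f X) + (g (X(n := a)) - cavg n g X))"
    by (simp add: cavg_add fun_eq_iff)
  then show ?case using low_degree.add[OF add.IH] by (simp only:)
qed

lemma low_degree_constant:
  assumes "low_degree d U f" "d = 0 \<or> U = {}" "finite U"
  shows "depends {} f"
  using assms(1)
proof induction
  case (base S f)
  then have "S = {}" using assms(2,3) by (auto dest: finite_subset)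
  then show ?case using base by simp
next
  case (add f g)
  show ?case
    unfolding depends_def
    by (intro ballI impI arg_cong2[where f = "(+)"] dependsD[OF add.IH(1)] dependsD[OF add.IH(2)]) simp_all
qed

lemma avg_depends_empty:
  assumes "depends {} f"
  shows "avg (\<lambda>X. (f X)^4) = (avg (\<lambda>X. (f X)\<^sup>2))\<^sup>2"
proof -
  obtain X0 where "X0 \<in> colorings" using colorings_nonempty by auto
  then have f: "f X = f X0" if "X \<in> colorings" for X
    by (rule dependsD[OF assms that]) simp_all
  have "avg (\<lambda>X. (f X)^n) = (f X0)^n" for n
    using avg_cong[of "\<lambda>X. (f X)^n" "\<lambda>_. (f X0)^n"] f by (simp add: avg_const)
  then show ?thesis by simp
qed

text \<open>The closing arithmetic of the induction below, used with \<open>M = 4 * real c\<close>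
  and \<open>k = real c\<close>: \<open>M \<ge> 4\<close> lets 8 M \<le> 2 M^2 absorb the mixed term
  into 2 G D, and M^2 \<ge> 3 k absorbs the fourth power of the increment.\<close>

lemma hypercontractive_step:
  fixes M :: real
  assumes "M \<ge> 4" "M\<^sup>2 \<ge> 3 * k" "0 \<le> G" "0 \<le> D" "k \<ge> 0"
  shows "M^(2 * Suc e) * G\<^sup>2 + 8 * (M^Suc e * M^e * (G * D)) + 3 * (k * M^(2*e) * D\<^sup>2)
    \<le> M^(2 * Suc e) * (G + D)\<^sup>2"
proof -
  have "8 * (M^Suc e * M^e * (G * D)) = (8 * M) * (M^(2*e) * (G * D))"
    by (simp add: power_add[symmetric] mult_2)
  also have "\<dots> \<le> (2 * M\<^sup>2) * (M^(2*e) * (G * D))"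
    using assms by (intro mult_right_mono) (auto simp: power2_eq_square)
  finally have 1: "8 * (M^Suc e * M^e * (G * D)) \<le> M^(2 * Suc e) * (2 * G * D)"
    by (simp add: power2_eq_square mult_ac)
  have "(3 * k) * (M^(2*e) * D\<^sup>2) \<le> M\<^sup>2 * (M^(2*e) * D\<^sup>2)"
    using assms by (intro mult_right_mono) auto
  then have 2: "3 * (k * M^(2*e) * D\<^sup>2) \<le> M^(2 * Suc e) * D\<^sup>2"
    by (simp add: power2_eq_square mult_ac)
  have "M^(2 * Suc e) * (G + D)\<^sup>2 = M^(2 * Suc e) * G\<^sup>2 + M^(2 * Suc e) * (2 * G * D) + M^(2 * Suc e) * D\<^sup>2"
    by (simp add: power2_sum algebra_simps)
  then show ?thesis using 1 2 by linarith
qed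

text \<open>Bonami's induction on the number of coordinates: for \<open>g = cavg n f\<close> and \<open>\<Delta> = f - g\<close> the
  term \<open>g\<^sup>3 \<Delta>\<close> averages to zero, and each \<open>\<Delta>(n := a)\<close> has smaller degree.\<close>

lemma hypercontractive:
  assumes "finite U" "U \<subseteq> V" "low_degree d U f"
  shows "avg (\<lambda>X. (f X)^4) \<le> (4 * real c)^(2 * d) * (avg (\<lambda>X. (f X)\<^sup>2))\<^sup>2"
  using assms
proof (induction U arbitrary: d f rule: finite_induct)
  case empty
  have "avg (\<lambda>X. (f X)^4) = (avg (\<lambda>X. (f X)\<^sup>2))\<^sup>2"
    using low_degree_constant[OF empty(2)] by (simp add: avg_depends_empty)
  moreover have "1 * (avg (\<lambda>X. (f X)\<^sup>2))\<^sup>2 \<le> (4 * real c)^(2 * d) * (avg (\<lambda>X. (f X)\<^sup>2))\<^sup>2"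
    using c_pos by (intro mult_right_mono one_le_power) auto
  ultimately show ?case by simp
next
  case (insert n U)
  have nV: "n \<in> V" and UV: "U \<subseteq> V" using insert by auto
  show ?case
  proof (cases d)
    case 0
    show ?thesis
      using low_degree_constant[OF insert(5)] 0 insert(1) by (simp add: avg_depends_empty)
  next
    case (Suc e)
    define M where "M = 4 * real c"
    have M4: "M \<ge> 4" using c_pos by (simp add: M_def)
    define g where "g = cavg n f"
    define \<Delta> where "\<Delta> X = f X - g X" for X
    define h where "h a X = f (X(n := a)) - cavg n f X" for a X
    have dg: "low_degree d U g" unfolding g_def using low_degree_cavg insert nV by blast
    have dh: "low_degree e U (h a)" if "a \<in> {1..c}" for a
      unfolding h_def using low_degree_difference[OF _ nV insert(1) that] insert(5) Suc by simp
    have \<Delta>h: "\<Delta> (X(n := a)) = h a X" and gu: "g (X(n := a)) = g X" for X a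
      unfolding \<Delta>_def h_def g_def by (simp_all add: cavg_upd)
    have \<Delta>0: "cavg n \<Delta> X = 0" for X
    proof -
      have "cavg n \<Delta> X = cavg n f X - cavg n g X"
        unfolding \<Delta>_def by (rule cavg_diff)
      also have "cavg n g X = g X" by (rule cavg_const) (simp add: gu)
      finally show ?thesis by (simp add: g_def)
    qed
    define G where "G = avg (\<lambda>X. (g X)\<^sup>2)"
    define D where "D = avg (\<lambda>X. (\<Delta> X)\<^sup>2)"
    have G0: "G \<ge> 0" and D0: "D \<ge> 0" unfolding G_def D_def by (auto intro: avg_nonneg)
    \<comment> \<open>Averaging over the color of \<open>n\<close> first leaves \<open>g\<close>
      alone and replaces \<Delta> by the functions \<open>h a\<close>, to which the induction
      hypothesis for degree \<open>e\<close> applies.\<close>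
    have avg\<Delta>: "avg (\<lambda>X. F (g X) (\<Delta> X)) = (\<Sum>a\<in>{1..c}. avg (\<lambda>X. F (g X) (h a X))) / real c" for F
    proof -
      have "avg (\<lambda>X. F (g X) (\<Delta> X)) = avg (cavg n (\<lambda>X. F (g X) (\<Delta> X)))"
        using nV by (simp add: avg_cavg)
      also have "\<dots> = avg (\<lambda>X. (1 / real c) * (\<Sum>a\<in>{1..c}. F (g X) (h a X)))"
        unfolding cavg_def by (simp add: \<Delta>h gu)
      also have "\<dots> = (1 / real c) * (\<Sum>a\<in>{1..c}. avg (\<lambda>X. F (g X) (h a X)))"
        by (simp only: avg_mult_left avg_sum)
      finally show ?thesis by simp
    qed
    define H where "H a = avg (\<lambda>X. (h a X)\<^sup>2)" for a
    have H0: "H a \<ge> 0" for a unfolding H_def by (auto intro: avg_nonneg)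
    have DH: "D = (\<Sum>a\<in>{1..c}. H a) / real c"
      unfolding D_def H_def using avg\<Delta>[of "\<lambda>x y. y\<^sup>2"] .
    have h4: "avg (\<lambda>X. (h a X)^4) \<le> M^(2*e) * (H a)\<^sup>2" if "a \<in> {1..c}" for a
      unfolding H_def M_def using insert.IH[OF UV dh[OF that]] .
    have g4: "avg (\<lambda>X. (g X)^4) \<le> M^(2*d) * G\<^sup>2"
      unfolding G_def M_def using insert.IH[OF UV dg] .
    have gh: "avg (\<lambda>X. (g X)\<^sup>2 * (h a X)\<^sup>2) \<le> M^d * M^e * (G * H a)" if "a \<in> {1..c}" for a
    proof (rule power2_le_imp_le)
      have "(avg (\<lambda>X. (g X)\<^sup>2 * (h a X)\<^sup>2))\<^sup>2 \<le> avg (\<lambda>X. (g X)^4) * avg (\<lambda>X. (h a X)^4)"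
        using avg_cauchy[of "\<lambda>X. (g X)\<^sup>2" "\<lambda>X. (h a X)\<^sup>2"] by (simp add: power_mult[symmetric])
      also have "\<dots> \<le> (M^(2*d) * G\<^sup>2) * (M^(2*e) * (H a)\<^sup>2)"
        using h4[OF that] g4 M4 by (intro mult_mono) (auto intro: avg_nonneg)
      also have "\<dots> = (M^d * M^e * (G * H a))\<^sup>2"
        by (simp add: power_mult_distrib power_mult[symmetric] mult_ac)
      finally show "(avg (\<lambda>X. (g X)\<^sup>2 * (h a X)\<^sup>2))\<^sup>2 \<le> (M^d * M^e * (G * H a))\<^sup>2" .
      show "0 \<le> M^d * M^e * (G * H a)" using M4 G0 H0 by simp
    qed
    have g2\<Delta>2: "avg (\<lambda>X. (g X)\<^sup>2 * (\<Delta> X)\<^sup>2) \<le> M^d * M^e * (G * D)"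
    proof -
      have "avg (\<lambda>X. (g X)\<^sup>2 * (\<Delta> X)\<^sup>2) \<le> (\<Sum>a\<in>{1..c}. M^d * M^e * (G * H a)) / real c"
        unfolding avg\<Delta>[of "\<lambda>x y. x\<^sup>2 * y\<^sup>2"] using gh by (intro divide_right_mono sum_mono) auto
      then show ?thesis unfolding DH by (simp add: sum_distrib_left)
    qed
    have \<Delta>4: "avg (\<lambda>X. (\<Delta> X)^4) \<le> real c * M^(2*e) * D\<^sup>2"
    proof -
      have "avg (\<lambda>X. (\<Delta> X)^4) \<le> (\<Sum>a\<in>{1..c}. M^(2*e) * (H a)\<^sup>2) / real c"
        unfolding avg\<Delta>[of "\<lambda>x y. y^4"] using h4 by (intro divide_right_mono sum_mono) auto
      also have "\<dots> = M^(2*e) * (\<Sum>a\<in>{1..c}. (H a)\<^sup>2) / real c" by (simp add: sum_distrib_left)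
      \<comment> \<open>A sum of squares of nonnegative numbers is at most the square of their sum.
        This crude step costs the factor \<open>c\<close> that the choice of \<open>M\<close> pays
        for.\<close>
      also have "\<dots> \<le> M^(2*e) * (real c * D)\<^sup>2 / real c"
      proof (intro divide_right_mono mult_left_mono)
        have "(\<Sum>a\<in>{1..c}. (H a)\<^sup>2) \<le> (\<Sum>a\<in>{1..c}. H a * (\<Sum>b\<in>{1..c}. H b))"
          unfolding power2_eq_square using H0
          by (intro sum_mono mult_left_mono member_le_sum) auto
        also have "\<dots> = (\<Sum>a\<in>{1..c}. H a)\<^sup>2" by (simp add: sum_distrib_right power2_eq_square)
        also have "(\<Sum>a\<in>{1..c}. H a) = real c * D" unfolding DH using c_pos by simp
        finally show "(\<Sum>a\<in>{1..c}. (H a)\<^sup>2) \<le> (real c * D)\<^sup>2" .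
      qed (use M4 in auto)
      also have "\<dots> = real c * M^(2*e) * D\<^sup>2" using c_pos by (simp add: power2_eq_square)
      finally show ?thesis .
    qed
    have cube: "avg (\<lambda>X. (g X)^3 * \<Delta> X) = 0"
      by (rule cavg_zero_imp_avg_mult_zero[OF nV]) (simp_all add: \<Delta>0 gu)
    have cross: "avg (\<lambda>X. g X * \<Delta> X) = 0"
      by (rule cavg_zero_imp_avg_mult_zero[OF nV]) (simp_all add: \<Delta>0 gu)
    have f2: "avg (\<lambda>X. (f X)\<^sup>2) = G + D"
    proof -
      have "avg (\<lambda>X. (f X)\<^sup>2) = avg (\<lambda>X. (g X)\<^sup>2 + (\<Delta> X)\<^sup>2 + 2 * (g X * \<Delta> X))"
        unfolding \<Delta>_def by (intro avg_cong) (simp add: power2_eq_square algebra_simps)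
      then show ?thesis using cross by (simp add: avg_add avg_mult_left G_def D_def)
    qed
    have "avg (\<lambda>X. (f X)^4)
        \<le> avg (\<lambda>X. (g X)^4 + 4 * ((g X)^3 * \<Delta> X) + 8 * ((g X)\<^sup>2 * (\<Delta> X)\<^sup>2) + 3 * (\<Delta> X)^4)"
    proof (rule avg_mono)
      fix X
      have f: "f X = g X + \<Delta> X" by (simp add: \<Delta>_def)
      \<comment> \<open>The added square is chosen to cancel the term 4 g \<Delta>^3, whose sign is
        unknown; it raises the coefficients 6 and 1 to 8 and 3.\<close>
      have "(f X)^4 \<le> (f X)^4 + 2 * ((g X - \<Delta> X)\<^sup>2 * (\<Delta> X)\<^sup>2)" by simp
      also have "\<dots> = (g X)^4 + 4 * ((g X)^3 * \<Delta> X) + 8 * ((g X)\<^sup>2 * (\<Delta> X)\<^sup>2) + 3 * (\<Delta> X)^4"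
        unfolding f by (simp add: power2_eq_square power3_eq_cube power4_eq_xxxx algebra_simps)
      finally show "(f X)^4 \<le> (g X)^4 + 4 * ((g X)^3 * \<Delta> X) + 8 * ((g X)\<^sup>2 * (\<Delta> X)\<^sup>2) + 3 * (\<Delta> X)^4" .
    qed
    also have "\<dots> = avg (\<lambda>X. (g X)^4) + 8 * avg (\<lambda>X. (g X)\<^sup>2 * (\<Delta> X)\<^sup>2) + 3 * avg (\<lambda>X. (\<Delta> X)^4)"
      using cube by (simp add: avg_add avg_mult_left)
    also have "\<dots> \<le> M^(2*d) * G\<^sup>2 + 8 * (M^d * M^e * (G * D)) + 3 * (real c * M^(2*e) * D\<^sup>2)"
      using g4 g2\<Delta>2 \<Delta>4 by linarith
    also have "\<dots> \<le> M^(2*d) * (G + D)\<^sup>2"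
      unfolding Suc using M4 G0 D0 c_pos
      by (intro hypercontractive_step) (auto simp: M_def power2_eq_square)
    finally show ?thesis by (simp add: f2 M_def)
  qed
qed

end


subsection \<open>The normal distribution function\<close>

abbreviation Phi :: "real \<Rightarrow> real" where "Phi \<equiv> cdf std_normal_distribution"

lemma std_normal_density_le_1: "std_normal_density x \<le> 1"
proof -
  have "1 \<le> sqrt (2 * pi)" using pi_ge_two by (simp add: real_le_rsqrt)
  then show ?thesis
    unfolding std_normal_density_def
    by (intro mult_le_one) (auto simp: divide_le_eq_1)
qed

lemma std_normal_density_DERIV:
  "(std_normal_density has_real_derivative - x * std_normal_density x) (at x)"
proof -
  have "((\<lambda>x. exp (- x\<^sup>2 / 2)) has_real_derivative - x * exp (- x\<^sup>2 / 2)) (at x)"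
    by (auto intro!: derivative_eq_intros)
  from DERIV_cmult[OF this, of "1 / sqrt (2 * pi)"] show ?thesis
    unfolding std_normal_density_def by (simp add: mult_ac)
qed

text \<open>One estimate for both the first and the second derivative of the density, which are
  bounded in the next two lemmas: 1 + y^2 \<le> 2 exp (y^2 / 2), and 2 is below the normalizing
  constant.\<close>

lemma std_normal_density_quadratic_le: "(1 + y\<^sup>2) * std_normal_density y \<le> 1"
proof -
  have "1 + y\<^sup>2 \<le> 2 * (1 + y\<^sup>2 / 2)" by simp
  also have "\<dots> \<le> 2 * exp (y\<^sup>2 / 2)" by (intro mult_left_mono exp_ge_add_one_self) simp
  finally have "(1 + y\<^sup>2) * exp (- y\<^sup>2 / 2) \<le> 2"
    by (simp add: exp_minus field_simps)
  moreover have "2 \<le> sqrt (2 * pi)"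
    using pi_ge_two by (simp add: real_le_rsqrt)
  ultimately have "(1 + y\<^sup>2) * exp (- y\<^sup>2 / 2) \<le> sqrt (2 * pi)" by linarith
  then show ?thesis unfolding std_normal_density_def by (simp add: field_simps)
qed

lemma abs_mult_std_normal_density_le: "\<bar>y\<bar> * std_normal_density y \<le> 1"
proof -
  have "\<bar>y\<bar> \<le> 1 + y\<^sup>2"
    using sum_squares_bound[of 1 "\<bar>y\<bar>"] by (auto simp: power2_eq_square abs_if)
  then have "\<bar>y\<bar> * std_normal_density y \<le> (1 + y\<^sup>2) * std_normal_density y"
    by (rule mult_right_mono) simp
  then show ?thesis using std_normal_density_quadratic_le[of y] by linarith
qed

lemma abs_square_minus_1_mult_std_normal_density_le: "\<bar>y\<^sup>2 - 1\<bar> * std_normal_density y \<le> 1"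
proof -
  have "\<bar>y\<^sup>2 - 1\<bar> \<le> 1 + y\<^sup>2" by (simp add: abs_le_iff)
  then have "\<bar>y\<^sup>2 - 1\<bar> * std_normal_density y \<le> (1 + y\<^sup>2) * std_normal_density y"
    by (rule mult_right_mono) simp
  then show ?thesis using std_normal_density_quadratic_le[of y] by linarith
qed

lemma Phi_diff:
  assumes "a \<le> b"
  shows "Phi b - Phi a = integral {a..b} std_normal_density"
proof -
  interpret real_distribution std_normal_distribution by (rule real_dist_normal_dist)
  have cont: "continuous_on {a..b} std_normal_density"
    unfolding std_normal_density_def by (intro continuous_intros) auto
  have "Phi b - Phi a = measure std_normal_distribution {a<..b}"
  proof (cases "a = b")
    case False then show ?thesis using assms by (intro cdf_diff_eq) auto
  qed simp
  also have "\<dots> = (LINT x | std_normal_distribution. indicator {a<..b} x)" by simp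
  also have "\<dots> = (LINT x | lborel. std_normal_density x * indicator {a<..b} x)"
    by (subst integral_density) auto
  also have "\<dots> = (LINT x | lborel. indicator {a..b} x * std_normal_density x)"
    by (rule integral_cong_AE)
       (auto simp: indicator_def intro!: eventually_mono[OF AE_lborel_singleton[of a]])
  also have "\<dots> = integral {a..b} std_normal_density"
    using set_borel_integral_eq_integral(2)[OF borel_integrable_atLeastAtMost'[OF cont]]
    by (simp add: set_lebesgue_integral_def)
  finally show ?thesis .
qed

lemma Phi_DERIV: "(Phi has_real_derivative std_normal_density x) (at x)"
proof -
  have cont: "continuous_on {x-1..x+1} std_normal_density"
    unfolding std_normal_density_def by (intro continuous_intros) auto
  have "((\<lambda>u. integral {x-1..u} std_normal_density) has_real_derivative std_normal_density x)
      (at x within {x-1..x+1})"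
    by (rule integral_has_real_derivative[OF cont]) simp
  then have "((\<lambda>u. integral {x-1..u} std_normal_density) has_real_derivative std_normal_density x) (at x)"
    by (simp add: at_within_Icc_at)
  then have "((\<lambda>u. Phi (x-1) + integral {x-1..u} std_normal_density) has_real_derivative std_normal_density x) (at x)"
    by (auto intro!: derivative_eq_intros)
  moreover have "\<forall>\<^sub>F u in nhds x. Phi (x-1) + integral {x-1..u} std_normal_density = Phi u"
  proof -
    have "\<forall>\<^sub>F u in nhds x. u > x - 1"
      using eventually_nhds_in_open[of "{x - 1<..}" x] by simp
    then show ?thesis
    proof eventually_elim
      case (elim u)
      then show ?case using Phi_diff[of "x - 1" u] by simp
    qed
  qed
  ultimately show ?thesis
    using DERIV_cong_ev[OF refl, of "\<lambda>u. Phi (x-1) + integral {x-1..u} std_normal_density" Phi x] by simp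
qed

lemma Phi_mono: "x \<le> y \<Longrightarrow> Phi x \<le> Phi y"
proof -
  interpret real_distribution std_normal_distribution by (rule real_dist_normal_dist)
  show "x \<le> y \<Longrightarrow> Phi x \<le> Phi y" by (rule cdf_nondecreasing)
qed

lemma Phi_bounds: "0 \<le> Phi x" "Phi x \<le> 1"
proof -
  interpret real_distribution std_normal_distribution by (rule real_dist_normal_dist)
  show "0 \<le> Phi x" "Phi x \<le> 1" by (rule cdf_nonneg, rule cdf_bounded_prob)
qed

lemma Phi_lipschitz: "\<bar>Phi x - Phi y\<bar> \<le> \<bar>x - y\<bar>"
  using field_differentiable_bound[of UNIV Phi std_normal_density 1 x y]
  by (simp add: Phi_DERIV std_normal_density_le_1)

text \<open>Chebyshev's inequality for variance 1. The polynomial tail suffices because it is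
  applied at a = 2 / \<rho>, where it is below \<rho>^2.\<close>

lemma Phi_tail:
  assumes "a > 0" shows "Phi (- a) \<le> 1 / a\<^sup>2" "1 - Phi a \<le> 1 / a\<^sup>2"
proof -
  interpret real_distribution std_normal_distribution by (rule real_dist_normal_dist)
  have mean: "expectation (\<lambda>x. x) = 0"
    using integral_std_normal_distribution_moment_odd[of 1] by simp
  have second: "expectation (\<lambda>x. x\<^sup>2) = 1"
    using std_normal_distribution_even_moments(1)[of 1] by simp
  have "prob {x \<in> space std_normal_distribution. a \<le> \<bar>x - expectation (\<lambda>x. x)\<bar>}
      \<le> variance (\<lambda>x. x) / a\<^sup>2"
    using std_normal_distribution_even_moments(2)[of 1] assms
    by (intro Chebyshev_inequality) auto
  then have tail: "prob {x. a \<le> \<bar>x\<bar>} \<le> 1 / a\<^sup>2" by (simp add: mean second)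
  have "Phi (- a) \<le> prob {x. a \<le> \<bar>x\<bar>}"
    unfolding cdf_def2 by (intro finite_measure_mono) auto
  then show "Phi (- a) \<le> 1 / a\<^sup>2" using tail by linarith
  have "1 - Phi a = prob (space std_normal_distribution - {..a})"
    unfolding cdf_def2 by (subst prob_compl) auto
  also have "\<dots> \<le> prob {x. a \<le> \<bar>x\<bar>}" by (intro finite_measure_mono) auto
  finally show "1 - Phi a \<le> 1 / a\<^sup>2" using tail by linarith
qed


subsection \<open>Stein's method\<close>

context color_space
begin

lemma cavg_square_le: "(cavg i f X)\<^sup>2 \<le> cavg i (\<lambda>X. (f X)\<^sup>2) X"
proof -
  have "(\<Sum>a\<in>{1..c}. f (X(i := a)) * 1)\<^sup>2 \<le> (\<Sum>a\<in>{1..c}. (f (X(i := a)))\<^sup>2) * (\<Sum>a\<in>{1..c}. 1\<^sup>2)"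
    by (rule Cauchy_Schwarz_ineq_sum)
  then show ?thesis
    unfolding cavg_def using c_pos by (simp add: field_simps power2_eq_square)
qed

text \<open>The discrepancy in Stein's characterization of the normal law, against test functions
  with bounded Lipschitz derivative. \<open>A\<close> will measure how far the conditional variance
  is from 1, and \<open>B\<close> the Taylor remainder.\<close>

definition stein_bounded :: "real \<Rightarrow> real \<Rightarrow> (('v \<Rightarrow> nat) \<Rightarrow> real) \<Rightarrow> bool" where
  "stein_bounded A B W \<longleftrightarrow> (\<forall>G G' M1 M2.
     (\<forall>x. (G has_real_derivative G' x) (at x)) \<longrightarrow> (\<forall>x. \<bar>G' x\<bar> \<le> M1) \<longrightarrow>
     (\<forall>x y. \<bar>G' x - G' y\<bar> \<le> M2 * \<bar>x - y\<bar>) \<longrightarrow>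
     \<bar>avg (\<lambda>X. G' (W X)) - avg (\<lambda>X. W X * G (W X))\<bar> \<le> M1 * A + M2 * B)"

lemma stein_bounded_mono:
  assumes "stein_bounded A B W" "A \<le> A'" "B \<le> B'" shows "stein_bounded A' B' W"
  unfolding stein_bounded_def
proof (intro allI impI)
  fix G G' :: "real \<Rightarrow> real" and M1 M2
  assume a: "\<forall>x. (G has_real_derivative G' x) (at x)" "\<forall>x. \<bar>G' x\<bar> \<le> M1"
     "\<forall>x y. \<bar>G' x - G' y\<bar> \<le> M2 * \<bar>x - y\<bar>"
  have "M1 \<ge> 0" using a(2) by (meson abs_ge_zero order_trans)
  moreover have "M2 \<ge> 0" using a(3)[rule_format, of 0 1] by (auto intro: order_trans[OF abs_ge_zero])
  ultimately have "M1 * A + M2 * B \<le> M1 * A' + M2 * B'"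
    using assms by (intro add_mono mult_left_mono) auto
  moreover have "\<bar>avg (\<lambda>X. G' (W X)) - avg (\<lambda>X. W X * G (W X))\<bar> \<le> M1 * A + M2 * B"
    using assms(1) a unfolding stein_bounded_def by blast
  ultimately show "\<bar>avg (\<lambda>X. G' (W X)) - avg (\<lambda>X. W X * G (W X))\<bar> \<le> M1 * A' + M2 * B'"
    by linarith
qed

text \<open>Put U = cavg i W. Since \<open>D i\<close> averages to 0 over the color of
  \<open>i\<close>, the term \<open>D i\<close> * G(W) may be replaced by \<open>D i\<close> * (G(W)
  - G(U)), whose linear part \<open>D i\<close> * \<open>L i\<close> * G'(U) averages to \<Gamma> i
  * G'(U). The Taylor remainder and the return from G'(U) to G'(W) cost the same amount, hence the
  factor 2.\<close>

lemma stein_bounded_martingale: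
  assumes W: "\<And>X. X \<in> colorings \<Longrightarrow> W X = (\<Sum>i\<in>V. D i X)"
    and D0: "\<And>i X. i \<in> V \<Longrightarrow> X \<in> colorings \<Longrightarrow> cavg i (D i) X = 0"
  defines "L \<equiv> \<lambda>i X. W X - cavg i W X"
  defines "\<Gamma> \<equiv> \<lambda>i. cavg i (\<lambda>X. D i X * L i X)"
  shows "stein_bounded (sqrt (avg (\<lambda>X. (1 - (\<Sum>i\<in>V. \<Gamma> i X))\<^sup>2)))
    (2 * (\<Sum>i\<in>V. sqrt (avg (\<lambda>X. (D i X)\<^sup>2)) * sqrt (avg (\<lambda>X. (L i X)^4)))) W"
  unfolding stein_bounded_def
proof (intro allI impI)
  fix G G' :: "real \<Rightarrow> real" and M1 M2
  assume dG: "\<forall>x. (G has_real_derivative G' x) (at x)" and G'b: "\<forall>x. \<bar>G' x\<bar> \<le> M1"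
    and lip: "\<forall>x y. \<bar>G' x - G' y\<bar> \<le> M2 * \<bar>x - y\<bar>"
  have M1: "M1 \<ge> 0" using G'b by (meson abs_ge_zero order_trans)
  have M2: "M2 \<ge> 0" using lip[rule_format, of 0 1] by (auto intro: order_trans[OF abs_ge_zero])
  have taylor: "\<bar>G u - G v - (u - v) * G' v\<bar> \<le> M2 * (u - v)\<^sup>2" for u v
  proof (cases "u = v")
    case False
    have "\<exists>z. \<bar>z - v\<bar> \<le> \<bar>u - v\<bar> \<and> G u - G v = (u - v) * G' z"
    proof (cases "u < v")
      case True
      from MVT2[OF True, of G G'] dG obtain z where "u < z" "z < v" "G v - G u = (v - u) * G' z" by blast
      then show ?thesis by (intro exI[of _ z]) (auto simp: algebra_simps)
    next
      case F: False
      then have "v < u" using False by simp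
      from MVT2[OF this, of G G'] dG obtain z where "v < z" "z < u" "G u - G v = (u - v) * G' z" by blast
      then show ?thesis by (intro exI[of _ z]) auto
    qed
    then obtain z where z: "\<bar>z - v\<bar> \<le> \<bar>u - v\<bar>" "G u - G v = (u - v) * G' z" by blast
    have "\<bar>G u - G v - (u - v) * G' v\<bar> = \<bar>u - v\<bar> * \<bar>G' z - G' v\<bar>"
      unfolding z(2) by (simp add: abs_mult[symmetric] right_diff_distrib)
    also have "\<dots> \<le> \<bar>u - v\<bar> * (M2 * \<bar>u - v\<bar>)"
      using lip M2 z(1) by (intro mult_left_mono order.trans[OF lip[rule_format]]) auto
    also have "\<dots> = M2 * (u - v)\<^sup>2" by (simp add: mult.left_commute[of _ M2] power2_eq_square)
    finally show ?thesis .
  qed simp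
  define s where "s i = sqrt (avg (\<lambda>X. (D i X)\<^sup>2)) * sqrt (avg (\<lambda>X. (L i X)^4))" for i
  have step: "\<bar>avg (\<lambda>X. D i X * G (W X)) - avg (\<lambda>X. \<Gamma> i X * G' (W X))\<bar> \<le> 2 * M2 * s i"
    if i: "i \<in> V" for i
  proof -
    define U where "U = cavg i W"
    have Uu: "U (X(i := a)) = U X" for X a unfolding U_def by (rule cavg_upd)
    have WU: "W X = U X + L i X" for X unfolding L_def U_def by simp
    have z1: "avg (\<lambda>X. G (U X) * D i X) = 0"
      by (rule cavg_zero_imp_avg_mult_zero[OF i]) (simp_all add: D0[OF i] Uu)
    have z2: "avg (\<lambda>X. G' (U X) * (D i X * L i X)) = avg (\<lambda>X. G' (U X) * \<Gamma> i X)"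
    proof -
      have "avg (\<lambda>X. G' (U X) * (D i X * L i X)) = avg (cavg i (\<lambda>X. G' (U X) * (D i X * L i X)))"
        using i by (simp add: avg_cavg)
      also have "cavg i (\<lambda>X. G' (U X) * (D i X * L i X)) = (\<lambda>X. G' (U X) * \<Gamma> i X)"
        unfolding \<Gamma>_def by (rule ext, rule cavg_mult) (simp add: Uu)
      finally show ?thesis .
    qed
    have e: "avg (\<lambda>X. D i X * G (W X)) - avg (\<lambda>X. \<Gamma> i X * G' (W X))
       = avg (\<lambda>X. D i X * (G (W X) - G (U X) - (W X - U X) * G' (U X)))
       + avg (\<lambda>X. \<Gamma> i X * (G' (U X) - G' (W X)))"
    proof -
      have "avg (\<lambda>X. D i X * (G (W X) - G (U X) - (W X - U X) * G' (U X)))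
        = avg (\<lambda>X. D i X * G (W X)) - avg (\<lambda>X. G (U X) * D i X) - avg (\<lambda>X. G' (U X) * (D i X * L i X))"
        unfolding avg_diff[symmetric] by (intro avg_cong) (simp add: WU algebra_simps)
      moreover have "avg (\<lambda>X. \<Gamma> i X * (G' (U X) - G' (W X)))
        = avg (\<lambda>X. G' (U X) * \<Gamma> i X) - avg (\<lambda>X. \<Gamma> i X * G' (W X))"
        unfolding avg_diff[symmetric] by (intro avg_cong) (simp add: algebra_simps)
      ultimately show ?thesis using z1 z2 by simp
    qed
    have b1: "\<bar>avg (\<lambda>X. D i X * (G (W X) - G (U X) - (W X - U X) * G' (U X)))\<bar> \<le> M2 * s i"
    proof -
      have "\<bar>avg (\<lambda>X. D i X * (G (W X) - G (U X) - (W X - U X) * G' (U X)))\<bar>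
         \<le> avg (\<lambda>X. M2 * (\<bar>D i X\<bar> * (L i X)\<^sup>2))"
      proof (rule order.trans[OF avg_abs avg_mono])
        fix X
        have "\<bar>D i X\<bar> * \<bar>G (W X) - G (U X) - (W X - U X) * G' (U X)\<bar> \<le> \<bar>D i X\<bar> * (M2 * (L i X)\<^sup>2)"
          using taylor[of "W X" "U X"] by (intro mult_left_mono) (auto simp: WU)
        then show "\<bar>D i X * (G (W X) - G (U X) - (W X - U X) * G' (U X))\<bar> \<le> M2 * (\<bar>D i X\<bar> * (L i X)\<^sup>2)"
          by (simp add: abs_mult mult_ac)
      qed
      also have "\<dots> = M2 * avg (\<lambda>X. \<bar>D i X\<bar> * (L i X)\<^sup>2)" by (rule avg_mult_left)
      also have "\<dots> \<le> M2 * s i"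
        using avg_cauchy_sqrt[of "\<lambda>X. \<bar>D i X\<bar>" "\<lambda>X. (L i X)\<^sup>2"] M2
        by (intro mult_left_mono) (simp_all add: s_def power_mult[symmetric])
      finally show ?thesis .
    qed
    have b2: "\<bar>avg (\<lambda>X. \<Gamma> i X * (G' (U X) - G' (W X)))\<bar> \<le> M2 * s i"
    proof -
      define a where "a = cavg i (\<lambda>X. \<bar>L i X\<bar>)"
      define b where "b = cavg i (\<lambda>X. \<bar>D i X * L i X\<bar>)"
      have au: "a (X(i := k)) = a X" and bu: "b (X(i := k)) = b X" for X k
        unfolding a_def b_def by (rule cavg_upd)+
      have "\<bar>avg (\<lambda>X. \<Gamma> i X * (G' (U X) - G' (W X)))\<bar> \<le> avg (\<lambda>X. M2 * (b X * \<bar>L i X\<bar>))"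
      proof (rule order.trans[OF avg_abs avg_mono])
        fix X
        have "\<bar>\<Gamma> i X\<bar> * \<bar>G' (U X) - G' (W X)\<bar> \<le> b X * (M2 * \<bar>L i X\<bar>)"
        proof (rule mult_mono)
          show "\<bar>\<Gamma> i X\<bar> \<le> b X" unfolding \<Gamma>_def b_def by (rule cavg_abs)
          then show "0 \<le> b X" by linarith
          show "\<bar>G' (U X) - G' (W X)\<bar> \<le> M2 * \<bar>L i X\<bar>"
            using lip[rule_format, of "U X" "W X"] by (simp add: WU)
        qed simp
        then show "\<bar>\<Gamma> i X * (G' (U X) - G' (W X))\<bar> \<le> M2 * (b X * \<bar>L i X\<bar>)"
          by (simp add: abs_mult mult_ac)
      qed
      also have "\<dots> = M2 * avg (\<lambda>X. b X * \<bar>L i X\<bar>)" by (rule avg_mult_left)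
      \<comment> \<open>Neither \<open>a\<close> nor \<open>b\<close> involves the color of
        \<open>i\<close>, so the conditional average can be moved from one factor to the other. This
        frees the single factor \<open>D i\<close>, which then enters only through its second
        moment.\<close>
      also have "avg (\<lambda>X. b X * \<bar>L i X\<bar>) = avg (\<lambda>X. b X * a X)"
      proof -
        have "avg (\<lambda>X. b X * \<bar>L i X\<bar>) = avg (cavg i (\<lambda>X. b X * \<bar>L i X\<bar>))"
          using i by (simp add: avg_cavg)
        also have "cavg i (\<lambda>X. b X * \<bar>L i X\<bar>) = (\<lambda>X. b X * a X)"
          unfolding a_def by (rule ext, rule cavg_mult) (simp add: bu)
        finally show ?thesis .
      qed
      also have "\<dots> = avg (\<lambda>X. a X * \<bar>D i X * L i X\<bar>)"
      proof -
        have "avg (\<lambda>X. a X * \<bar>D i X * L i X\<bar>) = avg (cavg i (\<lambda>X. a X * \<bar>D i X * L i X\<bar>))"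
          using i by (simp add: avg_cavg)
        also have "cavg i (\<lambda>X. a X * \<bar>D i X * L i X\<bar>) = (\<lambda>X. b X * a X)"
        proof
          fix X
          have "cavg i (\<lambda>X. a X * \<bar>D i X * L i X\<bar>) X = a X * b X"
            unfolding b_def by (rule cavg_mult) (simp add: au)
          then show "cavg i (\<lambda>X. a X * \<bar>D i X * L i X\<bar>) X = b X * a X" by simp
        qed
        finally show ?thesis by simp
      qed
      also have "\<dots> = avg (\<lambda>X. \<bar>D i X\<bar> * (\<bar>L i X\<bar> * a X))"
        by (intro avg_cong) (simp add: abs_mult mult_ac)
      also have "M2 * \<dots> \<le> M2 * s i"
      proof (rule mult_left_mono[OF _ M2])
        have "avg (\<lambda>X. \<bar>D i X\<bar> * (\<bar>L i X\<bar> * a X))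
          \<le> sqrt (avg (\<lambda>X. (D i X)\<^sup>2)) * sqrt (avg (\<lambda>X. (\<bar>L i X\<bar> * a X)\<^sup>2))"
          using avg_cauchy_sqrt[of "\<lambda>X. \<bar>D i X\<bar>" "\<lambda>X. \<bar>L i X\<bar> * a X"] by simp
        \<comment> \<open>The product of squares is at most the mean of the fourth powers, and a^4
          is at most the conditional average of L^4 by Jensen's inequality, used twice.\<close>
        also have "avg (\<lambda>X. (\<bar>L i X\<bar> * a X)\<^sup>2) \<le> avg (\<lambda>X. (L i X)^4)"
        proof -
          have "avg (\<lambda>X. (\<bar>L i X\<bar> * a X)\<^sup>2) \<le> avg (\<lambda>X. (1/2) * (L i X)^4 + (1/2) * (a X)^4)"
          proof (rule avg_mono)
            fix X show "(\<bar>L i X\<bar> * a X)\<^sup>2 \<le> (1/2) * (L i X)^4 + (1/2) * (a X)^4"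
              using sum_squares_bound[of "(L i X)\<^sup>2" "(a X)\<^sup>2"]
              by (simp add: power_mult_distrib power_mult[symmetric])
          qed
          also have "\<dots> = (1/2) * avg (\<lambda>X. (L i X)^4) + (1/2) * avg (\<lambda>X. (a X)^4)"
            by (simp only: avg_add avg_mult_left)
          also have "avg (\<lambda>X. (a X)^4) \<le> avg (cavg i (\<lambda>X. (L i X)^4))"
          proof (rule avg_mono)
            fix X
            have "(a X)\<^sup>2 \<le> cavg i (\<lambda>X. (L i X)\<^sup>2) X"
              unfolding a_def using cavg_square_le[of i "\<lambda>X. \<bar>L i X\<bar>" X] by simp
            then have "((a X)\<^sup>2)\<^sup>2 \<le> (cavg i (\<lambda>X. (L i X)\<^sup>2) X)\<^sup>2" by (intro power_mono) auto
            also have "\<dots> \<le> cavg i (\<lambda>X. (L i X)^4) X"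
              using cavg_square_le[of i "\<lambda>X. (L i X)\<^sup>2" X] by (simp add: power_mult[symmetric])
            finally show "(a X)^4 \<le> cavg i (\<lambda>X. (L i X)^4) X" by (simp add: power_mult[symmetric])
          qed
          also have "avg (cavg i (\<lambda>X. (L i X)^4)) = avg (\<lambda>X. (L i X)^4)" using i by (rule avg_cavg)
          finally show ?thesis by simp
        qed
        finally show "avg (\<lambda>X. \<bar>D i X\<bar> * (\<bar>L i X\<bar> * a X)) \<le> s i"
          unfolding s_def by (simp add: mult_left_mono avg_nonneg)
      qed
      finally show ?thesis .
    qed
    show ?thesis unfolding e using b1 b2 by linarith
  qed
  have WG: "avg (\<lambda>X. W X * G (W X)) = (\<Sum>i\<in>V. avg (\<lambda>X. D i X * G (W X)))"
    unfolding avg_sum[symmetric] sum_distrib_right[symmetric] by (intro avg_cong) (simp add: W)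
  have \<Gamma>G: "avg (\<lambda>X. (\<Sum>i\<in>V. \<Gamma> i X) * G' (W X)) = (\<Sum>i\<in>V. avg (\<lambda>X. \<Gamma> i X * G' (W X)))"
    unfolding avg_sum[symmetric] sum_distrib_right[symmetric] ..
  have "\<bar>avg (\<lambda>X. W X * G (W X)) - avg (\<lambda>X. (\<Sum>i\<in>V. \<Gamma> i X) * G' (W X))\<bar> \<le> (\<Sum>i\<in>V. 2 * M2 * s i)"
    unfolding WG \<Gamma>G sum_subtractf[symmetric] using step
    by (intro order.trans[OF sum_abs] sum_mono) auto
  moreover have "\<bar>avg (\<lambda>X. G' (W X)) - avg (\<lambda>X. (\<Sum>i\<in>V. \<Gamma> i X) * G' (W X))\<bar>
      \<le> M1 * sqrt (avg (\<lambda>X. (1 - (\<Sum>i\<in>V. \<Gamma> i X))\<^sup>2))"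
  proof -
    have "avg (\<lambda>X. G' (W X)) - avg (\<lambda>X. (\<Sum>i\<in>V. \<Gamma> i X) * G' (W X))
        = avg (\<lambda>X. (1 - (\<Sum>i\<in>V. \<Gamma> i X)) * G' (W X))"
      unfolding avg_diff[symmetric] by (simp add: left_diff_distrib)
    also have "\<bar>\<dots>\<bar> \<le> avg (\<lambda>X. M1 * \<bar>1 - (\<Sum>i\<in>V. \<Gamma> i X)\<bar>)"
      using G'b by (intro order.trans[OF avg_abs avg_mono]) (simp add: abs_mult mult.commute[of "\<bar>1 - _\<bar>"] mult_right_mono)
    also have "\<dots> = M1 * avg (\<lambda>X. \<bar>1 - (\<Sum>i\<in>V. \<Gamma> i X)\<bar>)" by (rule avg_mult_left)
    also have "\<dots> \<le> M1 * sqrt (avg (\<lambda>X. (1 - (\<Sum>i\<in>V. \<Gamma> i X))\<^sup>2))"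
      using M1 by (intro mult_left_mono avg_abs_le_sqrt)
    finally show ?thesis .
  qed
  ultimately show "\<bar>avg (\<lambda>X. G' (W X)) - avg (\<lambda>X. W X * G (W X))\<bar>
     \<le> M1 * sqrt (avg (\<lambda>X. (1 - (\<Sum>i\<in>V. \<Gamma> i X))\<^sup>2)) +
       M2 * (2 * (\<Sum>i\<in>V. sqrt (avg (\<lambda>X. (D i X)\<^sup>2)) * sqrt (avg (\<lambda>X. (L i X)^4))))"
    unfolding s_def[symmetric] by (simp only: sum_distrib_left[symmetric])
qed

section \<open>From Stein's discrepancy to distribution functions\<close>

lemma avg_DERIV:
  assumes "\<And>X. X \<in> colorings \<Longrightarrow> ((\<lambda>t. f t X) has_real_derivative f' X) (at t)"
  shows "((\<lambda>t. avg (f t)) has_real_derivative avg f') (at t)"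
  unfolding avg_def using assms by (intro DERIV_cdivide DERIV_sum)

text \<open>Differentiating the interpolation \<open>avg \<Phi>((z - t W) / q)\<close>, \<open>q\<^sup>2 = 1 - (1 - \<delta>\<^sup>2) t\<^sup>2\<close>, in \<open>t\<close> produces
  \<open>avg ((1 - \<delta>\<^sup>2) G'(W) - W G(W))\<close> with \<open>G x = \<phi>((z - t x) / q) / q\<close>, so no solution of Stein's
  equation is needed.\<close>

lemma smoothed_cdf_bound:
  assumes st: "stein_bounded A B W" and AB: "0 \<le> A" "0 \<le> B"
    and \<delta>: "0 < \<delta>" "\<delta>\<^sup>2 \<le> 1/2"
  shows "\<bar>avg (\<lambda>X. Phi ((z - W X) / \<delta>)) - Phi z\<bar> \<le> 4 * (A + B + \<delta>\<^sup>2) / \<delta>"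
proof -
  define k where "k = 1 - \<delta>\<^sup>2"
  have k: "1/2 \<le> k" "k < 1" using \<delta> by (auto simp: k_def)
  define q where "q t = sqrt (1 - k * t\<^sup>2)" for t :: real
  define \<theta> where "\<theta> t = avg (\<lambda>X. Phi ((z - t * W X) / q t))" for t
  define C where "C = A + B + \<delta>\<^sup>2"
  have C0: "C \<ge> 0" using AB by (simp add: C_def)
  \<comment> \<open>On [0, 1] one has t^2 \<le> t, hence \<open>p\<close> is at most
    \<open>q\<close>. \<open>P\<close> is an antiderivative of C / p^3, and p 1 = \<delta>.\<close>
  define p where "p t = sqrt (1 - k * t)" for t :: real
  define P where "P t = C * (2 / k) / p t" for t
  define \<theta>' where "\<theta>' t = avg (\<lambda>X. std_normal_density ((z - t * W X) / q t) *
      (- W X / q t + (z - t * W X) * (k * t / (q t)^3)))" for t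
  have pos: "0 < 1 - k * t" "1 - k * t \<le> 1 - k * t\<^sup>2" "1 - k * t\<^sup>2 \<le> 1" if t: "0 \<le> t" "t \<le> 1" for t
  proof -
    have "k * t \<le> k * 1" using t k by (intro mult_left_mono) auto
    then show "0 < 1 - k * t" using k by linarith
    have "t\<^sup>2 \<le> t" using t by (simp add: power2_eq_square mult_left_le)
    then show "1 - k * t \<le> 1 - k * t\<^sup>2" using k by (simp add: mult_left_mono)
    show "1 - k * t\<^sup>2 \<le> 1" using k by simp
  qed
  have d\<theta>: "(\<theta> has_real_derivative \<theta>' t) (at t)" if t: "0 \<le> t" "t \<le> 1" for t
    unfolding \<theta>_def \<theta>'_def
  proof (rule avg_DERIV)
    fix X
    have q0: "q t > 0" and arg: "1 - k * t\<^sup>2 > 0" using pos[OF t] by (auto simp: q_def)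
    have dq: "(q has_real_derivative - k * t / q t) (at t)"
      unfolding q_def using arg by (auto intro!: derivative_eq_intros simp: field_simps)
    have d1: "((\<lambda>t. (z - t * W X) / q t) has_real_derivative
       - W X / q t + (z - t * W X) * (k * t / (q t)^3)) (at t)"
      using q0 by (auto intro!: derivative_eq_intros dq simp: field_simps power3_eq_cube power2_eq_square)
    show "((\<lambda>t. Phi ((z - t * W X) / q t)) has_real_derivative
       std_normal_density ((z - t * W X) / q t) * (- W X / q t + (z - t * W X) * (k * t / (q t)^3))) (at t)"
      using DERIV_chain2[OF Phi_DERIV d1] .
  qed
  have b\<theta>: "\<bar>\<theta>' t\<bar> \<le> C / (p t)^3" if t: "0 \<le> t" "t \<le> 1" for t
  proof -
    have q0: "q t > 0" and p0: "p t > 0" and pq: "p t \<le> q t" and q1: "q t \<le> 1"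
      using pos[OF t] by (auto simp: q_def p_def)
    define y where "y x = (z - t * x) / q t" for x
    define G where "G x = std_normal_density (y x) / q t" for x
    define G' where "G' x = t / (q t)\<^sup>2 * (y x * std_normal_density (y x))" for x
    define G'' where "G'' x = t\<^sup>2 / (q t)^3 * (((y x)\<^sup>2 - 1) * std_normal_density (y x))" for x
    have dy: "(y has_real_derivative - t / q t) (at x)" for x
      unfolding y_def using q0 by (auto intro!: derivative_eq_intros simp: field_simps)
    have d\<phi>: "((\<lambda>x. std_normal_density (y x)) has_real_derivative
        (- y x * std_normal_density (y x)) * (- t / q t)) (at x)" for x
      using DERIV_chain2[OF std_normal_density_DERIV dy] .
    have dG: "(G has_real_derivative G' x) (at x)" for x
    proof -
      have "(G has_real_derivative (- y x * std_normal_density (y x)) * (- t / q t) / q t) (at x)"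
        unfolding G_def by (rule DERIV_cdivide[OF d\<phi>])
      also have "(- y x * std_normal_density (y x)) * (- t / q t) / q t = G' x"
        unfolding G'_def using q0 by (simp add: field_simps power2_eq_square)
      finally show ?thesis .
    qed
    have dG': "(G' has_real_derivative G'' x) (at x)" for x
    proof -
      have "(G' has_real_derivative t / (q t)\<^sup>2 * ((- t / q t) * std_normal_density (y x)
         + (- y x * std_normal_density (y x)) * (- t / q t) * y x)) (at x)"
        unfolding G'_def by (rule DERIV_cmult[OF DERIV_mult'[OF dy d\<phi>, THEN DERIV_cong]]) simp
      also have "t / (q t)\<^sup>2 * ((- t / q t) * std_normal_density (y x)
         + (- y x * std_normal_density (y x)) * (- t / q t) * y x) = G'' x"
        unfolding G''_def using q0 by (simp add: field_simps power2_eq_square power3_eq_cube)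
      finally show ?thesis .
    qed
    have bG': "\<bar>G' x\<bar> \<le> 1 / (q t)\<^sup>2" for x
    proof -
      have "\<bar>G' x\<bar> = t / (q t)\<^sup>2 * (\<bar>y x\<bar> * std_normal_density (y x))"
        unfolding G'_def using t by (simp add: abs_mult)
      also have "\<dots> \<le> 1 / (q t)\<^sup>2 * 1"
        using t abs_mult_std_normal_density_le by (intro mult_mono divide_right_mono) auto
      finally show ?thesis by simp
    qed
    have bG'': "\<bar>G'' x\<bar> \<le> 1 / (q t)^3" for x
    proof -
      have "\<bar>G'' x\<bar> = t\<^sup>2 / (q t)^3 * (\<bar>(y x)\<^sup>2 - 1\<bar> * std_normal_density (y x))"
        unfolding G''_def using t q0 by (simp add: abs_mult)
      also have "\<dots> \<le> 1 / (q t)^3 * 1"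
        using t q0 abs_square_minus_1_mult_std_normal_density_le
        by (intro mult_mono divide_right_mono) (auto simp: power_le_one)
      finally show ?thesis by simp
    qed
    have lip: "\<bar>G' x - G' x'\<bar> \<le> 1 / (q t)^3 * \<bar>x - x'\<bar>" for x x'
      using field_differentiable_bound[of UNIV G' G'' "1 / (q t)^3" x x'] dG' bG'' by simp
    \<comment> \<open>Stopping at \<open>k = 1 - \<delta>\<^sup>2\<close> instead of 1 keeps
      \<open>q\<close> positive at t = 1; the missing multiple of avg G' is the source of the
      summand \<delta>^2 in \<open>C\<close>.\<close>
    have e: "\<theta>' t = avg (\<lambda>X. G' (W X)) - avg (\<lambda>X. W X * G (W X)) - \<delta>\<^sup>2 * avg (\<lambda>X. G' (W X))"
      unfolding avg_mult_left[symmetric] avg_diff[symmetric] \<theta>'_def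
    proof (rule avg_cong)
      fix X
      have "(z - t * W X) = q t * y (W X)" unfolding y_def using q0 by simp
      then show "std_normal_density ((z - t * W X) / q t) * (- W X / q t + (z - t * W X) * (k * t / q t ^ 3))
         = G' (W X) - W X * G (W X) - \<delta>\<^sup>2 * G' (W X)"
        unfolding G_def G'_def y_def[symmetric] k_def using q0
        by (simp add: field_simps power2_eq_square power3_eq_cube)
    qed
    have "\<bar>avg (\<lambda>X. G' (W X)) - avg (\<lambda>X. W X * G (W X))\<bar> \<le> 1 / (q t)\<^sup>2 * A + 1 / (q t)^3 * B"
      using st dG bG' lip unfolding stein_bounded_def by blast
    moreover have "\<bar>\<delta>\<^sup>2 * avg (\<lambda>X. G' (W X))\<bar> \<le> \<delta>\<^sup>2 * (1 / (q t)\<^sup>2)"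
    proof -
      have "\<bar>avg (\<lambda>X. G' (W X))\<bar> \<le> avg (\<lambda>X. 1 / (q t)\<^sup>2)"
        using bG' by (intro order.trans[OF avg_abs avg_mono])
      then have "\<bar>avg (\<lambda>X. G' (W X))\<bar> \<le> 1 / (q t)\<^sup>2" by (simp add: avg_const)
      from mult_left_mono[OF this, of "\<delta>\<^sup>2"] show ?thesis by (simp add: abs_mult)
    qed
    ultimately have "\<bar>\<theta>' t\<bar> \<le> 1 / (q t)\<^sup>2 * A + 1 / (q t)^3 * B + 1 / (q t)\<^sup>2 * \<delta>\<^sup>2"
      unfolding e by (simp add: mult.commute)
    also have "\<dots> \<le> 1 / (p t)^3 * A + 1 / (p t)^3 * B + 1 / (p t)^3 * \<delta>\<^sup>2"
    proof -
      have 1: "1 / (q t)^3 \<le> 1 / (p t)^3"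
        using pq p0 q0 by (intro divide_left_mono power_mono) auto
      have "(q t)^3 \<le> (q t)\<^sup>2" using q0 q1 by (intro power_decreasing) auto
      then have "1 / (q t)\<^sup>2 \<le> 1 / (q t)^3" using q0 by (intro divide_left_mono) auto
      then have 2: "1 / (q t)\<^sup>2 \<le> 1 / (p t)^3" using 1 by linarith
      show ?thesis using 1 2 AB by (intro add_mono mult_right_mono) auto
    qed
    also have "\<dots> = C / (p t)^3" unfolding C_def by (simp add: add_divide_distrib)
    finally show ?thesis .
  qed
  have dP: "(P has_real_derivative C / (p t)^3) (at t)" if t: "0 \<le> t" "t \<le> 1" for t
  proof -
    have p0: "p t > 0" and arg: "1 - k * t > 0" using pos[OF t] by (auto simp: p_def)
    have dp: "(p has_real_derivative - k / (2 * p t)) (at t)"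
      unfolding p_def using arg by (auto intro!: derivative_eq_intros simp: field_simps)
    show ?thesis unfolding P_def using p0 k
      by (auto intro!: derivative_eq_intros dp simp: field_simps power2_eq_square power3_eq_cube)
  qed
  \<comment> \<open>Monotonicity of P + \<theta> and P - \<theta> bounds the variation of \<theta>
    by that of \<open>P\<close> without integrating the derivative of \<theta>.\<close>
  have "P 0 + \<theta> 0 \<le> P 1 + \<theta> 1"
  proof (rule DERIV_nonneg_imp_nondecreasing[of 0 1 "\<lambda>t. P t + \<theta> t"])
    fix t :: real assume t: "0 \<le> t" "t \<le> 1"
    show "\<exists>y. ((\<lambda>t. P t + \<theta> t) has_real_derivative y) (at t) \<and> 0 \<le> y"
      using b\<theta>[OF t] by (intro exI[of _ "C / (p t)^3 + \<theta>' t"] conjI DERIV_add dP d\<theta> t) auto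
  qed simp
  moreover have "P 0 - \<theta> 0 \<le> P 1 - \<theta> 1"
  proof (rule DERIV_nonneg_imp_nondecreasing[of 0 1 "\<lambda>t. P t - \<theta> t"])
    fix t :: real assume t: "0 \<le> t" "t \<le> 1"
    show "\<exists>y. ((\<lambda>t. P t - \<theta> t) has_real_derivative y) (at t) \<and> 0 \<le> y"
      using b\<theta>[OF t] by (intro exI[of _ "C / (p t)^3 - \<theta>' t"] conjI DERIV_diff dP d\<theta> t) auto
  qed simp
  moreover have "\<theta> 0 = Phi z" unfolding \<theta>_def q_def by (simp add: avg_const)
  moreover have "\<theta> 1 = avg (\<lambda>X. Phi ((z - W X) / \<delta>))"
    unfolding \<theta>_def q_def k_def using \<delta> by simp
  moreover have "P 0 \<ge> 0" unfolding P_def p_def using C0 k by simp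
  moreover have "P 1 \<le> 4 * C / \<delta>"
  proof -
    have "P 1 = C * (2 / k) / \<delta>" unfolding P_def p_def k_def using \<delta> by simp
    also have "\<dots> \<le> C * 4 / \<delta>"
      using k C0 \<delta> by (intro divide_right_mono mult_left_mono) (auto simp: field_simps)
    finally show ?thesis by (simp add: mult.commute)
  qed
  ultimately show ?thesis unfolding C_def by linarith
qed

text \<open>The indicator of W \<le> z is compared with smoothed indicators shifted by \<rho>^2 to
  either side. Three costs arise: Stein's error \<rho>^5 / \<delta>, the tail (\<delta> /
  \<rho>^2)^2 beyond the shift, and the shift itself by the Lipschitz bound for \<open>Phi\<close>.
  For \<delta> of order \<rho>^3 all are of order \<rho>^2; the factor 1/2 in \<delta> secures
  \<delta>^2 \<le> 1/2.\<close>

lemma kolmogorov_bound: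
  assumes st: "stein_bounded (C * \<rho>^5) (C * \<rho>^5) W" and C: "0 \<le> C" and \<rho>: "0 < \<rho>" "\<rho> \<le> 1"
  shows "\<bar>avg (\<lambda>X. of_bool (W X \<le> z)) - Phi z\<bar> \<le> (16 * C + 4) * \<rho>\<^sup>2"
proof -
  define \<delta> where "\<delta> = \<rho>^3 / 2"
  have \<delta>: "0 < \<delta>" using \<rho> by (simp add: \<delta>_def)
  have "\<rho>^3 \<le> 1" using \<rho> by (simp add: power_le_one)
  then have \<delta>2: "\<delta>\<^sup>2 \<le> 1/2"
    using power_mono[of \<delta> "1/2" 2] \<delta> by (simp add: \<delta>_def power2_eq_square)
  have err: "4 * (C * \<rho>^5 + C * \<rho>^5 + \<delta>\<^sup>2) / \<delta> \<le> (16 * C + 2) * \<rho>\<^sup>2"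
  proof -
    have "4 * (C * \<rho>^5 + C * \<rho>^5 + \<delta>\<^sup>2) / \<delta> = 16 * C * \<rho>\<^sup>2 + 2 * \<rho>^3"
      unfolding \<delta>_def using \<rho> by (simp add: field_simps power2_eq_square power3_eq_cube eval_nat_numeral)
    moreover have "\<rho>^3 \<le> \<rho>\<^sup>2" using \<rho> by (intro power_decreasing) auto
    ultimately show ?thesis by (simp add: algebra_simps)
  qed
  have smooth: "\<bar>avg (\<lambda>X. Phi ((z' - W X) / \<delta>)) - Phi z'\<bar> \<le> (16 * C + 2) * \<rho>\<^sup>2" for z'
    using smoothed_cdf_bound[OF st _ _ \<delta> \<delta>2, of z'] C \<rho> err by simp
  have ratio: "\<rho>\<^sup>2 / \<delta> = 2 / \<rho>" unfolding \<delta>_def using \<rho>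
    by (simp add: field_simps power2_eq_square power3_eq_cube)
  have tailbd: "1 / (\<rho>\<^sup>2 / \<delta>)\<^sup>2 \<le> \<rho>\<^sup>2" unfolding ratio using \<rho> by (simp add: power_divide)
  have apos: "\<rho>\<^sup>2 / \<delta> > 0" using \<rho> \<delta> by simp
  have up: "avg (\<lambda>X. of_bool (W X \<le> z)) \<le> avg (\<lambda>X. Phi ((z + \<rho>\<^sup>2 - W X) / \<delta>)) + \<rho>\<^sup>2"
  proof -
    have "avg (\<lambda>X. of_bool (W X \<le> z)) \<le> avg (\<lambda>X. Phi ((z + \<rho>\<^sup>2 - W X) / \<delta>) + \<rho>\<^sup>2)"
    proof (rule avg_mono)
      fix X
      show "of_bool (W X \<le> z) \<le> Phi ((z + \<rho>\<^sup>2 - W X) / \<delta>) + \<rho>\<^sup>2"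
      proof (cases "W X \<le> z")
        case True
        then have "Phi (\<rho>\<^sup>2 / \<delta>) \<le> Phi ((z + \<rho>\<^sup>2 - W X) / \<delta>)"
          using \<delta> by (intro Phi_mono divide_right_mono) auto
        then show ?thesis using True Phi_tail(2)[OF apos] tailbd by simp
      next
        case False then show ?thesis using Phi_bounds(1)[of "(z + \<rho>\<^sup>2 - W X) / \<delta>"] by simp
      qed
    qed
    then show ?thesis by (simp add: avg_add avg_const)
  qed
  have lo: "avg (\<lambda>X. Phi ((z - \<rho>\<^sup>2 - W X) / \<delta>)) - \<rho>\<^sup>2 \<le> avg (\<lambda>X. of_bool (W X \<le> z))"
  proof -
    have "avg (\<lambda>X. Phi ((z - \<rho>\<^sup>2 - W X) / \<delta>) - \<rho>\<^sup>2) \<le> avg (\<lambda>X. of_bool (W X \<le> z))"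
    proof (rule avg_mono)
      fix X
      show "Phi ((z - \<rho>\<^sup>2 - W X) / \<delta>) - \<rho>\<^sup>2 \<le> of_bool (W X \<le> z)"
      proof (cases "W X \<le> z")
        case False
        then have "(z - \<rho>\<^sup>2 - W X) / \<delta> \<le> - \<rho>\<^sup>2 / \<delta>"
          using \<delta> by (intro divide_right_mono) auto
        then have "Phi ((z - \<rho>\<^sup>2 - W X) / \<delta>) \<le> Phi (- (\<rho>\<^sup>2 / \<delta>))"
          by (intro Phi_mono) simp
        then show ?thesis using False Phi_tail(1)[OF apos] tailbd by simp
      next
        case True
        moreover have "Phi ((z - \<rho>\<^sup>2 - W X) / \<delta>) - \<rho>\<^sup>2 \<le> 1"
          using Phi_bounds(2)[of "(z - \<rho>\<^sup>2 - W X) / \<delta>"] zero_le_power2[of \<rho>] by linarith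
        ultimately show ?thesis by simp
      qed
    qed
    then show ?thesis by (simp add: avg_diff avg_const)
  qed
  have "\<bar>Phi (z + \<rho>\<^sup>2) - Phi z\<bar> \<le> \<rho>\<^sup>2" "\<bar>Phi (z - \<rho>\<^sup>2) - Phi z\<bar> \<le> \<rho>\<^sup>2"
    using Phi_lipschitz[of "z + \<rho>\<^sup>2" z] Phi_lipschitz[of "z - \<rho>\<^sup>2" z] by simp_all
  moreover have "(16 * C + 4) * \<rho>\<^sup>2 = (16 * C + 2) * \<rho>\<^sup>2 + 2 * \<rho>\<^sup>2" by (simp add: algebra_simps)
  ultimately show ?thesis
    using up lo smooth[of "z + \<rho>\<^sup>2"] smooth[of "z - \<rho>\<^sup>2"] by linarith
qed

end


subsection \<open>Centered color indicators\<close>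

context color_space
begin

definition cind :: "'v \<Rightarrow> nat \<Rightarrow> ('v \<Rightarrow> nat) \<Rightarrow> real" where
  "cind j a X = of_bool (X j = a) - 1 / real c"

definition cprod :: "'v set \<Rightarrow> nat \<Rightarrow> ('v \<Rightarrow> nat) \<Rightarrow> real" where
  "cprod A a X = (\<Prod>j\<in>A. cind j a X)"

definition cmono :: "'v set \<Rightarrow> ('v \<Rightarrow> nat) \<Rightarrow> real" where
  "cmono A X = (\<Sum>a\<in>{1..c}. cprod A a X)"

text \<open>The covariance of the indicators of the colors \<open>a\<close> and \<open>b\<close> at
  a single vertex; see \<open>cavg_cind_mult\<close>.\<close>

definition ccov :: "nat \<Rightarrow> nat \<Rightarrow> real" where
  "ccov a b = of_bool (b = a) / real c - 1 / (real c)\<^sup>2"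

text \<open>The conditional average of \<open>cmono (insert i A)\<close> times
  \<open>cmono (insert i B)\<close> over the color of a vertex \<open>i\<close> outside both sets;
  see \<open>cavg_cmono_mult\<close>.\<close>

definition cross :: "'v set \<Rightarrow> 'v set \<Rightarrow> ('v \<Rightarrow> nat) \<Rightarrow> real" where
  "cross A B X = (\<Sum>a\<in>{1..c}. \<Sum>b\<in>{1..c}. ccov a b * (cprod A a X * cprod B b X))"

lemma abs_cind_le: "\<bar>cind j a X\<bar> \<le> 1"
  unfolding cind_def using c_pos by (auto simp: abs_le_iff of_bool_def field_simps)

lemma abs_cprod_le: "\<bar>cprod A a X\<bar> \<le> 1"
  unfolding cprod_def abs_prod by (intro prod_le_1) (simp add: abs_cind_le)

lemma abs_cmono_le: "\<bar>cmono A X\<bar> \<le> real c"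
proof -
  have "\<bar>cmono A X\<bar> \<le> (\<Sum>a\<in>{1..c}. 1)"
    unfolding cmono_def by (intro order.trans[OF sum_abs] sum_mono abs_cprod_le)
  then show ?thesis by simp
qed

lemma abs_ccov_le: "\<bar>ccov a b\<bar> \<le> 1"
proof -
  have "0 \<le> of_bool (b = a) / real c" "of_bool (b = a) / real c \<le> 1"
    using c_pos by (cases "b = a"; simp)+
  moreover have "0 \<le> 1 / (real c)\<^sup>2" "1 / (real c)\<^sup>2 \<le> 1"
    using one_le_power[of "real c" 2] c_pos by simp_all
  ultimately show ?thesis unfolding ccov_def by linarith
qed

lemma abs_cross_le: "\<bar>cross A B X\<bar> \<le> (real c)\<^sup>2"
proof -
  have "\<bar>cross A B X\<bar> \<le> (\<Sum>a\<in>{1..c}. \<Sum>b\<in>{1..c}. 1)"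
    unfolding cross_def
  proof (rule order.trans[OF sum_abs sum_mono], rule order.trans[OF sum_abs sum_mono])
    fix a b
    have "\<bar>ccov a b\<bar> * (\<bar>cprod A a X\<bar> * \<bar>cprod B b X\<bar>) \<le> 1 * (1 * 1)"
      by (intro mult_mono abs_ccov_le abs_cprod_le) auto
    then show "\<bar>ccov a b * (cprod A a X * cprod B b X)\<bar> \<le> 1" by (simp add: abs_mult)
  qed
  then show ?thesis by (simp add: power2_eq_square)
qed

lemma cprod_cong: "(\<And>j. j \<in> A \<Longrightarrow> X j = Y j) \<Longrightarrow> cprod A a X = cprod A a Y"
  unfolding cprod_def cind_def by (intro prod.cong) auto

lemma cprod_upd: "i \<notin> A \<Longrightarrow> cprod A a (X(i := k)) = cprod A a X"
  by (rule cprod_cong) auto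

lemma cprod_insert: "finite A \<Longrightarrow> i \<notin> A \<Longrightarrow> cprod (insert i A) a X = cind i a X * cprod A a X"
  unfolding cprod_def by simp

lemma cprod_remove: "finite A \<Longrightarrow> i \<in> A \<Longrightarrow> cprod A a X = cind i a X * cprod (A - {i}) a X"
  unfolding cprod_def by (rule prod.remove)

lemma cprod_simps: "cprod {} a X = 1" "cprod {i} a X = cind i a X"
  "i \<noteq> j \<Longrightarrow> cprod {i, j} a X = cind i a X * cind j a X"
  unfolding cprod_def by simp_all

lemma ccov_commute: "ccov a b = ccov b a"
  unfolding ccov_def by (simp add: eq_commute)

lemma cross_commute: "cross A B X = cross B A X"
  unfolding cross_def by (subst sum.swap) (simp add: ccov_commute mult_ac)

section \<open>Averages and color sums of centered indicators\<close>

lemma sum_of_bool_eq: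
  assumes "a \<in> {1..c}" shows "(\<Sum>k\<in>{1..c}. of_bool (k = a) * f k) = (f a :: real)"
proof -
  have "(\<Sum>k\<in>{1..c}. of_bool (k = a) * f k) = (\<Sum>k\<in>{1..c}. if k = a then f k else 0)"
    by (intro sum.cong) auto
  then show ?thesis using assms by (simp add: sum.delta)
qed

lemma cavg_cind:
  assumes "a \<in> {1..c}" shows "cavg i (cind i a) X = 0"
proof -
  have "(\<Sum>k\<in>{1..c}. of_bool (k = a)) = (1 :: real)"
    using sum_of_bool_eq[OF assms, of "\<lambda>_. 1"] by simp
  then show ?thesis unfolding cavg_def cind_def using c_pos by (simp add: sum_subtractf)
qed

lemma sum_shifted_of_bool_mult:
  assumes "a \<in> {1..c}" "b \<in> {1..c}"
  shows "(\<Sum>k\<in>{1..c}. (of_bool (k = a) - 1 / real c) * (of_bool (k = b) - 1 / real c))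
     = of_bool (a = b) - 1 / real c"
proof -
  have "(\<Sum>k\<in>{1..c}. (of_bool (k = a) - 1 / real c) * (of_bool (k = b) - 1 / real c))
    = (\<Sum>k\<in>{1..c}. of_bool (k = a) * (of_bool (k = b) - 1 / real c))
      - (\<Sum>k\<in>{1..c}. of_bool (k = b) * (1 / real c)) + (\<Sum>k\<in>{1..c}. 1 / (real c)\<^sup>2)"
    unfolding sum_subtractf[symmetric] sum.distrib[symmetric]
    by (intro sum.cong) (auto simp: algebra_simps power2_eq_square)
  also have "\<dots> = of_bool (a = b) - 1 / real c"
    unfolding sum_of_bool_eq[OF assms(1)] sum_of_bool_eq[OF assms(2)]
    using c_pos by (simp add: power2_eq_square)
  finally show ?thesis .
qed

lemma cavg_cind_mult:
  assumes "a \<in> {1..c}" "b \<in> {1..c}"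
  shows "cavg i (\<lambda>X. cind i a X * cind i b X) X = ccov a b"
  unfolding cavg_def cind_def ccov_def using sum_shifted_of_bool_mult[OF assms] c_pos eq_commute[of a b]
  by (simp add: field_simps power2_eq_square)

lemma sum_cind:
  assumes "X \<in> colorings" "i \<in> V"
  shows "(\<Sum>a\<in>{1..c}. cind i a X) = 0"
proof -
  have "(\<Sum>k\<in>{1..c}. of_bool (X i = k)) = (1 :: real)"
    using sum_of_bool_eq[OF coloring_range[OF assms], of "\<lambda>_. 1"] unfolding eq_commute[of "X i"] by simp
  then show ?thesis unfolding cind_def using c_pos by (simp add: sum_subtractf)
qed

lemma sum_cind_square:
  assumes "X \<in> colorings" "i \<in> V"
  shows "(\<Sum>a\<in>{1..c}. cind i a X * cind i a X) = 1 - 1 / real c"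
proof -
  have "cind i a X = of_bool (a = X i) - 1 / real c" for a by (auto simp: cind_def)
  then show ?thesis
    using sum_shifted_of_bool_mult[OF coloring_range[OF assms] coloring_range[OF assms]] by simp
qed

lemma cavg_constant: "cavg i (\<lambda>_. k) X = k"
  by (rule cavg_const) simp

lemma cmono_empty: "cmono {} X = real c"
  unfolding cmono_def by (simp add: cprod_simps)

lemma cmono_singleton: "X \<in> colorings \<Longrightarrow> i \<in> V \<Longrightarrow> cmono {i} X = 0"
  unfolding cmono_def cprod_simps by (rule sum_cind)

lemma depends_cmono_set: "depends S (cmono S)"
  unfolding depends_def cmono_def by (intro ballI impI sum.cong refl cprod_cong) auto

lemma cmono_upd: "i \<notin> A \<Longrightarrow> cmono A (X(i := k)) = cmono A X"
  unfolding cmono_def by (simp add: cprod_upd)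

lemma cavg_cmono:
  assumes "finite A" "i \<in> A" shows "cavg i (cmono A) X = 0"
proof -
  have rem: "cprod A a = (\<lambda>X. cprod (A - {i}) a X * cind i a X)" for a
    by (rule ext) (simp add: cprod_remove[OF assms])
  have "cavg i (cmono A) X = (\<Sum>a\<in>{1..c}. cavg i (cprod A a) X)"
    unfolding cmono_def by (rule cavg_sum)
  also have "\<dots> = (\<Sum>a\<in>{1..c}. cavg i (\<lambda>X. cprod (A - {i}) a X * cind i a X) X)"
    by (simp only: rem)
  also have "\<dots> = (\<Sum>a\<in>{1..c}. 0)"
    by (intro sum.cong refl, subst cavg_mult) (simp_all add: cprod_upd cavg_cind)
  finally show ?thesis by simp
qed

lemma cavg_cmono_notin: "i \<notin> A \<Longrightarrow> cavg i (cmono A) X = cmono A X"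
  by (rule cavg_const) (simp add: cmono_upd)

lemma degenerate_cmono:
  assumes "S \<subseteq> V" shows "degenerate S (cmono S)"
proof -
  have "finite S" using assms fin_V by (rule finite_subset)
  then show ?thesis using assms unfolding degenerate_def by (simp add: depends_cmono_set cavg_cmono)
qed

lemma degenerate_scale:
  assumes "degenerate U f" shows "degenerate U (\<lambda>X. k * f X)"
  unfolding degenerate_def depends_def
proof (intro conjI ballI impI)
  show "U \<subseteq> V" using assms by (simp add: degenerate_def)
  show "k * f X = k * f Y" if "X \<in> colorings" "Y \<in> colorings" "\<forall>j\<in>U. X j = Y j" for X Y
    using that assms dependsD[of U f X Y] by (simp add: degenerate_def)
  show "cavg i (\<lambda>X. k * f X) X = 0" if "i \<in> U" "X \<in> colorings" for i X
    using that assms by (simp add: cavg_mult_left degenerate_def)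
qed

lemma avg_cmono_set: "S \<subseteq> V \<Longrightarrow> S \<noteq> {} \<Longrightarrow> avg (cmono S) = 0"
  using degenerate_cmono degenerate_avg by blast

lemma cavg_cmono_mult:
  assumes "finite A" "finite B" "i \<notin> A" "i \<notin> B"
  shows "cavg i (\<lambda>X. cmono (insert i A) X * cmono (insert i B) X) X = cross A B X"
proof -
  have "cavg i (\<lambda>X. cmono (insert i A) X * cmono (insert i B) X) X
     = cavg i (\<lambda>X. \<Sum>a\<in>{1..c}. \<Sum>b\<in>{1..c}. (cprod A a X * cprod B b X) * (cind i a X * cind i b X)) X"
    unfolding cmono_def sum_product using assms by (simp add: cprod_insert mult_ac)
  also have "\<dots> = (\<Sum>a\<in>{1..c}. \<Sum>b\<in>{1..c}.
      cavg i (\<lambda>X. (cprod A a X * cprod B b X) * (cind i a X * cind i b X)) X)"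
    by (simp only: cavg_sum)
  also have "\<dots> = (\<Sum>a\<in>{1..c}. \<Sum>b\<in>{1..c}. (cprod A a X * cprod B b X) * ccov a b)"
    using assms by (intro sum.cong refl, subst cavg_mult) (simp_all add: cprod_upd cavg_cind_mult)
  finally show ?thesis unfolding cross_def by (simp add: mult_ac)
qed

lemma depends_cross: "depends (A \<union> B) (cross A B)"
  unfolding depends_def cross_def
  by (intro ballI impI sum.cong refl arg_cong2[where f = "(*)"] cprod_cong) auto

lemma cavg_cross_zero:
  assumes "finite A" "i \<in> A" "i \<notin> B" shows "cavg i (cross A B) X = 0"
proof -
  have "cavg i (cross A B) X = (\<Sum>a\<in>{1..c}. \<Sum>b\<in>{1..c}.
      cavg i (\<lambda>X. ccov a b * (cprod A a X * cprod B b X)) X)"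
    unfolding cross_def by (simp only: cavg_sum)
  also have "\<dots> = (\<Sum>a\<in>{1..c}. \<Sum>b\<in>{1..c}.
      cavg i (\<lambda>X. (ccov a b * (cprod (A - {i}) a X * cprod B b X)) * cind i a X) X)"
    using cprod_remove[OF assms(1,2)] by (simp add: mult_ac)
  also have "\<dots> = (\<Sum>a\<in>{1..c}. \<Sum>b\<in>{1..c}. 0)"
    using assms by (intro sum.cong refl, subst cavg_mult) (simp_all add: cprod_upd cavg_cind)
  finally show ?thesis by simp
qed

lemma cavg_cross_zero':
  assumes "finite B" "i \<notin> A" "i \<in> B" shows "cavg i (cross A B) X = 0"
proof -
  have "cross A B = cross B A" by (rule ext, rule cross_commute)
  then show ?thesis using cavg_cross_zero[of B i A X] assms by simp
qed

text \<open>The excess of the diagonal of \<open>ccov\<close> squared over its off-diagonal value: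
  (1/c - 1/c^2)^2 - 1/c^4. It vanishes for c = 2.\<close>

abbreviation link_coef :: real where
  "link_coef \<equiv> 1 / (real c)\<^sup>2 - 2 / (real c)^3"

text \<open>What \<open>cross\<close> becomes when a common vertex, already removed from
  \<open>A\<close> and \<open>B\<close> here, is averaged out. The first term comes from the
  diagonal of the squared covariance, the second from its constant part 1/c^4.\<close>

definition reduced :: "'v set \<Rightarrow> 'v set \<Rightarrow> ('v \<Rightarrow> nat) \<Rightarrow> real" where
  "reduced A B X = link_coef * (\<Sum>a\<in>{1..c}. cprod A a X * cprod B a X)
     + 1 / (real c)^4 * (cmono A X * cmono B X)"

lemma ccov_square: "(ccov a b)\<^sup>2 = link_coef * of_bool (b = a) + 1 / (real c)^4"
  unfolding ccov_def using c_pos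
  by (cases "b = a") (simp_all add: field_simps power2_eq_square eval_nat_numeral)

lemma cavg_cross:
  assumes "finite A" "finite B" "i \<in> A" "i \<in> B"
  shows "cavg i (cross A B) X = reduced (A - {i}) (B - {i}) X"
proof -
  let ?A = "A - {i}" and ?B = "B - {i}"
  have "cavg i (cross A B) X = (\<Sum>a\<in>{1..c}. \<Sum>b\<in>{1..c}.
      cavg i (\<lambda>X. ccov a b * (cprod A a X * cprod B b X)) X)"
    unfolding cross_def by (simp only: cavg_sum)
  also have "\<dots> = (\<Sum>a\<in>{1..c}. \<Sum>b\<in>{1..c}.
      cavg i (\<lambda>X. (ccov a b * (cprod ?A a X * cprod ?B b X)) * (cind i a X * cind i b X)) X)"
    using cprod_remove[OF assms(1,3)] cprod_remove[OF assms(2,4)] by (simp add: mult_ac)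
  also have "\<dots> = (\<Sum>a\<in>{1..c}. \<Sum>b\<in>{1..c}. (ccov a b * (cprod ?A a X * cprod ?B b X)) * ccov a b)"
    by (intro sum.cong refl, subst cavg_mult) (simp_all add: cprod_upd cavg_cind_mult)
  also have "\<dots> = (\<Sum>a\<in>{1..c}. \<Sum>b\<in>{1..c}.
      of_bool (b = a) * (link_coef * (cprod ?A a X * cprod ?B b X))
      + 1 / (real c)^4 * (cprod ?A a X * cprod ?B b X))"
  proof (intro sum.cong refl)
    fix a b
    have "ccov a b * (cprod ?A a X * cprod ?B b X) * ccov a b = (ccov a b)\<^sup>2 * (cprod ?A a X * cprod ?B b X)"
      by (simp add: power2_eq_square)
    then show "ccov a b * (cprod ?A a X * cprod ?B b X) * ccov a b
       = of_bool (b = a) * (link_coef * (cprod ?A a X * cprod ?B b X))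
         + 1 / (real c)^4 * (cprod ?A a X * cprod ?B b X)"
      unfolding ccov_square by (simp add: algebra_simps)
  qed
  also have "\<dots> = (\<Sum>a\<in>{1..c}. link_coef * (cprod ?A a X * cprod ?B a X))
      + (\<Sum>a\<in>{1..c}. \<Sum>b\<in>{1..c}. 1 / (real c)^4 * (cprod ?A a X * cprod ?B b X))"
    unfolding sum.distrib by (intro arg_cong2[where f = "(+)"] sum.cong refl sum_of_bool_eq)
  also have "\<dots> = reduced ?A ?B X"
    unfolding reduced_def cmono_def sum_product sum_distrib_left[symmetric] ..
  finally show ?thesis .
qed

text \<open>The centered indicators of all colors at one vertex sum to 0, which kills both terms of
  \<open>reduced\<close>.\<close>

lemma reduced_empty_singleton:
  "X \<in> colorings \<Longrightarrow> l \<in> V \<Longrightarrow> reduced {} {l} X = 0"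
  "X \<in> colorings \<Longrightarrow> l \<in> V \<Longrightarrow> reduced {l} {} X = 0"
  unfolding reduced_def by (simp_all add: cprod_simps cmono_singleton sum_cind[unfolded One_nat_def])

lemma reduced_singleton: "X \<in> colorings \<Longrightarrow> l \<in> V \<Longrightarrow>
  reduced {l} {l} X = link_coef * (1 - 1 / real c)"
  unfolding reduced_def by (simp add: cprod_simps cmono_singleton sum_cind_square[unfolded One_nat_def])

lemma reduced_singletons: "X \<in> colorings \<Longrightarrow> l \<in> V \<Longrightarrow> l \<noteq> m \<Longrightarrow>
  reduced {l} {m} X = link_coef * cmono {l, m} X"
  unfolding reduced_def by (simp add: cprod_simps cmono_singleton) (simp add: cmono_def cprod_simps)

text \<open>The value does not depend on the coloring, so pairs of equal singletons contribute
  nothing to variances. This is why only pairs with at least two vertices in their union are kept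
  later.\<close>

lemma cross_singleton:
  assumes "X \<in> colorings" "l \<in> V"
  shows "cross {l} {l} X = (1 - 1 / real c) / real c"
proof -
  have "cross {l} {l} X = (\<Sum>a\<in>{1..c}. \<Sum>b\<in>{1..c}.
      of_bool (b = a) * (cind l a X * cind l b X / real c) - 1 / (real c)\<^sup>2 * (cind l a X * cind l b X))"
    unfolding cross_def cprod_simps ccov_def
    by (intro sum.cong refl) (simp add: algebra_simps)
  also have "\<dots> = (\<Sum>a\<in>{1..c}. cind l a X * cind l a X / real c)
      - (\<Sum>a\<in>{1..c}. \<Sum>b\<in>{1..c}. 1 / (real c)\<^sup>2 * (cind l a X * cind l b X))"
    unfolding sum_subtractf by (intro arg_cong2[where f = "(-)"] sum.cong refl sum_of_bool_eq)
  also have "\<dots> = (1 - 1 / real c) / real c"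
    unfolding sum_distrib_left[symmetric] sum_product[symmetric] sum_divide_distrib[symmetric]
      sum_cind[OF assms] sum_cind_square[OF assms] by simp
  finally show ?thesis .
qed

lemma avg_cross_zero:
  assumes "finite A" "finite B" "i \<in> V" "i \<in> A \<longleftrightarrow> i \<notin> B"
  shows "avg (cross A B) = 0"
proof -
  have "avg (cross A B) = avg (cavg i (cross A B))" using assms by (simp add: avg_cavg)
  also have "cavg i (cross A B) = (\<lambda>_. 0)"
    using assms by (auto simp: cavg_cross_zero cavg_cross_zero')
  finally show ?thesis by (simp add: avg_const)
qed

lemma avg_cmono_pair_square:
  assumes "i \<in> V" "j \<in> V" "i \<noteq> j"
  shows "avg (\<lambda>X. (cmono {i, j} X)\<^sup>2) = (1 - 1 / real c) / real c"
proof -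
  have "avg (\<lambda>X. (cmono {i, j} X)\<^sup>2) = avg (cavg i (\<lambda>X. cmono (insert i {j}) X * cmono (insert i {j}) X))"
    using assms by (simp add: avg_cavg power2_eq_square)
  also have "\<dots> = avg (\<lambda>X. (1 - 1 / real c) / real c)"
    using assms cavg_cmono_mult[of "{j}" "{j}" i] by (intro avg_cong) (simp add: cross_singleton)
  finally show ?thesis by (simp add: avg_const)
qed


subsection \<open>The degenerate parts of products\<close>

text \<open>The possible remainders \<open>S - {i}\<close> of an edge or triple \<open>S\<close>
  after removal of one of its vertices.\<close>

definition small :: "'v set set" where
  "small = {A. A \<subseteq> V \<and> A \<noteq> {} \<and> card A \<le> 2}"

lemma finite_small: "finite small"
  unfolding small_def using fin_V by (rule_tac finite_subset[of _ "Pow V"]) auto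

lemma small_finite: "A \<in> small \<Longrightarrow> finite A"
  unfolding small_def using fin_V finite_subset by blast

definition linked :: "('v set \<times> 'v set) set" where
  "linked = {(A, B). A \<in> small \<and> B \<in> small \<and> card A = 2 \<and> card B = 2 \<and> card (A \<inter> B) = 1}"

text \<open>For \<open>A = {j, l}\<close> and \<open>B = {j, m}\<close> the average of \<open>cross A B\<close> over the color of \<open>j\<close> is a
  multiple of \<open>cmono {l, m}\<close>. In all other cases \<open>cross A B\<close> minus its mean is already degenerate in
  every vertex of \<open>A \<union> B\<close>.\<close>

definition linkpart :: "'v set \<Rightarrow> 'v set \<Rightarrow> ('v \<Rightarrow> nat) \<Rightarrow> real" where
  "linkpart A B X = (if (A, B) \<in> linked
     then link_coef * cmono ((A - B) \<union> (B - A)) X else 0)"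

definition mainpart :: "'v set \<Rightarrow> 'v set \<Rightarrow> ('v \<Rightarrow> nat) \<Rightarrow> real" where
  "mainpart A B X = cross A B X - avg (cross A B) - linkpart A B X"

lemma small_cases:
  assumes "A \<in> small"
  obtains j where "A = {j}" "j \<in> V" | j l where "A = {j, l}" "j \<in> V" "l \<in> V" "j \<noteq> l"
proof -
  have "card A \<noteq> 0" using assms small_finite[OF assms] by (auto simp: small_def)
  then have "card A = 1 \<or> card A = 2" using assms by (auto simp: small_def)
  then show thesis using assms that
    by (elim disjE) (auto simp: card_1_singleton_iff card_2_iff small_def)
qed

lemma small_pair_cases:
  assumes "A \<in> small" "B \<in> small" "card (A \<union> B) \<ge> 2"
  obtains (disjoint) "A \<inter> B = {}"
  | (left) j l where "A = {j}" "B = {j, l}" "j \<noteq> l"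
  | (right) j l where "A = {j, l}" "B = {j}" "j \<noteq> l"
  | (equal) j l where "A = {j, l}" "B = {j, l}" "j \<noteq> l"
  | (link) j l m where "A = {j, l}" "B = {j, m}" "j \<noteq> l" "j \<noteq> m" "l \<noteq> m"
proof (cases "A \<inter> B = {}")
  case False
  then obtain j where j: "j \<in> A" "j \<in> B" by blast
  have A: "A = {j} \<or> (\<exists>l. A = {j, l} \<and> j \<noteq> l)"
    using j by (cases rule: small_cases[OF assms(1)]) auto
  have B: "B = {j} \<or> (\<exists>l. B = {j, l} \<and> j \<noteq> l)"
    using j by (cases rule: small_cases[OF assms(2)]) auto
  show thesis
  proof (cases "A = {j}")
    case True
    then have "B \<noteq> {j}" using assms(3) by auto
    then show thesis using True B left by blast
  next
    case F: False
    then obtain l where l: "A = {j, l}" "j \<noteq> l" using A by blast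
    show thesis
    proof (cases "B = {j}")
      case True then show thesis using l right by blast
    next
      case False
      then obtain m where m: "B = {j, m}" "j \<noteq> m" using B by blast
      show thesis using l m equal link by (cases "l = m") blast+
    qed
  qed
qed (rule disjoint)

lemma card_2_obtain:
  assumes "card A = 2" "j \<in> A" obtains l where "A = {j, l}" "l \<noteq> j"
proof -
  obtain x y where "A = {x, y}" "x \<noteq> y" using assms(1) by (auto simp: card_2_iff)
  then show thesis using that[of x] that[of y] assms(2) by auto
qed

lemma linkpart_upd:
  assumes "i \<notin> A \<or> i \<in> B" "i \<in> A \<or> i \<notin> B"
  shows "linkpart A B (X(i := k)) = linkpart A B X"
proof -
  have "i \<notin> (A - B) \<union> (B - A)" using assms by auto
  then show ?thesis unfolding linkpart_def using cmono_upd[of i "(A - B) \<union> (B - A)"] by simp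
qed

text \<open>At a vertex of only one of the sets each term of \<open>mainpart\<close> averages to 0.
  At a common vertex \<open>cross\<close> averages to \<open>reduced\<close> of the remainders, and
  a look at the possible overlaps shows that this is exactly the mean plus \<open>linkpart\<close>:
  0 if one remainder is empty, a constant if both are the same vertex, a multiple of
  \<open>cmono {l, m}\<close> if they are different vertices.\<close>

lemma degenerate_mainpart:
  assumes AB: "A \<in> small" "B \<in> small" "card (A \<union> B) \<ge> 2"
  shows "degenerate (A \<union> B) (mainpart A B)"
  unfolding degenerate_def
proof (intro conjI ballI)
  have fin: "finite A" "finite B" using AB small_finite by blast+
  have sub: "A \<subseteq> V" "B \<subseteq> V" using AB by (simp_all add: small_def)
  show "A \<union> B \<subseteq> V" using sub by simp
  have dm: "depends (A \<union> B) (cmono ((A - B) \<union> (B - A)))"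
    by (rule depends_mono[OF depends_cmono_set]) auto
  show "depends (A \<union> B) (mainpart A B)"
    unfolding depends_def
  proof (intro ballI impI)
    fix X Y assume XY: "X \<in> colorings" "Y \<in> colorings" "\<forall>j\<in>A \<union> B. X j = Y j"
    have "cmono ((A - B) \<union> (B - A)) X = cmono ((A - B) \<union> (B - A)) Y"
      by (rule dependsD[OF dm XY(1,2)]) (use XY(3) in blast)
    moreover have "cross A B X = cross A B Y"
      by (rule dependsD[OF depends_cross XY(1,2)]) (use XY(3) in blast)
    ultimately show "mainpart A B X = mainpart A B Y"
      unfolding mainpart_def linkpart_def by (simp only:)
  qed
  fix i X assume i: "i \<in> A \<union> B" and X: "X \<in> colorings"
  have iV: "i \<in> V" using i sub by auto
  have split: "cavg i (mainpart A B) X = cavg i (cross A B) X - avg (cross A B) - cavg i (linkpart A B) X"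
    unfolding mainpart_def cavg_diff by (simp add: cavg_constant)
  show "cavg i (mainpart A B) X = 0"
  proof (cases "i \<in> A \<inter> B")
    case False
    then have x: "i \<in> A \<longleftrightarrow> i \<notin> B" using i by auto
    then have "i \<in> (A - B) \<union> (B - A)" by auto
    then have "cavg i (cmono ((A - B) \<union> (B - A))) X = 0"
      using fin by (intro cavg_cmono) auto
    then have "cavg i (linkpart A B) X = 0"
      unfolding linkpart_def
      by (cases "(A, B) \<in> linked") (simp_all add: cavg_mult_left cavg_constant)
    then show ?thesis
      using split avg_cross_zero[OF fin iV x] x fin by (auto simp: cavg_cross_zero cavg_cross_zero')
  next
    case True
    then have i: "i \<in> A" "i \<in> B" by auto
    have linkc: "cavg i (linkpart A B) X = linkpart A B X"
      by (rule cavg_const) (simp add: linkpart_upd i)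
    have red: "cavg i (cross A B) Y = reduced (A - {i}) (B - {i}) Y" for Y
      by (rule cavg_cross[OF fin i])
    show ?thesis
    proof (cases rule: small_pair_cases[OF AB])
      case 1 then show ?thesis using True by simp
    next
      case (2 j l)
      note left = 2
      then have "i = j" using i by auto
      moreover have "l \<in> V" using left sub by auto
      moreover have "avg (cross A B) = 0"
        using fin \<open>l \<in> V\<close> left by (intro avg_cross_zero[of A B l]) auto
      moreover have "linkpart A B X = 0" using left by (simp add: linkpart_def linked_def)
      moreover have "reduced (A - {i}) (B - {i}) X = 0"
      proof -
        have *: "A - {i} = {}" "B - {i} = {l}" using left \<open>i = j\<close> by auto
        show ?thesis unfolding * using X \<open>l \<in> V\<close> by (rule reduced_empty_singleton)
      qed
      ultimately show ?thesis using split red linkc by simp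
    next
      case (3 j l)
      note right = 3
      then have "i = j" using i by auto
      moreover have "l \<in> V" using right sub by auto
      moreover have "avg (cross A B) = 0"
        using fin \<open>l \<in> V\<close> right by (intro avg_cross_zero[of A B l]) auto
      moreover have "linkpart A B X = 0" using right by (simp add: linkpart_def linked_def)
      moreover have "reduced (A - {i}) (B - {i}) X = 0"
      proof -
        have *: "A - {i} = {l}" "B - {i} = {}" using right \<open>i = j\<close> by auto
        show ?thesis unfolding * using X \<open>l \<in> V\<close> by (rule reduced_empty_singleton)
      qed
      ultimately show ?thesis using split red linkc by simp
    next
      case (4 j l)
      note equal = 4
      obtain k where k: "A - {i} = {k}" "B - {i} = {k}" "k \<in> V"
        using equal i sub by (cases "i = j") auto
      let ?r = "link_coef * (1 - 1 / real c)"
      have "avg (cross A B) = avg (cavg i (cross A B))" using iV by (simp add: avg_cavg)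
      also have "\<dots> = avg (\<lambda>_. ?r)"
        using red k by (intro avg_cong) (simp add: reduced_singleton)
      finally have "avg (cross A B) = ?r" by (simp add: avg_const)
      moreover have "linkpart A B X = 0" using equal by (simp add: linkpart_def linked_def)
      ultimately show ?thesis using split red linkc k X by (simp add: reduced_singleton)
    next
      case (5 j l m)
      note link = 5
      then have "i = j" using i by auto
      have lm: "l \<in> V" "m \<in> V" using link sub by auto
      have "(A, B) \<in> linked" using link AB by (auto simp: linked_def)
      moreover have "(A - B) \<union> (B - A) = {l, m}" using link by auto
      moreover have "avg (cross A B) = 0"
        using fin lm link by (intro avg_cross_zero[of A B l]) auto
      moreover have "A - {i} = {l}" "B - {i} = {m}" using link \<open>i = j\<close> by auto
      ultimately show ?thesis
        using split red linkc X lm link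
        by (simp add: reduced_singletons linkpart_def)
    qed
  qed
qed

lemma link_coefficient: "\<bar>1 / (real c)\<^sup>2 - 2 / (real c)^3\<bar> \<le> 1"
proof -
  have "1 / (real c)\<^sup>2 \<le> 1"
    using one_le_power[of "real c" 2] c_pos by simp
  moreover have "1 / (real c)\<^sup>2 - 2 / (real c)^3 = (real c - 2) * (1 / (real c)^3)"
    using c_pos by (simp add: field_simps power2_eq_square power3_eq_cube)
  then have "1 / (real c)\<^sup>2 - 2 / (real c)^3 \<ge> 0" using c_pos by simp
  moreover have "2 / (real c)^3 \<ge> 0" by simp
  ultimately show ?thesis by linarith
qed

lemma abs_mainpart_le: "\<bar>mainpart A B X\<bar> \<le> 3 * (real c)\<^sup>2"
proof -
  have "\<bar>avg (cross A B)\<bar> \<le> avg (\<lambda>_. (real c)\<^sup>2)"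
    by (intro order.trans[OF avg_abs avg_mono] abs_cross_le)
  then have 1: "\<bar>avg (cross A B)\<bar> \<le> (real c)\<^sup>2" by (simp add: avg_const)
  have "\<bar>link_coef\<bar> * \<bar>cmono ((A - B) \<union> (B - A)) X\<bar> \<le> 1 * real c"
    by (intro mult_mono link_coefficient abs_cmono_le) auto
  then have "\<bar>linkpart A B X\<bar> \<le> real c"
    unfolding linkpart_def by (simp add: abs_mult)
  also have "\<dots> \<le> (real c)\<^sup>2" using c_pos by (simp add: power2_eq_square)
  finally show ?thesis unfolding mainpart_def using 1 abs_cross_le[of A B X] by linarith
qed

lemma cross_minus_avg:
  assumes "A \<in> small" "B \<in> small" "X \<in> colorings"
  shows "cross A B X - avg (cross A B) = (if card (A \<union> B) \<ge> 2 then mainpart A B X else 0) + linkpart A B X"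
proof (cases "card (A \<union> B) \<ge> 2")
  case False
  obtain j where j: "A = {j}" "j \<in> V"
  proof (cases rule: small_cases[OF assms(1)])
    case (2 j l)
    have "card A \<le> card (A \<union> B)" using small_finite assms by (intro card_mono) auto
    then show ?thesis using 2 False by simp
  qed (use that in blast)
  have B: "B = {j}"
  proof (cases rule: small_cases[OF assms(2)])
    case (1 k) then show ?thesis using False j by (cases "j = k") auto
  next
    case (2 k l)
    have "card B \<le> card (A \<union> B)" using small_finite assms by (intro card_mono) auto
    then show ?thesis using 2 False by simp
  qed
  have "avg (cross {j} {j}) = avg (\<lambda>_. (1 - 1 / real c) / real c)"
    using j by (intro avg_cong) (simp add: cross_singleton)
  then have "cross A B X - avg (cross A B) = 0"
    using j B assms by (simp add: cross_singleton avg_const)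
  moreover have "linkpart A B X = 0" using j B by (simp add: linkpart_def linked_def)
  ultimately show ?thesis using False by simp
qed (simp add: mainpart_def)

text \<open>The coefficients of \<^const>\<open>cmono\<close> obtained by collecting \<^const>\<open>linkpart\<close> over the
  common vertex \<open>j\<close> of \<open>{j, l}\<close> and \<open>{j, m}\<close>.\<close>

definition link_sum :: "('v set \<Rightarrow> 'v set \<Rightarrow> real) \<Rightarrow> 'v \<Rightarrow> 'v \<Rightarrow> real" where
  "link_sum \<alpha> l m = (\<Sum>j\<in>V - {l, m}. \<alpha> {j, l} {j, m})"

abbreviation distinct_pairs :: "('v \<times> 'v) set" where
  "distinct_pairs \<equiv> {(l, m). l \<in> V \<and> m \<in> V \<and> l \<noteq> m}"

text \<open>A linked pair of edges is the same thing as its common vertex together with the ordered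
  pair of its outer vertices.\<close>

lemma sum_linkpart:
  "(\<Sum>A\<in>small. \<Sum>B\<in>small. \<alpha> A B * linkpart A B X)
    = (\<Sum>(l, m)\<in>distinct_pairs. link_sum \<alpha> l m *
        (link_coef * cmono {l, m} X))"
proof -
  let ?p = "link_coef"
  let ?P = "distinct_pairs"
  let ?f = "\<lambda>((l, m), j). ({j, l}, {j :: 'v, m})"
  have finP: "finite ?P" using fin_V by (auto intro: finite_subset[of _ "V \<times> V"])
  have "(\<Sum>A\<in>small. \<Sum>B\<in>small. \<alpha> A B * linkpart A B X)
     = (\<Sum>(A, B)\<in>small \<times> small. \<alpha> A B * linkpart A B X)" by (simp add: sum.cartesian_product)
  also have "\<dots> = (\<Sum>(A, B)\<in>linked. \<alpha> A B * linkpart A B X)"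
    by (rule sum.mono_neutral_right) (auto simp: linked_def linkpart_def finite_small split: if_splits)
  also have "\<dots> = (\<Sum>((l, m), j)\<in>Sigma ?P (\<lambda>(l, m). V - {l, m}). \<alpha> {j, l} {j, m} * (?p * cmono {l, m} X))"
  proof -
    have inj: "inj_on ?f (Sigma ?P (\<lambda>(l, m). V - {l, m}))"
      by (auto simp: inj_on_def doubleton_eq_iff)
    have im: "linked = ?f ` Sigma ?P (\<lambda>(l, m). V - {l, m})"
    proof (intro equalityI subsetI)
      fix z assume "z \<in> linked"
      then obtain A B where z: "z = (A, B)" "A \<in> small" "B \<in> small" "card A = 2" "card B = 2"
        "card (A \<inter> B) = 1" by (auto simp: linked_def)
      obtain j where j: "A \<inter> B = {j}" using z(6) by (auto simp: card_1_singleton_iff)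
      obtain l where l: "A = {j, l}" "l \<noteq> j" using card_2_obtain[OF z(4), of j] j by blast
      obtain m where m: "B = {j, m}" "m \<noteq> j" using card_2_obtain[OF z(5), of j] j by blast
      have "l \<noteq> m" using j l m by auto
      then have "((l, m), j) \<in> Sigma ?P (\<lambda>(l, m). V - {l, m})"
        using z l m by (auto simp: small_def)
      then show "z \<in> ?f ` Sigma ?P (\<lambda>(l, m). V - {l, m})"
        using z l m by (intro image_eqI[where x = "((l, m), j)"]) auto
    qed (auto simp: linked_def small_def card_insert_if)
    have "\<alpha> (fst (?f q)) (snd (?f q)) * linkpart (fst (?f q)) (snd (?f q)) X
       = (case q of ((l, m), j) \<Rightarrow> \<alpha> {j, l} {j, m} * (?p * cmono {l, m} X))"
      if "q \<in> Sigma ?P (\<lambda>(l, m). V - {l, m})" for q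
    proof -
      obtain l m j where q: "q = ((l, m), j)" "l \<in> V" "m \<in> V" "l \<noteq> m" "j \<in> V" "j \<noteq> l" "j \<noteq> m"
        using \<open>q \<in> Sigma ?P (\<lambda>(l, m). V - {l, m})\<close> by auto
      have "({j, l}, {j, m}) \<in> linked"
        using q by (auto simp: linked_def small_def card_insert_if)
      moreover have "({j, l} - {j, m}) \<union> ({j, m} - {j, l}) = {l, m}" using q by auto
      ultimately show ?thesis using q by (simp add: linkpart_def)
    qed
    then show ?thesis
      unfolding im sum.reindex[OF inj] by (intro sum.cong refl) (simp add: case_prod_unfold)
  qed
  also have "\<dots> = (\<Sum>z\<in>?P. \<Sum>j\<in>(case z of (l, m) \<Rightarrow> V - {l, m}). case z of (l, m) \<Rightarrow> \<alpha> {j, l} {j, m} * (?p * cmono {l, m} X))"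
    using finP fin_V by (subst sum.Sigma) (auto intro!: sum.cong)
  also have "\<dots> = (\<Sum>(l, m)\<in>?P. link_sum \<alpha> l m * (?p * cmono {l, m} X))"
    by (intro sum.cong refl) (auto simp: link_sum_def sum_distrib_right)
  finally show ?thesis .
qed

text \<open>The link parts have to be collected before squaring: every common vertex
  \<open>j\<close> yields the same function \<open>cmono {l, m}\<close>, so their multiplicity is
  unbounded. The main parts need no collecting, since a union of at most four vertices arises from
  at most 2^4 * 2^4 = 256 pairs. The constant is 4608 = 2 * 256 * 3^2.\<close>

lemma variance_cross_sum_le:
  fixes \<alpha> :: "'v set \<Rightarrow> 'v set \<Rightarrow> real"
  defines "\<Gamma> \<equiv> \<lambda>X. \<Sum>A\<in>small. \<Sum>B\<in>small. \<alpha> A B * cross A B X"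
  shows "avg (\<lambda>X. (\<Gamma> X - avg \<Gamma>)\<^sup>2) \<le> 4608 * (real c)^4 *
     ((\<Sum>(A, B)\<in>{(A, B). A \<in> small \<and> B \<in> small \<and> card (A \<union> B) \<ge> 2}. (\<alpha> A B)\<^sup>2)
      + (\<Sum>(l, m)\<in>distinct_pairs. (link_sum \<alpha> l m)\<^sup>2))"
proof -
  let ?P = "{(A, B). A \<in> small \<and> B \<in> small \<and> card (A \<union> B) \<ge> 2}"
  let ?Q = "distinct_pairs"
  let ?p = "link_coef"
  have finP: "finite ?P" using finite_small by (auto intro: finite_subset[of _ "small \<times> small"])
  have finQ: "finite ?Q" using fin_V by (auto intro: finite_subset[of _ "V \<times> V"])
  define R where "R X = (\<Sum>z\<in>?P. (case z of (A, B) \<Rightarrow> \<alpha> A B) * (case z of (A, B) \<Rightarrow> mainpart A B X))" for X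
  define S where "S X = (\<Sum>z\<in>?Q. (case z of (l, m) \<Rightarrow> link_sum \<alpha> l m) * (case z of (l, m) \<Rightarrow> ?p * cmono {l, m} X))" for X
  have dec: "\<Gamma> X - avg \<Gamma> = R X + S X" if X: "X \<in> colorings" for X
  proof -
    have "avg \<Gamma> = (\<Sum>A\<in>small. \<Sum>B\<in>small. \<alpha> A B * avg (cross A B))"
      unfolding \<Gamma>_def by (simp only: avg_sum avg_mult_left)
    then have "\<Gamma> X - avg \<Gamma> = (\<Sum>A\<in>small. \<Sum>B\<in>small. \<alpha> A B * (cross A B X - avg (cross A B)))"
      unfolding \<Gamma>_def by (simp add: sum_subtractf[symmetric] right_diff_distrib)
    also have "\<dots> = (\<Sum>A\<in>small. \<Sum>B\<in>small. \<alpha> A B * (if card (A \<union> B) \<ge> 2 then mainpart A B X else 0))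
       + (\<Sum>A\<in>small. \<Sum>B\<in>small. \<alpha> A B * linkpart A B X)"
      using X by (simp add: cross_minus_avg sum.distrib[symmetric] distrib_left)
    also have "(\<Sum>A\<in>small. \<Sum>B\<in>small. \<alpha> A B * (if card (A \<union> B) \<ge> 2 then mainpart A B X else 0))
       = (\<Sum>(A, B)\<in>small \<times> small. \<alpha> A B * (if card (A \<union> B) \<ge> 2 then mainpart A B X else 0))"
      by (simp add: sum.cartesian_product)
    also have "\<dots> = R X"
      unfolding R_def by (rule sum.mono_neutral_cong_right) (auto simp: finite_small split: if_splits)
    finally show ?thesis unfolding sum_linkpart S_def by (simp add: case_prod_unfold)
  qed
  have bR: "avg (\<lambda>X. (R X)\<^sup>2) \<le> real 256 * (3 * (real c)\<^sup>2)\<^sup>2 * (\<Sum>z\<in>?P. (case z of (A, B) \<Rightarrow> \<alpha> A B)\<^sup>2)"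
    unfolding R_def
  proof (rule avg_degenerate_sum_square_le[OF finP, where U = "\<lambda>(A, B). A \<union> B"])
    fix z assume z: "z \<in> ?P"
    then obtain A B where AB: "z = (A, B)" "A \<in> small" "B \<in> small" "card (A \<union> B) \<ge> 2" by auto
    show "degenerate (case z of (A, B) \<Rightarrow> A \<union> B) (\<lambda>X. case z of (A, B) \<Rightarrow> mainpart A B X)"
      using degenerate_mainpart[OF AB(2-4)] AB(1) by simp
    show "\<bar>case z of (A, B) \<Rightarrow> mainpart A B X\<bar> \<le> 3 * (real c)\<^sup>2" for X
      using AB(1) by (simp add: abs_mainpart_le)
    have finAB: "finite (A \<union> B)" using AB small_finite by auto
    have "card {q \<in> ?P. (case q of (A, B) \<Rightarrow> A \<union> B) = (case z of (A, B) \<Rightarrow> A \<union> B)}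
        \<le> card (Pow (A \<union> B) \<times> Pow (A \<union> B))"
      using finAB AB(1) by (intro card_mono) auto
    also have "\<dots> = 2 ^ card (A \<union> B) * 2 ^ card (A \<union> B)"
      using finAB by (simp add: card_cartesian_product card_Pow)
    also have "\<dots> \<le> 2 ^ 4 * 2 ^ 4"
    proof -
      have "card (A \<union> B) \<le> 4"
        using card_Un_le[of A B] AB by (auto simp: small_def)
      then show ?thesis by (intro mult_mono power_increasing) auto
    qed
    finally show "card {q \<in> ?P. (case q of (A, B) \<Rightarrow> A \<union> B) = (case z of (A, B) \<Rightarrow> A \<union> B)} \<le> 256"
      by simp
  qed
  have bS: "avg (\<lambda>X. (S X)\<^sup>2) \<le> real 4 * (real c)\<^sup>2 * (\<Sum>z\<in>?Q. (case z of (l, m) \<Rightarrow> link_sum \<alpha> l m)\<^sup>2)"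
    unfolding S_def
  proof (rule avg_degenerate_sum_square_le[OF finQ, where U = "\<lambda>(l, m). {l, m}"])
    fix z assume z: "z \<in> ?Q"
    then obtain l m where lm: "z = (l, m)" "l \<in> V" "m \<in> V" by auto
    have "degenerate {l, m} (cmono {l, m})" using lm by (intro degenerate_cmono) auto
    then have "degenerate {l, m} (\<lambda>X. ?p * cmono {l, m} X)" by (rule degenerate_scale)
    then show "degenerate (case z of (l, m) \<Rightarrow> {l, m}) (\<lambda>X. case z of (l, m) \<Rightarrow> ?p * cmono {l, m} X)"
      using lm by simp
    show "\<bar>case z of (l, m) \<Rightarrow> ?p * cmono {l, m} X\<bar> \<le> real c" for X
    proof -
      have "\<bar>?p\<bar> * \<bar>cmono {l, m} X\<bar> \<le> 1 * real c"
        by (intro mult_mono link_coefficient abs_cmono_le) auto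
      then show ?thesis unfolding lm(1) by (simp add: abs_mult)
    qed
    have "card {q \<in> ?Q. (case q of (l, m) \<Rightarrow> {l, m}) = (case z of (l, m) \<Rightarrow> {l, m})} \<le> card ({l, m} \<times> {l, m})"
      using lm(1) by (intro card_mono) auto
    also have "\<dots> \<le> 2 * 2"
      unfolding card_cartesian_product by (intro mult_mono) (auto simp: card_insert_if)
    finally show "card {q \<in> ?Q. (case q of (l, m) \<Rightarrow> {l, m}) = (case z of (l, m) \<Rightarrow> {l, m})} \<le> 4" by simp
  qed
  have "avg (\<lambda>X. (\<Gamma> X - avg \<Gamma>)\<^sup>2) \<le> avg (\<lambda>X. 2 * (R X)\<^sup>2 + 2 * (S X)\<^sup>2)"
  proof (rule avg_mono)
    fix X assume "X \<in> colorings"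
    then show "(\<Gamma> X - avg \<Gamma>)\<^sup>2 \<le> 2 * (R X)\<^sup>2 + 2 * (S X)\<^sup>2"
      unfolding dec[OF \<open>X \<in> colorings\<close>] using sum_squares_bound[of "R X" "S X"]
      by (simp add: power2_sum)
  qed
  also have "\<dots> = 2 * avg (\<lambda>X. (R X)\<^sup>2) + 2 * avg (\<lambda>X. (S X)\<^sup>2)"
    by (simp only: avg_add avg_mult_left)
  also have "\<dots> \<le> 4608 * (real c)^4 * (\<Sum>z\<in>?P. (case z of (A, B) \<Rightarrow> \<alpha> A B)\<^sup>2)
      + 4608 * (real c)^4 * (\<Sum>z\<in>?Q. (case z of (l, m) \<Rightarrow> link_sum \<alpha> l m)\<^sup>2)"
  proof (rule add_mono)
    show "2 * avg (\<lambda>X. (R X)\<^sup>2) \<le> 4608 * (real c)^4 * (\<Sum>z\<in>?P. (case z of (A, B) \<Rightarrow> \<alpha> A B)\<^sup>2)"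
      using bR by (simp add: power_mult_distrib)
    have "8 * (real c)\<^sup>2 \<le> 4608 * (real c)^4"
      using c_pos by (intro mult_mono power_increasing) auto
    then have "8 * (real c)\<^sup>2 * (\<Sum>z\<in>?Q. (case z of (l, m) \<Rightarrow> link_sum \<alpha> l m)\<^sup>2)
       \<le> 4608 * (real c)^4 * (\<Sum>z\<in>?Q. (case z of (l, m) \<Rightarrow> link_sum \<alpha> l m)\<^sup>2)"
      by (intro mult_right_mono sum_nonneg) auto
    then show "2 * avg (\<lambda>X. (S X)\<^sup>2) \<le> 4608 * (real c)^4 * (\<Sum>z\<in>?Q. (case z of (l, m) \<Rightarrow> link_sum \<alpha> l m)\<^sup>2)"
      using bS by simp
  qed
  finally show ?thesis by (simp add: case_prod_unfold distrib_left)
qed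

end


subsection \<open>Triple systems\<close>

definition codeg :: "'v set set \<Rightarrow> 'v set \<Rightarrow> nat" where
  "codeg T S = card {t \<in> T. S \<subseteq> t}"

text \<open>For i = j the set \<open>{i, j}\<close> is a singleton, and \<open>codeg\<close> would
  count all triples through \<open>i\<close>.\<close>

definition pair_deg :: "'v set set \<Rightarrow> 'v \<Rightarrow> 'v \<Rightarrow> nat" where
  "pair_deg T i j = (if i = j then 0 else codeg T {i, j})"

text \<open>Up to a factor depending on \<open>c\<close> it bounds the second moment of
  \<open>part any i\<close>; see \<open>avg_part_square_le\<close>.\<close>

definition influence :: "'v set \<Rightarrow> 'v set set \<Rightarrow> 'v \<Rightarrow> nat" where
  "influence V T i = (\<Sum>j\<in>V. (pair_deg T i j)\<^sup>2)"

text \<open>The first summand bounds the deviation of the conditional variance, the second the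
  Taylor remainder, both as found in \<open>normal_approximation\<close>. The root of 6 c^3 is the
  loss in replacing \<open>total\<close> by the variance.\<close>

definition normal_const :: "nat \<Rightarrow> real \<Rightarrow> real" where
  "normal_const c \<kappa> = 6606 * (real c)^5 * sqrt \<kappa> + 65536 * (real c)^6 * sqrt \<kappa> * (sqrt (6 * (real c)^3))^3"

text \<open>Only the set of triangles is retained from the graph. The order is given by an abstract
  injective \<open>rank\<close>, so that ties in influence may be broken arbitrarily.\<close>

locale triple_system = color_space V c for V :: "'v set" and c +
  fixes T :: "'v set set" and rank :: "'v \<Rightarrow> nat"
  assumes T_sub: "\<And>t. t \<in> T \<Longrightarrow> t \<subseteq> V" and T_card: "\<And>t. t \<in> T \<Longrightarrow> card t = 3"
    and rank_inj: "inj_on rank V"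
    and rank_influence: "\<And>i j. i \<in> V \<Longrightarrow> j \<in> V \<Longrightarrow> rank j < rank i \<Longrightarrow> influence V T i \<le> influence V T j"
begin

abbreviation d :: "'v \<Rightarrow> 'v \<Rightarrow> real" where "d i j \<equiv> real (pair_deg T i j)"

lemma sum_of_bool_card:
  "finite A \<Longrightarrow> (\<Sum>x\<in>A. of_bool (P x)) = real (card {x \<in> A. P x})"
  by (simp add: of_bool_def sum.If_cases Int_def)

lemma finite_T: "finite T"
  using T_sub fin_V by (intro finite_subset[of T "Pow V"]) auto

lemma codeg_mono: "S \<subseteq> S' \<Longrightarrow> codeg T S' \<le> codeg T S"
  unfolding codeg_def using finite_T by (intro card_mono) auto

lemma pair_deg_commute: "pair_deg T i j = pair_deg T j i"
  unfolding pair_deg_def by (simp add: insert_commute)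

text \<open>The value 0 for \<open>i\<close> in \<open>A\<close> discards the sets that are not of
  the form \<open>S - {i}\<close>, so that sums can run over all of \<open>small\<close>.\<close>

definition xdeg :: "'v \<Rightarrow> 'v set \<Rightarrow> real" where
  "xdeg i A = (if i \<in> A then 0 else real (codeg T (insert i A)))"

text \<open>The relation \<open>R\<close> is either trivial or the order given by \<open>rank\<close>.\<close>

definition rxdeg :: "('v \<Rightarrow> 'v \<Rightarrow> bool) \<Rightarrow> 'v \<Rightarrow> 'v set \<Rightarrow> real" where
  "rxdeg R i A = of_bool (\<forall>j\<in>A. R j i) * xdeg i A"

definition rdeg :: "('v \<Rightarrow> 'v \<Rightarrow> bool) \<Rightarrow> 'v \<Rightarrow> 'v \<Rightarrow> real" where
  "rdeg R i u = of_bool (R u i) * d i u"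

abbreviation (input) below :: "'v \<Rightarrow> 'v \<Rightarrow> bool" where "below j i \<equiv> rank j < rank i"

abbreviation (input) any :: "'v \<Rightarrow> 'v \<Rightarrow> bool" where "any j i \<equiv> True"

lemma xdeg_nonneg: "0 \<le> xdeg i A" unfolding xdeg_def by simp

lemma rxdeg_nonneg: "0 \<le> rxdeg R i A" unfolding rxdeg_def by (simp add: xdeg_nonneg)

lemma rdeg_nonneg: "0 \<le> rdeg R i u" unfolding rdeg_def by simp

lemma rdeg_le: "rdeg R i u \<le> d i u" unfolding rdeg_def by simp

lemma rdeg_any: "rdeg any i u = d i u" unfolding rdeg_def by simp

definition star :: "'v \<Rightarrow> 'v set set" where
  "star u = {A \<in> small. u \<in> A}"

lemma finite_star: "finite (star u)"
  unfolding star_def using finite_small by simp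

section \<open>Sums of extension degrees over the sets through a vertex\<close>

lemma rxdeg_le_rdeg:
  assumes "u \<in> A" shows "rxdeg R i A \<le> rdeg R i u"
proof -
  have "codeg T (insert i A) \<le> codeg T {i, u}" using assms by (intro codeg_mono) auto
  then show ?thesis
    using assms unfolding rxdeg_def rdeg_def xdeg_def pair_deg_def by (auto simp: of_bool_def)
qed

text \<open>Double counting: each triple counted on the left contains both \<open>i\<close> and
  \<open>u\<close>, and it has at most 2^3 subsets to serve as \<open>A\<close>.\<close>

lemma sum_xdeg_star: "(\<Sum>A\<in>star u. xdeg i A) \<le> 8 * d i u"
proof (cases "i = u")
  case True
  then show ?thesis by (auto simp: star_def xdeg_def intro!: sum_nonpos)
next
  case False
  have "(\<Sum>A\<in>star u. xdeg i A) \<le> (\<Sum>A\<in>star u. \<Sum>t\<in>T. of_bool (insert i A \<subseteq> t))"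
    unfolding sum_of_bool_card[OF finite_T] by (intro sum_mono) (simp add: xdeg_def codeg_def)
  also have "\<dots> = (\<Sum>t\<in>T. \<Sum>A\<in>star u. of_bool (insert i A \<subseteq> t))" by (rule sum.swap)
  also have "\<dots> \<le> (\<Sum>t\<in>T. of_bool ({i, u} \<subseteq> t) * 8)"
  proof (rule sum_mono)
    fix t assume t: "t \<in> T"
    have fin: "finite t" using T_card[OF t] by (simp add: card_ge_0_finite)
    have "(\<Sum>A\<in>star u. of_bool (insert i A \<subseteq> t)) = real (card {A \<in> star u. insert i A \<subseteq> t})"
      by (rule sum_of_bool_card[OF finite_star])
    also have "\<dots> \<le> of_bool ({i, u} \<subseteq> t) * 8"
    proof (cases "{i, u} \<subseteq> t")
      case True
      have "card {A \<in> star u. insert i A \<subseteq> t} \<le> card (Pow t)"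
        using fin by (intro card_mono) auto
      then show ?thesis using True T_card[OF t] fin by (simp add: card_Pow)
    next
      case False
      then have "{A \<in> star u. insert i A \<subseteq> t} = {}" by (auto simp: star_def)
      then show ?thesis by (simp only: card.empty) simp
    qed
    finally show "(\<Sum>A\<in>star u. of_bool (insert i A \<subseteq> t)) \<le> (of_bool ({i, u} \<subseteq> t) * 8 :: real)" .
  qed
  also have "\<dots> = 8 * d i u"
    unfolding sum_distrib_right[symmetric] sum_of_bool_card[OF finite_T] using False
    by (simp add: pair_deg_def codeg_def)
  finally show ?thesis .
qed

lemma sum_rxdeg_star: "(\<Sum>A\<in>star u. rxdeg R i A) \<le> 8 * rdeg R i u"
proof (cases "R u i")
  case True
  have "(\<Sum>A\<in>star u. rxdeg R i A) \<le> (\<Sum>A\<in>star u. xdeg i A)"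
    unfolding rxdeg_def by (intro sum_mono) (simp add: xdeg_nonneg)
  then show ?thesis using sum_xdeg_star[of i u] True by (simp add: rdeg_def)
next
  case False
  then have "(\<Sum>A\<in>star u. rxdeg R i A) = 0"
    by (intro sum.neutral) (auto simp: star_def rxdeg_def)
  then show ?thesis by (simp add: rdeg_nonneg)
qed

text \<open>Only one factor is summed; the other is first bounded uniformly on
  \<open>star u\<close>. The result stays a product in \<open>i\<close> and \<open>k\<close>, so
  that it can be reassembled into a square.\<close>

lemma sum_rxdeg_mult_star: "(\<Sum>A\<in>star u. rxdeg R i A * rxdeg R k A) \<le> 8 * (rdeg R i u * rdeg R k u)"
proof -
  have "(\<Sum>A\<in>star u. rxdeg R i A * rxdeg R k A) \<le> (\<Sum>A\<in>star u. rxdeg R i A * rdeg R k u)"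
    by (intro sum_mono mult_left_mono rxdeg_le_rdeg rxdeg_nonneg) (simp add: star_def)
  also have "\<dots> = (\<Sum>A\<in>star u. rxdeg R i A) * rdeg R k u" by (simp add: sum_distrib_right)
  also have "\<dots> \<le> 8 * rdeg R i u * rdeg R k u"
    by (intro mult_right_mono sum_rxdeg_star rdeg_nonneg)
  finally show ?thesis by (simp add: mult_ac)
qed

lemma sum_rxdeg_square: "(\<Sum>A\<in>small. (rxdeg R i A)\<^sup>2) \<le> 8 * (\<Sum>u\<in>V. (rdeg R i u)\<^sup>2)"
proof -
  have "(\<Sum>A\<in>small. (rxdeg R i A)\<^sup>2) \<le> (\<Sum>(u, A)\<in>Sigma V star. (rxdeg R i A)\<^sup>2)"
  proof (rule sum_le_included[where i = snd])
    show "finite (Sigma V star)" using fin_V finite_star by auto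
    show "\<forall>A\<in>small. \<exists>y\<in>Sigma V star. snd y = A \<and> (rxdeg R i A)\<^sup>2 \<le> (case y of (u, A) \<Rightarrow> (rxdeg R i A)\<^sup>2)"
    proof
      fix A assume A: "A \<in> small"
      then obtain u where "u \<in> A" "u \<in> V" by (auto simp: small_def)
      then show "\<exists>y\<in>Sigma V star. snd y = A \<and> (rxdeg R i A)\<^sup>2 \<le> (case y of (u, A) \<Rightarrow> (rxdeg R i A)\<^sup>2)"
        using A by (intro bexI[of _ "(u, A)"]) (auto simp: star_def)
    qed
  qed (auto simp: finite_small)
  also have "\<dots> = (\<Sum>u\<in>V. \<Sum>A\<in>star u. rxdeg R i A * rxdeg R i A)"
    using fin_V finite_star by (subst sum.Sigma) (auto simp: power2_eq_square)
  also have "\<dots> \<le> (\<Sum>u\<in>V. 8 * (rdeg R i u * rdeg R i u))"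
    by (intro sum_mono sum_rxdeg_mult_star)
  finally show ?thesis by (simp add: sum_distrib_left power2_eq_square)
qed


subsection \<open>The decomposition of the monochromatic count\<close>

definition edges_triples :: "'v set set" where
  "edges_triples = {S. S \<subseteq> V \<and> (card S = 2 \<or> card S = 3)}"

definition centered_count :: "('v \<Rightarrow> nat) \<Rightarrow> real" where
  "centered_count X = (\<Sum>S\<in>edges_triples. real (codeg T S) / real c ^ (3 - card S) * cmono S X)"

definition coef :: "('v \<Rightarrow> 'v \<Rightarrow> bool) \<Rightarrow> 'v \<Rightarrow> 'v set \<Rightarrow> real" where
  "coef R i A = rxdeg R i A / real c ^ (2 - card A)"

text \<open>With \<open>below\<close> this is the increment \<open>D i\<close> of the overview, with
  \<open>any\<close> it is \<open>L i\<close>, both before division by the standard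
  deviation.\<close>

definition part :: "('v \<Rightarrow> 'v \<Rightarrow> bool) \<Rightarrow> 'v \<Rightarrow> ('v \<Rightarrow> nat) \<Rightarrow> real" where
  "part R i X = (\<Sum>A\<in>small. coef R i A * cmono (insert i A) X)"

lemma finite_edges_triples: "finite edges_triples"
  unfolding edges_triples_def using fin_V by (auto intro: rev_finite_subset[of "Pow V"])

lemma coef_bounds: "0 \<le> coef R i A" "coef R i A \<le> rxdeg R i A"
proof -
  have "1 \<le> real c ^ (2 - card A)" using c_pos by (intro one_le_power) auto
  then have "rxdeg R i A * 1 \<le> rxdeg R i A * real c ^ (2 - card A)"
    by (intro mult_left_mono rxdeg_nonneg)
  then show "coef R i A \<le> rxdeg R i A"
    unfolding coef_def using c_pos by (simp add: divide_le_eq)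
  show "0 \<le> coef R i A" unfolding coef_def using rxdeg_nonneg c_pos by simp
qed

lemma coef_mem: "i \<in> A \<Longrightarrow> coef R i A = 0"
  unfolding coef_def rxdeg_def xdeg_def by simp

lemma part_eq:
  "part R i X = (\<Sum>A | A \<in> small \<and> i \<notin> A \<and> (\<forall>j\<in>A. R j i).
      real (codeg T (insert i A)) / real c ^ (3 - card (insert i A)) * cmono (insert i A) X)"
proof -
  have "part R i X = (\<Sum>A | A \<in> small \<and> i \<notin> A \<and> (\<forall>j\<in>A. R j i). coef R i A * cmono (insert i A) X)"
    unfolding part_def
    by (rule sum.mono_neutral_right) (auto simp: finite_small coef_def rxdeg_def xdeg_def)
  also have "\<dots> = (\<Sum>A | A \<in> small \<and> i \<notin> A \<and> (\<forall>j\<in>A. R j i).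
      real (codeg T (insert i A)) / real c ^ (3 - card (insert i A)) * cmono (insert i A) X)"
    by (intro sum.cong refl) (auto simp: coef_def rxdeg_def xdeg_def small_finite)
  finally show ?thesis .
qed

lemma insert_small: "i \<in> V \<Longrightarrow> A \<in> small \<Longrightarrow> i \<notin> A \<Longrightarrow> insert i A \<in> edges_triples"
  by (erule small_cases) (auto simp: edges_triples_def)

lemma remove_small:
  assumes "S \<in> edges_triples" "i \<in> S" shows "S - {i} \<in> small" "i \<in> V"
proof -
  have "card (S - {i}) = card S - 1" using assms by simp
  then have "card (S - {i}) \<noteq> 0" and le: "card (S - {i}) \<le> 2"
    using assms(1) by (auto simp: edges_triples_def)
  then have "S - {i} \<noteq> {}" by (metis card.empty)
  with le show "S - {i} \<in> small" using assms by (auto simp: small_def edges_triples_def)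
  show "i \<in> V" using assms by (auto simp: edges_triples_def)
qed

text \<open>Each index set is counted once, at its unique vertex of largest rank.\<close>

lemma sum_part: "(\<Sum>i\<in>V. part below i X) = centered_count X"
proof -
  let ?P = "Sigma V (\<lambda>i. {A. A \<in> small \<and> i \<notin> A \<and> (\<forall>j\<in>A. below j i)})"
  let ?h = "\<lambda>(i, A). insert i A"
  have inj: "inj_on ?h ?P"
  proof (rule inj_onI)
    fix p q assume p: "p \<in> ?P" and q: "q \<in> ?P" and eq: "?h p = ?h q"
    obtain i A where iA: "p = (i, A)" by (cases p)
    obtain i' A' where iA': "q = (i', A')" by (cases q)
    have A: "i \<notin> A" "\<And>j. j \<in> A \<Longrightarrow> below j i" using p unfolding iA by simp_all
    have A': "i' \<notin> A'" "\<And>j. j \<in> A' \<Longrightarrow> below j i'" using q unfolding iA' by simp_all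
    have ins: "insert i A = insert i' A'" using eq unfolding iA iA' by simp
    have "i = i'"
    proof (rule ccontr)
      assume "i \<noteq> i'"
      moreover have "i \<in> insert i' A'" unfolding ins[symmetric] by simp
      moreover have "i' \<in> insert i A" unfolding ins by simp
      ultimately have "i \<in> A'" "i' \<in> A" by simp_all
      then show False using A(2)[of i'] A'(2)[of i] by simp
    qed
    moreover have "A = A'"
      using A(1) A'(1) ins \<open>i = i'\<close> by (metis insert_ident)
    ultimately show "p = q" unfolding iA iA' by simp
  qed
  have im: "edges_triples = ?h ` ?P"
  proof (intro equalityI subsetI)
    fix S assume S: "S \<in> edges_triples"
    then have fin: "finite S" "S \<noteq> {}" by (auto simp: edges_triples_def intro: card_ge_0_finite)
    then have "Max (rank ` S) \<in> rank ` S" by (intro Max_in) auto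
    then obtain i where i: "i \<in> S" "rank i = Max (rank ` S)" by auto
    have "below j i" if "j \<in> S - {i}" for j
    proof -
      have "rank j \<le> rank i" using i fin that by simp
      moreover have "rank j \<noteq> rank i"
      proof
        assume "rank j = rank i"
        moreover have "j \<in> V" "i \<in> V" using that i S by (auto simp: edges_triples_def)
        ultimately have "j = i" by (rule inj_onD[OF rank_inj])
        then show False using that by simp
      qed
      ultimately show ?thesis by simp
    qed
    then have "(i, S - {i}) \<in> ?P" using remove_small[OF S i(1)] by auto
    then show "S \<in> ?h ` ?P" using i by (intro image_eqI[where x = "(i, S - {i})"]) auto
  next
    fix S assume "S \<in> ?h ` ?P"
    then obtain i A where "S = insert i A" "i \<in> V" "A \<in> small" "i \<notin> A" by auto
    then show "S \<in> edges_triples" by (simp add: insert_small)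
  qed
  have "centered_count X = (\<Sum>(i, A)\<in>?P.
      real (codeg T (insert i A)) / real c ^ (3 - card (insert i A)) * cmono (insert i A) X)"
    unfolding centered_count_def im sum.reindex[OF inj] by (intro sum.cong refl) auto
  also have "\<dots> = (\<Sum>i\<in>V. part below i X)"
    unfolding part_eq using fin_V finite_small by (subst sum.Sigma) auto
  finally show ?thesis by simp
qed

lemma local_part_eq:
  assumes i: "i \<in> V"
  shows "part any i X = (\<Sum>S | S \<in> edges_triples \<and> i \<in> S. real (codeg T S) / real c ^ (3 - card S) * cmono S X)"
proof -
  have inj: "inj_on (insert i) {A. A \<in> small \<and> i \<notin> A}" by (auto simp: inj_on_def insert_ident)
  have im: "{S. S \<in> edges_triples \<and> i \<in> S} = insert i ` {A. A \<in> small \<and> i \<notin> A}"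
  proof (intro equalityI subsetI)
    fix S assume S: "S \<in> {S. S \<in> edges_triples \<and> i \<in> S}"
    then show "S \<in> insert i ` {A. A \<in> small \<and> i \<notin> A}"
      using remove_small(1)[of S i] by (intro image_eqI[where x = "S - {i}"]) auto
  qed (use insert_small[OF i] in auto)
  show ?thesis unfolding im sum.reindex[OF inj] part_eq by simp
qed

text \<open>Averaging over the color of \<open>i\<close> deletes exactly the terms whose index set
  contains \<open>i\<close>.\<close>

lemma centered_count_minus_cavg:
  assumes i: "i \<in> V"
  shows "centered_count X - cavg i centered_count X = part any i X"
proof -
  let ?w = "\<lambda>S. real (codeg T S) / real c ^ (3 - card S)"
  have "centered_count X - cavg i centered_count X
      = (\<Sum>S\<in>edges_triples. ?w S * (cmono S X - cavg i (cmono S) X))"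
    unfolding centered_count_def cavg_sum cavg_mult_left right_diff_distrib sum_subtractf ..
  also have "\<dots> = (\<Sum>S | S \<in> edges_triples \<and> i \<in> S. ?w S * cmono S X)"
  proof (rule sum.mono_neutral_cong_right)
    show "\<forall>S\<in>edges_triples - {S. S \<in> edges_triples \<and> i \<in> S}. ?w S * (cmono S X - cavg i (cmono S) X) = 0"
      by (auto simp: cavg_cmono_notin)
    show "?w S * (cmono S X - cavg i (cmono S) X) = ?w S * cmono S X"
      if "S \<in> {S. S \<in> edges_triples \<and> i \<in> S}" for S
    proof -
      have "finite S" using that by (auto simp: edges_triples_def intro: card_ge_0_finite)
      then show ?thesis using that by (simp add: cavg_cmono)
    qed
  qed (auto simp: finite_edges_triples)
  finally show ?thesis using local_part_eq[OF i] by simp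
qed

lemma cavg_part: "cavg i (part R i) X = 0"
proof -
  have "cavg i (part R i) X = (\<Sum>A\<in>small. coef R i A * cavg i (cmono (insert i A)) X)"
    unfolding part_def cavg_sum cavg_mult_left ..
  also have "\<dots> = 0" using small_finite by (intro sum.neutral) (auto simp: cavg_cmono)
  finally show ?thesis .
qed

lemma cavg_part_mult:
  "cavg i (\<lambda>X. part R i X * part R' i X) X
    = (\<Sum>A\<in>small. \<Sum>B\<in>small. coef R i A * coef R' i B * cross A B X)"
proof -
  have "cavg i (\<lambda>X. part R i X * part R' i X) X = (\<Sum>A\<in>small. \<Sum>B\<in>small.
      (coef R i A * coef R' i B) * cavg i (\<lambda>X. cmono (insert i A) X * cmono (insert i B) X) X)"
    unfolding part_def sum_product cavg_sum[symmetric] cavg_mult_left[symmetric]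
    by (simp add: mult_ac)
  also have "\<dots> = (\<Sum>A\<in>small. \<Sum>B\<in>small. coef R i A * coef R' i B * cross A B X)"
  proof (intro sum.cong refl)
    fix A B assume "A \<in> small" "B \<in> small"
    then show "(coef R i A * coef R' i B) * cavg i (\<lambda>X. cmono (insert i A) X * cmono (insert i B) X) X
        = coef R i A * coef R' i B * cross A B X"
      using cavg_cmono_mult[of A B i X] small_finite coef_mem by (cases "i \<in> A \<or> i \<in> B") auto
  qed
  finally show ?thesis .
qed

lemma avg_part_square_le:
  assumes i: "i \<in> V"
  shows "avg (\<lambda>X. (part R i X)\<^sup>2) \<le> 64 * (real c)\<^sup>2 * (\<Sum>u\<in>V. (rdeg R i u)\<^sup>2)"
proof -
  have "avg (\<lambda>X. (part R i X)\<^sup>2) \<le> real 8 * (real c)\<^sup>2 * (\<Sum>A\<in>small. (coef R i A)\<^sup>2)"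
    unfolding part_def
  proof (rule avg_degenerate_sum_square_le[OF finite_small, where U = "insert i"])
    fix A assume A: "A \<in> small"
    show "degenerate (insert i A) (cmono (insert i A))"
      using A i by (intro degenerate_cmono) (auto simp: small_def)
    show "\<bar>cmono (insert i A) X\<bar> \<le> real c" for X by (rule abs_cmono_le)
    have fin: "finite (insert i A)" using small_finite[OF A] by simp
    have "card {B \<in> small. insert i B = insert i A} \<le> card (Pow (insert i A))"
      using fin by (intro card_mono) auto
    also have "\<dots> = 2 ^ card (insert i A)" using fin by (simp add: card_Pow)
    also have "\<dots> \<le> 2 ^ 3"
    proof (rule power_increasing)
      have "card (insert i A) \<le> Suc (card A)" by (rule card_insert_le_m1) auto
      then show "card (insert i A) \<le> 3" using A by (simp add: small_def)
    qed simp
    finally show "card {B \<in> small. insert i B = insert i A} \<le> 8" by simp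
  qed
  also have "\<dots> \<le> real 8 * (real c)\<^sup>2 * (8 * (\<Sum>u\<in>V. (rdeg R i u)\<^sup>2))"
  proof (intro mult_left_mono)
    have "(\<Sum>A\<in>small. (coef R i A)\<^sup>2) \<le> (\<Sum>A\<in>small. (rxdeg R i A)\<^sup>2)"
      using coef_bounds by (intro sum_mono power_mono) auto
    then show "(\<Sum>A\<in>small. (coef R i A)\<^sup>2) \<le> 8 * (\<Sum>u\<in>V. (rdeg R i u)\<^sup>2)"
      using sum_rxdeg_square[of R i] by linarith
  qed auto
  finally show ?thesis by simp
qed

lemma low_degree_part:
  assumes i: "i \<in> V" shows "low_degree 3 V (part R i)"
  unfolding part_def
proof (rule low_degree_sum[OF finite_small])
  fix A assume A: "A \<in> small"
  have "card (insert i A) \<le> Suc (card A)" by (rule card_insert_le_m1) auto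
  then have "card (insert i A) \<le> 3" using A by (simp add: small_def)
  moreover have "depends (insert i A) (\<lambda>X. coef R i A * cmono (insert i A) X)"
    using depends_cmono_set[of "insert i A"] unfolding depends_def by metis
  ultimately show "low_degree 3 V (\<lambda>X. coef R i A * cmono (insert i A) X)"
    using A i by (intro low_degree.base[of "insert i A"]) (auto simp: small_def)
qed

text \<open>Hypercontractivity in degree 3, with constant (4 c)^3 * 64 c^2. The bound is linear in
  the sum of squared degrees, hence can be summed over \<open>i\<close> to give
  \<open>total\<close>.\<close>

lemma avg_part_fourth_le:
  assumes i: "i \<in> V"
  shows "sqrt (avg (\<lambda>X. (part R i X)^4)) \<le> 4096 * (real c)^5 * (\<Sum>u\<in>V. (rdeg R i u)\<^sup>2)"
proof -
  have "avg (\<lambda>X. (part R i X)^4) \<le> (4 * real c)^(2 * 3) * (avg (\<lambda>X. (part R i X)\<^sup>2))\<^sup>2"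
    using hypercontractive[OF fin_V order_refl low_degree_part[OF i]] .
  also have "\<dots> = ((4 * real c)^3 * avg (\<lambda>X. (part R i X)\<^sup>2))\<^sup>2"
    by (simp add: power_mult_distrib power_mult[symmetric])
  finally have "avg (\<lambda>X. (part R i X)^4) \<le> ((4 * real c)^3 * avg (\<lambda>X. (part R i X)\<^sup>2))\<^sup>2" .
  moreover have "0 \<le> (4 * real c)^3 * avg (\<lambda>X. (part R i X)\<^sup>2)"
    by (intro mult_nonneg_nonneg avg_nonneg) simp_all
  ultimately have "sqrt (avg (\<lambda>X. (part R i X)^4)) \<le> (4 * real c)^3 * avg (\<lambda>X. (part R i X)\<^sup>2)"
    by (simp add: real_le_lsqrt avg_nonneg)
  also have "\<dots> \<le> (4 * real c)^3 * (64 * (real c)\<^sup>2 * (\<Sum>u\<in>V. (rdeg R i u)\<^sup>2))"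
    by (intro mult_left_mono avg_part_square_le i) auto
  also have "\<dots> = 4096 * (real c)^5 * (\<Sum>u\<in>V. (rdeg R i u)\<^sup>2)"
    by (simp add: power_mult_distrib eval_nat_numeral)
  finally show ?thesis .
qed


subsection \<open>The variance of the count\<close>

definition total :: real where
  "total = (\<Sum>i\<in>V. \<Sum>j\<in>V. (d i j)\<^sup>2)"

lemma total_nonneg: "0 \<le> total"
  unfolding total_def by (intro sum_nonneg) auto

text \<open>The edge components alone suffice: an edge has coefficient d / c and second moment (1 -
  1/c) / c \<ge> 1 / (2 c), so d^2 is at most 2 c^3 times its share of the variance. Summation over
  vertices meets each index set at most three times.\<close>

lemma avg_centered_count_square_ge: "total \<le> 6 * (real c)^3 * avg (\<lambda>X. (centered_count X)\<^sup>2)"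
proof -
  let ?w = "\<lambda>S. real (codeg T S) / real c ^ (3 - card S)"
  let ?g = "\<lambda>S. (?w S)\<^sup>2 * avg (\<lambda>X. (cmono S X)\<^sup>2)"
  let ?v = "(1 - 1 / real c) / real c"
  have g0: "?g S \<ge> 0" for S by (intro mult_nonneg_nonneg avg_nonneg) auto
  have fin: "finite S" if "S \<in> edges_triples" for S
    using that by (auto simp: edges_triples_def intro: card_ge_0_finite)
  have var: "avg (\<lambda>X. (centered_count X)\<^sup>2) = (\<Sum>S\<in>edges_triples. ?g S)"
    unfolding centered_count_def
    by (rule avg_degenerate_sum_square[OF finite_edges_triples])
       (auto simp: edges_triples_def intro: degenerate_cmono)
  have v: "1 \<le> 2 * real c * ?v"
    using c_pos by (simp add: field_simps)
  have loc: "(\<Sum>j\<in>V. (d i j)\<^sup>2) \<le> 2 * (real c)^3 * (\<Sum>S | S \<in> edges_triples \<and> i \<in> S. ?g S)"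
    if i: "i \<in> V" for i
  proof -
    have "(\<Sum>j\<in>V. (d i j)\<^sup>2) = (\<Sum>j\<in>V - {i}. (d i j)\<^sup>2)"
      using fin_V by (intro sum.mono_neutral_right) (auto simp: pair_deg_def)
    also have "\<dots> \<le> (\<Sum>j\<in>V - {i}. 2 * (real c)^3 * ?g {i, j})"
    proof (rule sum_mono)
      fix j assume j: "j \<in> V - {i}"
      then have "i \<noteq> j" by auto
      have "(d i j)\<^sup>2 * 1 \<le> (d i j)\<^sup>2 * (2 * real c * ?v)"
        using v by (intro mult_left_mono) auto
      also have "\<dots> = 2 * (real c)^3 * ?g {i, j}"
        using j i avg_cmono_pair_square[OF i _ \<open>i \<noteq> j\<close>] \<open>i \<noteq> j\<close> c_pos
        by (simp add: pair_deg_def power_divide power2_eq_square power3_eq_cube)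
      finally show "(d i j)\<^sup>2 \<le> 2 * (real c)^3 * ?g {i, j}" by simp
    qed
    also have "\<dots> = 2 * (real c)^3 * (\<Sum>S\<in>(\<lambda>j. {i, j}) ` (V - {i}). ?g S)"
    proof -
      have "inj_on (\<lambda>j. {i, j}) (V - {i})" by (auto simp: inj_on_def doubleton_eq_iff)
      then show ?thesis by (simp only: sum.reindex sum_distrib_left o_def)
    qed
    also have "\<dots> \<le> 2 * (real c)^3 * (\<Sum>S | S \<in> edges_triples \<and> i \<in> S. ?g S)"
    proof (intro mult_left_mono sum_mono2 g0)
      show "finite {S. S \<in> edges_triples \<and> i \<in> S}" using finite_edges_triples by simp
    qed (use i in \<open>auto simp: edges_triples_def card_insert_if\<close>)
    finally show ?thesis .
  qed
  have "total \<le> (\<Sum>i\<in>V. 2 * (real c)^3 * (\<Sum>S | S \<in> edges_triples \<and> i \<in> S. ?g S))"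
    unfolding total_def by (intro sum_mono loc)
  also have "\<dots> = 2 * (real c)^3 * (\<Sum>i\<in>V. \<Sum>S\<in>edges_triples. of_bool (i \<in> S) * ?g S)"
  proof -
    have "(\<Sum>S | S \<in> edges_triples \<and> i \<in> S. ?g S) = (\<Sum>S\<in>edges_triples. of_bool (i \<in> S) * ?g S)" for i
      by (rule sum.mono_neutral_cong_left) (auto simp: finite_edges_triples)
    then show ?thesis by (simp only: sum_distrib_left[symmetric])
  qed
  also have "\<dots> = 2 * (real c)^3 * (\<Sum>S\<in>edges_triples. (\<Sum>i\<in>V. of_bool (i \<in> S)) * ?g S)"
    by (subst sum.swap) (simp add: sum_distrib_right)
  also have "\<dots> \<le> 2 * (real c)^3 * (\<Sum>S\<in>edges_triples. 3 * ?g S)"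
  proof (intro mult_left_mono sum_mono mult_right_mono g0)
    fix S assume S: "S \<in> edges_triples"
    have "(\<Sum>i\<in>V. of_bool (i \<in> S)) = real (card (V \<inter> S))"
      using sum_of_bool_card[OF fin_V, of "\<lambda>i. i \<in> S"] by (simp add: Int_def)
    also have "V \<inter> S = S" using S by (auto simp: edges_triples_def)
    finally show "(\<Sum>i\<in>V. of_bool (i \<in> S)) \<le> (3 :: real)" using S by (auto simp: edges_triples_def)
  qed auto
  also have "\<dots> = 6 * (real c)^3 * avg (\<lambda>X. (centered_count X)\<^sup>2)"
    unfolding var by (simp add: sum_distrib_left mult_ac)
  finally show ?thesis .
qed

lemma avg_centered_count: "avg centered_count = 0"
proof -
  have "avg centered_count = (\<Sum>S\<in>edges_triples. real (codeg T S) / real c ^ (3 - card S) * avg (cmono S))"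
    unfolding centered_count_def avg_sum avg_mult_left ..
  also have "\<dots> = 0"
    by (intro sum.neutral) (auto simp: edges_triples_def intro!: avg_cmono_set)
  finally show ?thesis .
qed


text \<open>Write each indicator as \<open>cind\<close> plus 1/c, expand the product over the triple
  and sum over the colors. The empty set yields the mean, singletons vanish, and sets of size 2 and
  3 form \<open>centered_count\<close>.\<close>

lemma monochromatic_count:
  assumes X: "X \<in> colorings"
  shows "(\<Sum>t\<in>T. of_bool (\<exists>a. \<forall>j\<in>t. X j = a)) = real (card T) / (real c)\<^sup>2 + centered_count X"
proof -
  let ?w = "\<lambda>S. 1 / real c ^ (3 - card S) * cmono S X"
  let ?E = "\<lambda>t. {S. S \<subseteq> t \<and> (card S = 2 \<or> card S = 3)}"
  have one: "of_bool (\<exists>a. \<forall>j\<in>t. X j = a) = 1 / (real c)\<^sup>2 + (\<Sum>S\<in>?E t. ?w S)" if t: "t \<in> T" for t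
  proof -
    have fin: "finite t" and tV: "t \<subseteq> V" and card_t: "card t = 3"
      using T_card[OF t] T_sub[OF t] by (simp_all add: card_ge_0_finite)
    then obtain j0 where j0: "j0 \<in> t" by fastforce
    then have "X j0 \<in> {1..c}" using coloring_range[OF X] tV by blast
    then have "(of_bool (\<forall>j\<in>t. X j = X j0) :: real) = (\<Sum>a\<in>{1..c}. of_bool (a = X j0) * of_bool (\<forall>j\<in>t. X j = a))"
      by (rule sum_of_bool_eq[symmetric])
    also have "\<dots> = (\<Sum>a\<in>{1..c}. \<Prod>j\<in>t. cind j a X + 1 / real c)"
    proof (intro sum.cong refl)
      fix a
      have "(\<Prod>j\<in>t. cind j a X + 1 / real c) = (\<Prod>j\<in>t. of_bool (X j = a))"
        by (simp add: cind_def)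
      also have "\<dots> = of_bool (\<forall>j\<in>t. X j = a)"
        using fin by (cases "\<forall>j\<in>t. X j = a") auto
      finally show "of_bool (a = X j0) * of_bool (\<forall>j\<in>t. X j = a) = (\<Prod>j\<in>t. cind j a X + 1 / real c)"
        using j0 by auto
    qed
    also have "\<dots> = (\<Sum>a\<in>{1..c}. \<Sum>S\<in>Pow t. cprod S a X * (1 / real c) ^ card (t - S))"
      unfolding prod_add[OF fin] cprod_def by simp
    also have "\<dots> = (\<Sum>S\<in>Pow t. ?w S)"
    proof (subst sum.swap, intro sum.cong refl)
      fix S assume "S \<in> Pow t"
      then have "card (t - S) = 3 - card S" using fin card_t by (simp add: card_Diff_subset finite_subset)
      then show "(\<Sum>a\<in>{1..c}. cprod S a X * (1 / real c) ^ card (t - S)) = ?w S"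
        unfolding cmono_def by (simp add: sum_divide_distrib power_one_over)
    qed
    also have "\<dots> = (\<Sum>S\<in>insert {} (?E t). ?w S)"
    proof (rule sum.mono_neutral_right)
      show "\<forall>S\<in>Pow t - insert {} (?E t). ?w S = 0"
      proof
        fix S assume S: "S \<in> Pow t - insert {} (?E t)"
        have "card S \<le> 3" using S card_mono[of t S] fin card_t by auto
        moreover have "card S \<noteq> 0" using S fin by (auto dest: finite_subset)
        ultimately have "card S = 1" using S by auto
        then obtain i where "S = {i}" by (auto simp: card_1_singleton_iff)
        then show "?w S = 0" using S tV X cmono_singleton by auto
      qed
    qed (use fin in auto)
    also have "\<dots> = ?w {} + (\<Sum>S\<in>?E t. ?w S)"
      using fin by (intro sum.insert) (auto intro: rev_finite_subset[of "Pow t"])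
    also have "?w {} = 1 / (real c)\<^sup>2"
      using c_pos by (simp add: cmono_empty power2_eq_square power3_eq_cube)
    finally have "of_bool (\<forall>j\<in>t. X j = X j0) = 1 / (real c)\<^sup>2 + (\<Sum>S\<in>?E t. ?w S)" .
    moreover have "(\<exists>a. \<forall>j\<in>t. X j = a) \<longleftrightarrow> (\<forall>j\<in>t. X j = X j0)" using j0 by auto
    ultimately show ?thesis by simp
  qed
  have "(\<Sum>t\<in>T. of_bool (\<exists>a. \<forall>j\<in>t. X j = a)) = (\<Sum>t\<in>T. 1 / (real c)\<^sup>2 + (\<Sum>S\<in>?E t. ?w S))"
    using one by (rule sum.cong[OF refl])
  also have "\<dots> = real (card T) / (real c)\<^sup>2 + (\<Sum>t\<in>T. \<Sum>S\<in>?E t. ?w S)"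
    by (simp add: sum.distrib)
  also have "(\<Sum>t\<in>T. \<Sum>S\<in>?E t. ?w S) = (\<Sum>t\<in>T. \<Sum>S\<in>edges_triples. of_bool (S \<subseteq> t) * ?w S)"
  proof (rule sum.cong[OF refl])
    fix t assume "t \<in> T"
    then show "(\<Sum>S\<in>?E t. ?w S) = (\<Sum>S\<in>edges_triples. of_bool (S \<subseteq> t) * ?w S)"
      using T_sub[of t] finite_edges_triples
      by (intro sum.mono_neutral_cong_left) (auto simp: edges_triples_def)
  qed
  also have "\<dots> = (\<Sum>S\<in>edges_triples. (\<Sum>t\<in>T. of_bool (S \<subseteq> t)) * ?w S)"
    by (subst sum.swap) (simp only: sum_distrib_right)
  also have "\<dots> = centered_count X"
    unfolding centered_count_def sum_of_bool_card[OF finite_T] by (simp add: codeg_def)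
  finally show ?thesis .
qed


subsection \<open>The conditional covariances\<close>

text \<open>The sum \<Gamma> of the overview before division by the variance; by
  \<open>avg_cond_var\<close> its mean is the variance, so that \<Gamma> has mean 1.\<close>

definition cond_var :: "('v \<Rightarrow> nat) \<Rightarrow> real" where
  "cond_var X = (\<Sum>i\<in>V. cavg i (\<lambda>X. part below i X * part any i X) X)"

text \<open>Closed walks l, i, m, k weighted by degrees, with opposite corners distinct;
  neighbouring corners are distinct because the degree of (i, i) is 0. By
  \<open>sum_cycle_weight_le\<close> this is at most 256 times \<open>b_term\<close>.\<close>

definition four_cycles :: real where
  "four_cycles = (\<Sum>l\<in>V. \<Sum>m\<in>V - {l}. \<Sum>i\<in>V. \<Sum>k\<in>V - {i}. d i l * d i m * (d k l * d k m))"

text \<open>\<open>part below i\<close> is orthogonal to \<open>cavg i centered_count\<close>, so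
  \<open>part any i\<close> may be replaced by the whole sum; then the increments add up to
  \<open>centered_count\<close>.\<close>

lemma avg_cond_var: "avg cond_var = avg (\<lambda>X. (centered_count X)\<^sup>2)"
proof -
  have "avg cond_var = (\<Sum>i\<in>V. avg (\<lambda>X. part below i X * part any i X))"
    unfolding cond_var_def avg_sum by (intro sum.cong refl avg_cavg)
  also have "\<dots> = (\<Sum>i\<in>V. avg (\<lambda>X. part below i X * centered_count X))"
  proof (intro sum.cong refl)
    fix i assume i: "i \<in> V"
    have "avg (\<lambda>X. cavg i centered_count X * part below i X) = 0"
      by (rule cavg_zero_imp_avg_mult_zero[OF i]) (simp_all add: cavg_part cavg_upd)
    moreover have "part below i X * part any i X
        = part below i X * centered_count X - cavg i centered_count X * part below i X" for X
      using centered_count_minus_cavg[OF i, of X] by (simp add: algebra_simps flip: \<open>_ = part any i X\<close>)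
    ultimately show "avg (\<lambda>X. part below i X * part any i X) = avg (\<lambda>X. part below i X * centered_count X)"
      by (simp add: avg_diff)
  qed
  also have "\<dots> = avg (\<lambda>X. (\<Sum>i\<in>V. part below i X) * centered_count X)"
    unfolding sum_distrib_right avg_sum ..
  finally show ?thesis by (simp add: sum_part power2_eq_square)
qed

section \<open>The variance of \<open>cond_var\<close> through weighted paths\<close>

definition pair_coef :: "'v set \<Rightarrow> 'v set \<Rightarrow> real" where
  "pair_coef A B = (\<Sum>i\<in>V. coef below i A * coef any i B)"

text \<open>Weighted paths from \<open>l\<close> over \<open>i\<close> to \<open>m\<close> in which
  \<open>l\<close> precedes \<open>i\<close>. Their squares produce four-cycles, plus diagonal terms
  in which both middle vertices agree.\<close>

definition wedges :: "'v \<Rightarrow> 'v \<Rightarrow> real" where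
  "wedges l m = (\<Sum>i\<in>V. rdeg below i l * d i m)"

lemma cond_var_eq: "cond_var X = (\<Sum>A\<in>small. \<Sum>B\<in>small. pair_coef A B * cross A B X)"
proof -
  have "cond_var X = (\<Sum>i\<in>V. \<Sum>A\<in>small. \<Sum>B\<in>small. coef below i A * coef any i B * cross A B X)"
    unfolding cond_var_def by (intro sum.cong refl cavg_part_mult)
  also have "\<dots> = (\<Sum>A\<in>small. \<Sum>i\<in>V. \<Sum>B\<in>small. coef below i A * coef any i B * cross A B X)"
    by (rule sum.swap)
  also have "\<dots> = (\<Sum>A\<in>small. \<Sum>B\<in>small. \<Sum>i\<in>V. coef below i A * coef any i B * cross A B X)"
    by (intro sum.cong refl sum.swap)
  finally show ?thesis by (simp add: pair_coef_def sum_distrib_right)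
qed

lemma pair_coef_bounds:
  "0 \<le> pair_coef A B" "pair_coef A B \<le> (\<Sum>i\<in>V. rxdeg below i A * rxdeg any i B)"
  unfolding pair_coef_def
  by (intro sum_nonneg mult_nonneg_nonneg coef_bounds)
     (intro sum_mono mult_mono coef_bounds rxdeg_nonneg)

text \<open>Squaring produces two middle vertices \<open>i\<close> and \<open>k\<close>. For fixed
  \<open>i\<close> and \<open>k\<close> the sums over \<open>A\<close> and \<open>B\<close>
  separate, each is bounded by \<open>sum_rxdeg_mult_star\<close>, and the bounds recombine to the
  square of \<open>wedges\<close>.\<close>

lemma sum_pair_coef_square_star:
  "(\<Sum>A\<in>star l. \<Sum>B\<in>star m. (pair_coef A B)\<^sup>2) \<le> 64 * (wedges l m)\<^sup>2"
proof -
  let ?x = "rxdeg below" and ?y = "rxdeg any"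
  have "(\<Sum>A\<in>star l. \<Sum>B\<in>star m. (pair_coef A B)\<^sup>2)
      \<le> (\<Sum>A\<in>star l. \<Sum>B\<in>star m. (\<Sum>i\<in>V. ?x i A * ?y i B)\<^sup>2)"
    using pair_coef_bounds by (intro sum_mono power_mono) auto
  also have "\<dots> = (\<Sum>A\<in>star l. \<Sum>B\<in>star m. \<Sum>(i, k)\<in>V \<times> V. (?x i A * ?x k A) * (?y i B * ?y k B))"
    by (simp add: power2_eq_square sum_product sum.cartesian_product mult_ac)
  also have "\<dots> = (\<Sum>A\<in>star l. \<Sum>(i, k)\<in>V \<times> V. \<Sum>B\<in>star m. (?x i A * ?x k A) * (?y i B * ?y k B))"
    by (intro sum.cong refl, subst sum.swap) (simp add: case_prod_unfold)
  also have "\<dots> = (\<Sum>(i, k)\<in>V \<times> V. \<Sum>A\<in>star l. \<Sum>B\<in>star m. (?x i A * ?x k A) * (?y i B * ?y k B))"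
    by (subst sum.swap) (simp add: case_prod_unfold)
  also have "\<dots> = (\<Sum>(i, k)\<in>V \<times> V. (\<Sum>A\<in>star l. ?x i A * ?x k A) * (\<Sum>B\<in>star m. ?y i B * ?y k B))"
    by (simp add: sum_product)
  also have "\<dots> \<le> (\<Sum>(i, k)\<in>V \<times> V. (8 * (rdeg below i l * rdeg below k l)) * (8 * (rdeg any i m * rdeg any k m)))"
    by (intro sum_mono, clarify, intro mult_mono sum_rxdeg_mult_star sum_nonneg mult_nonneg_nonneg
        rxdeg_nonneg rdeg_nonneg) auto
  also have "\<dots> = 64 * (wedges l m)\<^sup>2"
    unfolding wedges_def rdeg_any
    by (simp add: power2_eq_square sum_product sum.cartesian_product sum_distrib_left mult_ac
        case_prod_unfold)
  finally show ?thesis .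
qed

text \<open>If the union has at least two vertices, there are distinct \<open>l\<close> in
  \<open>A\<close> and \<open>m\<close> in \<open>B\<close>; each pair of sets is charged to such a
  pair of vertices.\<close>

lemma sum_pair_coef_square:
  "(\<Sum>(A, B)\<in>{(A, B). A \<in> small \<and> B \<in> small \<and> card (A \<union> B) \<ge> 2}. (pair_coef A B)\<^sup>2)
    \<le> 64 * (\<Sum>(l, m)\<in>distinct_pairs. (wedges l m)\<^sup>2)"
proof -
  let ?P = "{(A, B). A \<in> small \<and> B \<in> small \<and> card (A \<union> B) \<ge> 2}"
  let ?Q = "distinct_pairs"
  let ?R = "Sigma ?Q (\<lambda>(l, m). star l \<times> star m)"
  have finP: "finite ?P" using finite_small by (auto intro: finite_subset[of _ "small \<times> small"])
  have finQ: "finite ?Q" using fin_V by (auto intro: finite_subset[of _ "V \<times> V"])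
  have finR: "finite ?R" using finQ finite_star by auto
  have "(\<Sum>(A, B)\<in>?P. (pair_coef A B)\<^sup>2) \<le> (\<Sum>z\<in>?R. (pair_coef (fst (snd z)) (snd (snd z)))\<^sup>2)"
  proof (rule sum_le_included[where i = snd, OF finP finR])
    show "\<forall>z\<in>?P. \<exists>y\<in>?R. snd y = z \<and> (case z of (A, B) \<Rightarrow> (pair_coef A B)\<^sup>2)
       \<le> (pair_coef (fst (snd y)) (snd (snd y)))\<^sup>2"
    proof
      fix z assume "z \<in> ?P"
      then obtain A B where AB: "z = (A, B)" "A \<in> small" "B \<in> small" "card (A \<union> B) \<ge> 2" by auto
      have "\<exists>l\<in>A. \<exists>m\<in>B. l \<noteq> m"
      proof (rule ccontr)
        assume "\<not> (\<exists>l\<in>A. \<exists>m\<in>B. l \<noteq> m)"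
        then have eq: "l = m" if "l \<in> A" "m \<in> B" for l m using that by blast
        obtain u v where uv: "u \<in> A" "v \<in> B" using AB by (auto simp: small_def)
        have "A \<union> B \<subseteq> {u}"
        proof
          fix x assume "x \<in> A \<union> B"
          then show "x \<in> {u}" using eq[of x v] eq[of u v] eq[of u x] uv by auto
        qed
        then have "card (A \<union> B) \<le> 1" using card_mono[of "{u}" "A \<union> B"] by simp
        then show False using AB by simp
      qed
      then obtain l m where lm: "l \<in> A" "m \<in> B" "l \<noteq> m" by blast
      then have "l \<in> V" "m \<in> V" using AB by (auto simp: small_def)
      then show "\<exists>y\<in>?R. snd y = z \<and> (case z of (A, B) \<Rightarrow> (pair_coef A B)\<^sup>2)
         \<le> (pair_coef (fst (snd y)) (snd (snd y)))\<^sup>2"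
        using lm AB by (intro bexI[of _ "((l, m), z)"]) (auto simp: star_def)
    qed
  qed auto
  also have "\<dots> = (\<Sum>q\<in>?Q. \<Sum>z\<in>(case q of (l, m) \<Rightarrow> star l \<times> star m). (pair_coef (fst z) (snd z))\<^sup>2)"
    using finQ finite_star by (subst sum.Sigma) (auto simp: case_prod_unfold)
  also have "\<dots> \<le> (\<Sum>(l, m)\<in>?Q. 64 * (wedges l m)\<^sup>2)"
  proof (rule sum_mono)
    fix q assume "q \<in> ?Q"
    obtain l m where q: "q = (l, m)" by (cases q)
    have "(\<Sum>z\<in>star l \<times> star m. (pair_coef (fst z) (snd z))\<^sup>2)
        = (\<Sum>A\<in>star l. \<Sum>B\<in>star m. (pair_coef A B)\<^sup>2)"
      by (simp add: sum.cartesian_product case_prod_unfold)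
    then show "(\<Sum>z\<in>(case q of (l, m) \<Rightarrow> star l \<times> star m). (pair_coef (fst z) (snd z))\<^sup>2)
        \<le> (case q of (l, m) \<Rightarrow> 64 * (wedges l m)\<^sup>2)"
      using sum_pair_coef_square_star[of m l] unfolding q by simp
  qed
  finally show ?thesis by (simp add: sum_distrib_left case_prod_unfold)
qed

text \<open>In the second factor the vertex \<open>j\<close> is dropped by monotonicity of the
  degree. In the first the sets \<open>{j, l}\<close> all lie in \<open>star l\<close>, so summing
  over \<open>j\<close> costs only a factor 8.\<close>

lemma link_sum_pair_coef:
  assumes "l \<in> V" "m \<in> V" "l \<noteq> m"
  shows "0 \<le> link_sum pair_coef l m" "link_sum pair_coef l m \<le> 8 * wedges l m"
proof -
  show "0 \<le> link_sum pair_coef l m"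
    unfolding link_sum_def by (intro sum_nonneg pair_coef_bounds)
  have "link_sum pair_coef l m \<le> (\<Sum>j\<in>V - {l, m}. \<Sum>i\<in>V. rxdeg below i {j, l} * rxdeg any i {j, m})"
    unfolding link_sum_def by (intro sum_mono pair_coef_bounds)
  also have "\<dots> \<le> (\<Sum>j\<in>V - {l, m}. \<Sum>i\<in>V. rxdeg below i {j, l} * rdeg any i m)"
    by (intro sum_mono mult_left_mono rxdeg_le_rdeg rxdeg_nonneg) auto
  also have "\<dots> = (\<Sum>i\<in>V. (\<Sum>j\<in>V - {l, m}. rxdeg below i {j, l}) * d i m)"
    by (subst sum.swap) (simp add: sum_distrib_right rdeg_any)
  also have "\<dots> \<le> (\<Sum>i\<in>V. 8 * rdeg below i l * d i m)"
  proof (intro sum_mono mult_right_mono)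
    fix i
    have inj: "inj_on (\<lambda>j. {j, l}) (V - {l, m})" by (auto simp: inj_on_def doubleton_eq_iff)
    have "(\<Sum>j\<in>V - {l, m}. rxdeg below i {j, l}) = (\<Sum>A\<in>(\<lambda>j. {j, l}) ` (V - {l, m}). rxdeg below i A)"
      by (simp only: sum.reindex[OF inj] o_def)
    also have "\<dots> \<le> (\<Sum>A\<in>star l. rxdeg below i A)"
      using assms finite_star rxdeg_nonneg
      by (intro sum_mono2) (auto simp: star_def small_def card_insert_if)
    also have "\<dots> \<le> 8 * rdeg below i l" by (rule sum_rxdeg_star)
    finally show "(\<Sum>j\<in>V - {l, m}. rxdeg below i {j, l}) \<le> 8 * rdeg below i l" .
  qed auto
  finally show "link_sum pair_coef l m \<le> 8 * wedges l m"
    unfolding wedges_def by (simp add: sum_distrib_left mult_ac)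
qed

text \<open>Main and link parts both cost 64 times the squared wedges: 589824 = 4608 * (64 +
  64).\<close>

lemma variance_cond_var_le_wedges:
  "avg (\<lambda>X. (cond_var X - avg cond_var)\<^sup>2)
    \<le> 589824 * (real c)^4 * (\<Sum>(l, m)\<in>distinct_pairs. (wedges l m)\<^sup>2)"
proof -
  let ?Q = "distinct_pairs"
  have "(\<Sum>(l, m)\<in>?Q. (link_sum pair_coef l m)\<^sup>2) \<le> (\<Sum>(l, m)\<in>?Q. (8 * wedges l m)\<^sup>2)"
  proof (rule sum_mono)
    fix q assume "q \<in> ?Q"
    then obtain l m where q: "q = (l, m)" and lm: "l \<in> V" "m \<in> V" "l \<noteq> m" by auto
    from power_mono[OF link_sum_pair_coef(2)[OF lm] link_sum_pair_coef(1)[OF lm], of 2]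
    show "(case q of (l, m) \<Rightarrow> (link_sum pair_coef l m)\<^sup>2) \<le> (case q of (l, m) \<Rightarrow> (8 * wedges l m)\<^sup>2)"
      unfolding q by simp
  qed
  also have "\<dots> = 64 * (\<Sum>(l, m)\<in>?Q. (wedges l m)\<^sup>2)"
    by (simp add: sum_distrib_left power_mult_distrib case_prod_unfold)
  finally have "4608 * (real c)^4 *
     ((\<Sum>(A, B)\<in>{(A, B). A \<in> small \<and> B \<in> small \<and> card (A \<union> B) \<ge> 2}. (pair_coef A B)\<^sup>2)
      + (\<Sum>(l, m)\<in>?Q. (link_sum pair_coef l m)\<^sup>2))
    \<le> 4608 * (real c)^4 * (64 * (\<Sum>(l, m)\<in>?Q. (wedges l m)\<^sup>2) + 64 * (\<Sum>(l, m)\<in>?Q. (wedges l m)\<^sup>2))"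
    using sum_pair_coef_square by (intro mult_left_mono add_mono) auto
  also have "\<dots> = 589824 * (real c)^4 * (\<Sum>(l, m)\<in>?Q. (wedges l m)\<^sup>2)" by simp
  finally show ?thesis
    using variance_cross_sum_le[of pair_coef, folded cond_var_eq] by linarith
qed

text \<open>Expand the square in the middle vertices \<open>i\<close> and \<open>k\<close>. Off the
  diagonal the order is forgotten and four-cycles remain. On the diagonal it must be kept: otherwise
  the sum of squared influences would appear, which can be as large as \<open>total\<close> squared
  in order of magnitude.\<close>

lemma sum_wedges_square_le:
  "(\<Sum>(l, m)\<in>distinct_pairs. (wedges l m)\<^sup>2)
    \<le> four_cycles + (\<Sum>i\<in>V. (\<Sum>l\<in>V. (rdeg below i l)\<^sup>2) * (\<Sum>m\<in>V. (d i m)\<^sup>2))"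
proof -
  let ?e = "rdeg below"
  have Q: "distinct_pairs = Sigma V (\<lambda>l. V - {l})" by auto
  have "(\<Sum>(l, m)\<in>distinct_pairs. (wedges l m)\<^sup>2) = (\<Sum>l\<in>V. \<Sum>m\<in>V - {l}. (wedges l m)\<^sup>2)"
    unfolding Q using fin_V by (subst sum.Sigma) auto
  also have "\<dots> \<le> (\<Sum>l\<in>V. \<Sum>m\<in>V - {l}. (\<Sum>i\<in>V. \<Sum>k\<in>V - {i}. d i l * d i m * (d k l * d k m))
     + (\<Sum>i\<in>V. (?e i l)\<^sup>2 * (d i m)\<^sup>2))"
  proof (intro sum_mono)
    fix l m
    have "(wedges l m)\<^sup>2 = (\<Sum>i\<in>V. \<Sum>k\<in>V. (?e i l * d i m) * (?e k l * d k m))"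
      unfolding wedges_def power2_eq_square sum_product ..
    also have "\<dots> = (\<Sum>i\<in>V. (?e i l * d i m) * (?e i l * d i m)
        + (\<Sum>k\<in>V - {i}. (?e i l * d i m) * (?e k l * d k m)))"
      using fin_V by (intro sum.cong refl sum.remove) auto
    also have "\<dots> \<le> (\<Sum>i\<in>V. (?e i l)\<^sup>2 * (d i m)\<^sup>2 + (\<Sum>k\<in>V - {i}. d i l * d i m * (d k l * d k m)))"
    proof (intro sum_mono add_mono)
      fix i k
      show "?e i l * d i m * (?e i l * d i m) \<le> (?e i l)\<^sup>2 * (d i m)\<^sup>2"
        by (simp add: power2_eq_square mult_ac)
      show "?e i l * d i m * (?e k l * d k m) \<le> d i l * d i m * (d k l * d k m)"
        by (intro mult_mono rdeg_le mult_nonneg_nonneg rdeg_nonneg) auto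
    qed
    finally show "(wedges l m)\<^sup>2 \<le> (\<Sum>i\<in>V. \<Sum>k\<in>V - {i}. d i l * d i m * (d k l * d k m))
     + (\<Sum>i\<in>V. (?e i l)\<^sup>2 * (d i m)\<^sup>2)" by (simp add: sum.distrib add.commute)
  qed
  also have "\<dots> = four_cycles + (\<Sum>l\<in>V. \<Sum>m\<in>V - {l}. \<Sum>i\<in>V. (?e i l)\<^sup>2 * (d i m)\<^sup>2)"
    unfolding four_cycles_def sum.distrib ..
  also have "(\<Sum>l\<in>V. \<Sum>m\<in>V - {l}. \<Sum>i\<in>V. (?e i l)\<^sup>2 * (d i m)\<^sup>2)
      \<le> (\<Sum>l\<in>V. \<Sum>m\<in>V. \<Sum>i\<in>V. (?e i l)\<^sup>2 * (d i m)\<^sup>2)"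
    using fin_V by (intro sum_mono sum_mono2 sum_nonneg mult_nonneg_nonneg) auto
  also have "\<dots> = (\<Sum>l\<in>V. \<Sum>i\<in>V. \<Sum>m\<in>V. (?e i l)\<^sup>2 * (d i m)\<^sup>2)"
    by (intro sum.cong refl sum.swap)
  also have "\<dots> = (\<Sum>i\<in>V. \<Sum>l\<in>V. \<Sum>m\<in>V. (?e i l)\<^sup>2 * (d i m)\<^sup>2)"
    by (rule sum.swap)
  also have "\<dots> = (\<Sum>i\<in>V. (\<Sum>l\<in>V. (?e i l)\<^sup>2) * (\<Sum>m\<in>V. (d i m)\<^sup>2))"
    by (simp add: sum_product)
  finally show ?thesis by simp
qed

text \<open>Processing the vertices by decreasing influence \<open>I\<close> keeps the increments small: at most
  \<open>total / I i\<close> vertices precede \<open>i\<close>, and each of them contributes at most \<open>M\<^sup>2\<close>.\<close>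

lemma sum_rdeg_below_le:
  assumes i: "i \<in> V" and M: "\<And>i j. i \<in> V \<Longrightarrow> j \<in> V \<Longrightarrow> d i j \<le> M" "0 \<le> M"
  shows "(\<Sum>l\<in>V. (rdeg below i l)\<^sup>2) \<le> M * sqrt total"
proof (rule power2_le_imp_le)
  let ?J = "\<Sum>l\<in>V. (rdeg below i l)\<^sup>2"
  let ?I = "\<lambda>i. \<Sum>m\<in>V. (d i m)\<^sup>2"
  let ?B = "{l \<in> V. below l i}"
  have J0: "0 \<le> ?J" by (intro sum_nonneg) auto
  have 1: "?J \<le> ?I i" using rdeg_le rdeg_nonneg by (intro sum_mono power_mono) auto
  have "?J = (\<Sum>l\<in>?B. (rdeg below i l)\<^sup>2)"
    using fin_V by (intro sum.mono_neutral_right) (auto simp: rdeg_def)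
  also have "\<dots> \<le> (\<Sum>l\<in>?B. M\<^sup>2)"
    using M i rdeg_nonneg by (intro sum_mono power_mono order.trans[OF rdeg_le]) auto
  finally have 2: "?J \<le> real (card ?B) * M\<^sup>2" by simp
  have "real (card ?B) * ?I i = (\<Sum>l\<in>?B. ?I i)" by simp
  also have "\<dots> \<le> (\<Sum>l\<in>?B. ?I l)"
  proof (rule sum_mono)
    fix l assume "l \<in> ?B"
    then have "influence V T i \<le> influence V T l" using rank_influence[OF i] by auto
    then have "real (influence V T i) \<le> real (influence V T l)" by simp
    then show "?I i \<le> ?I l" unfolding influence_def by simp
  qed
  also have "\<dots> \<le> total"
    unfolding total_def using fin_V by (intro sum_mono2) (auto intro: sum_nonneg)
  finally have 3: "real (card ?B) * ?I i \<le> total" .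
  \<comment> \<open>One factor is bounded by the influence of \<open>i\<close>, the other by the
    number of predecessors; the product of these two is at most \<open>total\<close>, so neither
    needs to be known.\<close>
  have "?J\<^sup>2 \<le> ?I i * (real (card ?B) * M\<^sup>2)"
    unfolding power2_eq_square[of ?J] using 1 2 J0 by (intro mult_mono) auto
  also have "\<dots> = M\<^sup>2 * (real (card ?B) * ?I i)" by simp
  also have "\<dots> \<le> M\<^sup>2 * total" using 3 by (intro mult_left_mono) auto
  also have "\<dots> = (M * sqrt total)\<^sup>2" using total_nonneg by (simp add: power_mult_distrib)
  finally show "?J\<^sup>2 \<le> (M * sqrt total)\<^sup>2" .
  show "0 \<le> M * sqrt total" using M total_nonneg by simp
qed

lemma variance_cond_var_le:
  assumes M: "\<And>i j. i \<in> V \<Longrightarrow> j \<in> V \<Longrightarrow> d i j \<le> M" "0 \<le> M"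
  shows "avg (\<lambda>X. (cond_var X - avg cond_var)\<^sup>2)
    \<le> 589824 * (real c)^4 * (four_cycles + M * sqrt total * total)"
proof -
  have "(\<Sum>i\<in>V. (\<Sum>l\<in>V. (rdeg below i l)\<^sup>2) * (\<Sum>m\<in>V. (d i m)\<^sup>2))
      \<le> (\<Sum>i\<in>V. M * sqrt total * (\<Sum>m\<in>V. (d i m)\<^sup>2))"
    by (intro sum_mono mult_right_mono sum_rdeg_below_le M sum_nonneg) auto
  also have "\<dots> = M * sqrt total * total" unfolding total_def by (simp add: sum_distrib_left)
  finally have "(\<Sum>(l, m)\<in>distinct_pairs. (wedges l m)\<^sup>2)
      \<le> four_cycles + M * sqrt total * total"
    using sum_wedges_square_le by linarith
  then show ?thesis
    by (intro order.trans[OF variance_cond_var_le_wedges] mult_left_mono) auto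
qed


subsection \<open>Normal approximation for triple systems\<close>

text \<open>The power \<rho>^10 stands for the error quantity of the final bound: the variance of
  \<Gamma> and the squared norms of the increments are of this order, so both errors in
  \<open>stein_bounded\<close> are of order \<rho>^5, as \<open>kolmogorov_bound\<close> expects.
  Writing it through \<rho> keeps all exponents integral.\<close>

lemma normal_approximation:
  assumes M: "\<And>i j. i \<in> V \<Longrightarrow> j \<in> V \<Longrightarrow> d i j \<le> M" "0 \<le> M"
    and tot: "0 < total" and \<rho>: "0 < \<rho>" "\<rho> \<le> 1" and \<kappa>: "1 \<le> \<kappa>"
    and b: "four_cycles \<le> \<kappa> * \<rho>^10 * total\<^sup>2" and m: "M \<le> \<kappa> * \<rho>^10 * sqrt total"
  shows "\<bar>avg (\<lambda>X. of_bool (centered_count X / sqrt (avg (\<lambda>X. (centered_count X)\<^sup>2)) \<le> z)) - Phi z\<bar>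
     \<le> (16 * normal_const c \<kappa> + 4) * \<rho>\<^sup>2"
proof -
  define v where "v = avg (\<lambda>X. (centered_count X)\<^sup>2)"
  define \<sigma> where "\<sigma> = sqrt v"
  define s where "s = sqrt (6 * (real c)^3)"
  have s0: "s > 0" using c_pos by (simp add: s_def)
  have s2: "s\<^sup>2 = 6 * (real c)^3" using c_pos by (simp add: s_def)
  have tv: "total \<le> s\<^sup>2 * v" unfolding s2 v_def by (rule avg_centered_count_square_ge)
  have v0: "0 < v" using tv tot s0 by (smt (verit) mult_nonneg_nonpos zero_le_power2)
  have \<sigma>0: "0 < \<sigma>" and \<sigma>2: "\<sigma>\<^sup>2 = v" using v0 by (auto simp: \<sigma>_def)
  have t\<sigma>: "sqrt total \<le> s * \<sigma>"
    using tv s0 \<sigma>0 \<sigma>2 by (intro real_le_lsqrt) (auto simp: power_mult_distrib)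
  define D where "D i X = part below i X / \<sigma>" for i X
  define W where "W X = centered_count X / \<sigma>" for X
  define L where "L i X = W X - cavg i W X" for i X
  define \<Gamma> where "\<Gamma> i = cavg i (\<lambda>X. D i X * L i X)" for i
  have divc: "cavg i (\<lambda>X. f X / k) X = cavg i f X / k" for i f X k
    using cavg_mult_left[of i "1 / k" f X] by simp
  have Lp: "L i X = part any i X / \<sigma>" if "i \<in> V" for i X
    using centered_count_minus_cavg[OF that, of X]
    unfolding L_def W_def divc by (simp add: diff_divide_distrib[symmetric])
  have \<Gamma>p: "\<Gamma> i X = cavg i (\<lambda>X. part below i X * part any i X) X / v" if "i \<in> V" for i X
  proof -
    have "(\<lambda>X. D i X * L i X) = (\<lambda>X. (part below i X * part any i X) / v)"
      unfolding D_def Lp[OF that] \<sigma>2[symmetric] by (simp add: power2_eq_square)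
    then show ?thesis unfolding \<Gamma>_def by (simp only: divc)
  qed
  have W_sum: "W X = (\<Sum>i\<in>V. D i X)" for X
    unfolding W_def D_def sum_part[symmetric] by (simp add: sum_divide_distrib)
  have D0: "cavg i (D i) X = 0" for i X
    unfolding D_def divc cavg_part by simp
  have st: "stein_bounded (sqrt (avg (\<lambda>X. (1 - (\<Sum>i\<in>V. \<Gamma> i X))\<^sup>2)))
    (2 * (\<Sum>i\<in>V. sqrt (avg (\<lambda>X. (D i X)\<^sup>2)) * sqrt (avg (\<lambda>X. (L i X)^4)))) W"
    using stein_bounded_martingale[of W D, OF W_sum D0] unfolding \<Gamma>_def L_def .
  have Abd: "sqrt (avg (\<lambda>X. (1 - (\<Sum>i\<in>V. \<Gamma> i X))\<^sup>2)) \<le> normal_const c \<kappa> * \<rho>^5"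
  proof -
    have \<Gamma>s: "(\<Sum>i\<in>V. \<Gamma> i X) = cond_var X / v" for X
      unfolding cond_var_def sum_divide_distrib by (intro sum.cong refl \<Gamma>p)
    have "(1 - (\<Sum>i\<in>V. \<Gamma> i X))\<^sup>2 = (1 / v\<^sup>2) * (cond_var X - avg cond_var)\<^sup>2" for X
      using v0 unfolding \<Gamma>s avg_cond_var v_def[symmetric]
      by (simp add: power2_eq_square field_simps)
    then have "avg (\<lambda>X. (1 - (\<Sum>i\<in>V. \<Gamma> i X))\<^sup>2) = (1 / v\<^sup>2) * avg (\<lambda>X. (cond_var X - avg cond_var)\<^sup>2)"
      by (simp only: avg_mult_left)
    also have "\<dots> \<le> (1 / v\<^sup>2) * (589824 * (real c)^4 * (2 * \<kappa> * \<rho>^10 * (s\<^sup>2 * v)\<^sup>2))"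
    proof (rule mult_left_mono)
      have "M * sqrt total * total \<le> \<kappa> * \<rho>^10 * sqrt total * sqrt total * total"
        using m tot by (intro mult_right_mono) auto
      also have "\<dots> = \<kappa> * \<rho>^10 * total\<^sup>2" using tot by (simp add: power2_eq_square)
      finally have "four_cycles + M * sqrt total * total \<le> 2 * \<kappa> * \<rho>^10 * total\<^sup>2" using b by simp
      also have "\<dots> \<le> 2 * \<kappa> * \<rho>^10 * (s\<^sup>2 * v)\<^sup>2"
        using tv tot \<kappa> by (intro mult_left_mono power_mono) auto
      finally show "avg (\<lambda>X. (cond_var X - avg cond_var)\<^sup>2)
          \<le> 589824 * (real c)^4 * (2 * \<kappa> * \<rho>^10 * (s\<^sup>2 * v)\<^sup>2)"
        by (intro order.trans[OF variance_cond_var_le[OF M]] mult_left_mono) auto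
    qed simp
    \<comment> \<open>Here 72 = 2 * 36, where 36 c^6 is s^4; the next constant is chosen with 6606^2
      \<ge> 589824 * 72.\<close>
    also have "\<dots> = 589824 * 72 * \<kappa> * ((real c)^5 * \<rho>^5)\<^sup>2"
      unfolding s2 using v0 by (simp add: field_simps eval_nat_numeral)
    also have "\<dots> \<le> 6606\<^sup>2 * \<kappa> * ((real c)^5 * \<rho>^5)\<^sup>2"
      using \<kappa> by (intro mult_right_mono) auto
    also have "\<dots> = (6606 * (real c)^5 * sqrt \<kappa> * \<rho>^5)\<^sup>2"
      using \<kappa> by (simp add: power_mult_distrib)
    finally have "sqrt (avg (\<lambda>X. (1 - (\<Sum>i\<in>V. \<Gamma> i X))\<^sup>2)) \<le> 6606 * (real c)^5 * sqrt \<kappa> * \<rho>^5"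
      using \<kappa> \<rho> by (intro real_le_lsqrt) (auto intro: avg_nonneg)
    also have "\<dots> \<le> normal_const c \<kappa> * \<rho>^5"
      unfolding normal_const_def using \<rho> \<kappa> by (intro mult_right_mono) auto
    finally show ?thesis .
  qed
  \<comment> \<open>The factor with \<open>D\<close> is bounded uniformly in \<open>i\<close>,
    thanks to the order of the vertices; the factors with \<open>L\<close> are summed and give total
    / v. The constant is 65536 = 2 * 8 * 4096.\<close>
  have Bbd: "2 * (\<Sum>i\<in>V. sqrt (avg (\<lambda>X. (D i X)\<^sup>2)) * sqrt (avg (\<lambda>X. (L i X)^4))) \<le> normal_const c \<kappa> * \<rho>^5"
  proof -
    have "sqrt (avg (\<lambda>X. (D i X)\<^sup>2)) * sqrt (avg (\<lambda>X. (L i X)^4))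
       \<le> (8 * real c * sqrt \<kappa> * \<rho>^5 * s) * (4096 * (real c)^5 * (\<Sum>u\<in>V. (d i u)\<^sup>2) / v)"
      if i: "i \<in> V" for i
    proof (rule mult_mono)
      have "avg (\<lambda>X. (D i X)\<^sup>2) = (1 / v) * avg (\<lambda>X. (part below i X)\<^sup>2)"
        unfolding D_def avg_mult_left[symmetric] \<sigma>2[symmetric] by (simp add: power_divide)
      also have "\<dots> \<le> (1 / v) * (64 * (real c)\<^sup>2 * (\<kappa> * \<rho>^10 * (s\<^sup>2 * v)))"
      proof (intro mult_left_mono order.trans[OF avg_part_square_le[OF i]])
        have "(\<Sum>u\<in>V. (rdeg below i u)\<^sup>2) \<le> M * sqrt total" by (rule sum_rdeg_below_le[OF i M])
        also have "\<dots> \<le> \<kappa> * \<rho>^10 * sqrt total * sqrt total" using m tot by (intro mult_right_mono) auto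
        also have "\<dots> = \<kappa> * \<rho>^10 * total" using tot by simp
        also have "\<dots> \<le> \<kappa> * \<rho>^10 * (s\<^sup>2 * v)" using tv \<kappa> by (intro mult_left_mono) auto
        finally show "(\<Sum>u\<in>V. (rdeg below i u)\<^sup>2) \<le> \<kappa> * \<rho>^10 * (s\<^sup>2 * v)" .
      qed (use v0 in auto)
      also have "\<dots> = (8 * real c * sqrt \<kappa> * \<rho>^5 * s)\<^sup>2"
        using v0 \<kappa> by (simp add: power_mult_distrib power_mult[symmetric])
      finally show "sqrt (avg (\<lambda>X. (D i X)\<^sup>2)) \<le> 8 * real c * sqrt \<kappa> * \<rho>^5 * s"
        using \<kappa> \<rho> s0 by (intro real_le_lsqrt) (auto intro: avg_nonneg)
      have "avg (\<lambda>X. (L i X)^4) = (1 / v\<^sup>2) * avg (\<lambda>X. (part any i X)^4)"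
        unfolding Lp[OF i] avg_mult_left[symmetric] \<sigma>2[symmetric]
        by (simp add: power_divide power_mult[symmetric])
      then have "sqrt (avg (\<lambda>X. (L i X)^4)) = (1 / v) * sqrt (avg (\<lambda>X. (part any i X)^4))"
        using v0 by (simp add: real_sqrt_divide)
      also have "\<dots> \<le> (1 / v) * (4096 * (real c)^5 * (\<Sum>u\<in>V. (rdeg any i u)\<^sup>2))"
        using v0 by (intro mult_left_mono avg_part_fourth_le i) auto
      finally show "sqrt (avg (\<lambda>X. (L i X)^4)) \<le> 4096 * (real c)^5 * (\<Sum>u\<in>V. (d i u)\<^sup>2) / v"
        by (simp add: rdeg_any)
    qed (use \<kappa> \<rho> s0 in \<open>auto intro: avg_nonneg\<close>)
    then have "(\<Sum>i\<in>V. sqrt (avg (\<lambda>X. (D i X)\<^sup>2)) * sqrt (avg (\<lambda>X. (L i X)^4)))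
       \<le> (\<Sum>i\<in>V. (8 * real c * sqrt \<kappa> * \<rho>^5 * s) * (4096 * (real c)^5 * (\<Sum>u\<in>V. (d i u)\<^sup>2) / v))"
      by (rule sum_mono)
    also have "\<dots> = (8 * real c * sqrt \<kappa> * \<rho>^5 * s) * (4096 * (real c)^5 * (total / v))"
      unfolding total_def by (simp add: sum_distrib_left sum_divide_distrib)
    also have "\<dots> \<le> (8 * real c * sqrt \<kappa> * \<rho>^5 * s) * (4096 * (real c)^5 * s\<^sup>2)"
      using tv v0 \<kappa> \<rho> s0 by (intro mult_left_mono) (auto simp: divide_le_eq)
    finally have "2 * (\<Sum>i\<in>V. sqrt (avg (\<lambda>X. (D i X)\<^sup>2)) * sqrt (avg (\<lambda>X. (L i X)^4)))
      \<le> 65536 * (real c)^6 * sqrt \<kappa> * s^3 * \<rho>^5"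
      by (simp add: eval_nat_numeral mult_ac)
    also have "\<dots> \<le> normal_const c \<kappa> * \<rho>^5"
      unfolding normal_const_def s_def[symmetric] using \<rho> \<kappa> by (intro mult_right_mono) auto
    finally show ?thesis .
  qed
  have "0 \<le> normal_const c \<kappa>"
    unfolding normal_const_def using \<kappa> by (intro add_nonneg_nonneg) auto
  from kolmogorov_bound[OF stein_bounded_mono[OF st Abd Bbd] this \<rho>, of z]
  show ?thesis unfolding W_def \<sigma>_def v_def .
qed

end


subsection \<open>Four-cycles with ordered vertices\<close>

definition cycle_weight :: "(nat \<Rightarrow> nat \<Rightarrow> nat) \<Rightarrow> nat \<Rightarrow> nat \<Rightarrow> nat \<Rightarrow> nat \<Rightarrow> nat" where
  "cycle_weight f a b e g = f a b * f b e * f e g * f g a"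

definition cycle_triple :: "(nat \<Rightarrow> nat \<Rightarrow> nat) \<Rightarrow> nat \<times> nat \<times> nat \<times> nat \<Rightarrow> nat" where
  "cycle_triple f = (\<lambda>(s1, s2, s3, s4). cycle_weight f s1 s2 s3 s4
     + cycle_weight f s1 s2 s4 s3 + cycle_weight f s1 s3 s2 s4)"

definition increasing4 :: "nat \<Rightarrow> (nat \<times> nat \<times> nat \<times> nat) set" where
  "increasing4 n = {(s1, s2, s3, s4). 1 \<le> s1 \<and> s1 < s2 \<and> s2 < s3 \<and> s3 < s4 \<and> s4 \<le> n}"

definition set4 :: "'a \<times> 'a \<times> 'a \<times> 'a \<Rightarrow> 'a set" where
  "set4 = (\<lambda>(s1, s2, s3, s4). {s1, s2, s3, s4})"

lemma finite_increasing4: "finite (increasing4 n)"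
  by (rule finite_subset[of _ "{1..n} \<times> {1..n} \<times> {1..n} \<times> {1..n}"]) (auto simp: increasing4_def)

lemma cycle_weight_rotate: "cycle_weight f a b e g = cycle_weight f b e g a"
  unfolding cycle_weight_def by simp

lemma cycle_weight_reflect:
  assumes "\<And>x y. f x y = f y x" shows "cycle_weight f a b e g = cycle_weight f a g e b"
  unfolding cycle_weight_def using assms[of a b] assms[of b e] assms[of e g] assms[of g a]
  by (simp add: mult_ac)

text \<open>The three summands of \<open>cycle_triple\<close> are the three cycles on a set of four
  vertices. Rotations bring the smallest vertex to the front, a reflection sorts its two neighbours,
  and the position of the opposite vertex decides which of the three cycles it is.\<close>

lemma sorted_cycle:
  fixes f :: "nat \<Rightarrow> nat \<Rightarrow> nat"
  assumes sym: "\<And>x y. f x y = f y x"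
    and V: "{a, b, e, g} \<subseteq> {1..n}" and dist: "distinct [a, b, e, g]"
  shows "\<exists>s\<in>increasing4 n. set4 s = {a, b, e, g} \<and> cycle_weight f a b e g \<le> cycle_triple f s"
proof -
  define P where "P a b e g \<longleftrightarrow> (\<exists>s\<in>increasing4 n. set4 s = {a, b, e, g} \<and>
    cycle_weight f a b e g \<le> cycle_triple f s)" for a b e g
  have rot: "P a b e g" if "P b e g a" for a b e g
  proof -
    have "{b, e, g, a} = {a, b, e, g}" by auto
    then show ?thesis using that unfolding P_def cycle_weight_rotate[of f a b e g] by simp
  qed
  have reflect: "P a b e g" if "P a g e b" for a b e g
  proof -
    have "{a, g, e, b} = {a, b, e, g}" by auto
    then show ?thesis using that unfolding P_def cycle_weight_reflect[where f = f and a = a and b = b and e = e and g = g, OF sym] by simp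
  qed
  have 1: "P a b e g" if *: "{a, b, e, g} \<subseteq> {1..n}" "distinct [a, b, e, g]" "a < b" "a < e" "a < g" "b < g"
    for a b e g
  proof -
    consider "e < b" | "b < e" "e < g" | "g < e" using * by force
    then show ?thesis
    proof cases
      case 1 then show ?thesis unfolding P_def using *
        by (intro bexI[of _ "(a, e, b, g)"]) (auto simp: set4_def cycle_triple_def increasing4_def)
    next
      case 2 then show ?thesis unfolding P_def using *
        by (intro bexI[of _ "(a, b, e, g)"]) (auto simp: set4_def cycle_triple_def increasing4_def)
    next
      case 3 then show ?thesis unfolding P_def using *
        by (intro bexI[of _ "(a, b, g, e)"]) (auto simp: set4_def cycle_triple_def increasing4_def)
    qed
  qed
  have 2: "P a b e g" if *: "{a, b, e, g} \<subseteq> {1..n}" "distinct [a, b, e, g]" "a < b" "a < e" "a < g"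
    for a b e g
  proof (cases "b < g")
    case True then show ?thesis using 1 * by blast
  next
    case False
    then have "P a g e b" using * by (intro 1) auto
    then show ?thesis by (rule reflect)
  qed
  have "P a b e g"
  proof -
    consider "a < b" "a < e" "a < g" | "b < a" "b < e" "b < g" | "e < a" "e < b" "e < g" | "g < a" "g < b" "g < e"
      using dist by (simp, linarith)
    then show ?thesis
    proof cases
      case 1 then show ?thesis using 2 V dist by blast
    next
      case c: 2
      have "P b e g a" using c V dist by (intro 2) auto
      then show ?thesis by (rule rot)
    next
      case 3
      have "P e g a b" using 3 V dist by (intro 2) auto
      then show ?thesis by (rule rot[OF rot])
    next
      case 4
      have "P g a b e" using 4 V dist by (intro 2) auto
      then show ?thesis by (rule rot[OF rot[OF rot]])
    qed
  qed
  then show ?thesis unfolding P_def .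
qed

text \<open>Each tuple of nonzero weight has four distinct entries and is charged to the increasing
  tuple on the same vertices; 256 = 4^4 counts all tuples with entries in that set.\<close>

lemma sum_cycle_weight_le:
  fixes f :: "nat \<Rightarrow> nat \<Rightarrow> nat"
  assumes sym: "\<And>x y. f x y = f y x" and diag: "\<And>x. f x x = 0"
  shows "(\<Sum>l\<in>{1..n}. \<Sum>m\<in>{1..n} - {l}. \<Sum>i\<in>{1..n}. \<Sum>k\<in>{1..n} - {i}. f i l * f i m * (f k l * f k m))
    \<le> 256 * (\<Sum>s\<in>increasing4 n. cycle_triple f s)"
proof -
  let ?V = "{1..n}"
  let ?D = "{(l, i, m, k). {l, i, m, k} \<subseteq> ?V \<and> distinct [l, i, m, k]}"
  let ?Q = "increasing4 n"
  let ?R = "Sigma ?Q (\<lambda>s. set4 s \<times> set4 s \<times> set4 s \<times> set4 s)"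
  have fin4: "finite (set4 s)" for s :: "nat \<times> nat \<times> nat \<times> nat"
    by (cases s) (simp add: set4_def)
  have finD: "finite ?D" by (rule finite_subset[of _ "?V \<times> ?V \<times> ?V \<times> ?V"]) auto
  have finR: "finite ?R" using finite_increasing4 fin4 by auto
  have "(\<Sum>l\<in>?V. \<Sum>m\<in>?V - {l}. \<Sum>i\<in>?V. \<Sum>k\<in>?V - {i}. f i l * f i m * (f k l * f k m))
     \<le> (\<Sum>l\<in>?V. \<Sum>m\<in>?V. \<Sum>i\<in>?V. \<Sum>k\<in>?V. of_bool (distinct [l, i, m, k]) * cycle_weight f l i m k)"
  proof (intro sum_mono)
    fix l assume "l \<in> ?V"
    have "(\<Sum>m\<in>?V - {l}. \<Sum>i\<in>?V. \<Sum>k\<in>?V - {i}. f i l * f i m * (f k l * f k m))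
      \<le> (\<Sum>m\<in>?V - {l}. \<Sum>i\<in>?V. \<Sum>k\<in>?V. of_bool (distinct [l, i, m, k]) * cycle_weight f l i m k)"
    proof (intro sum_mono)
      fix m i assume m: "m \<in> ?V - {l}"
      have "(\<Sum>k\<in>?V - {i}. f i l * f i m * (f k l * f k m))
        \<le> (\<Sum>k\<in>?V - {i}. of_bool (distinct [l, i, m, k]) * cycle_weight f l i m k)"
      proof (rule sum_mono)
        fix k assume k: "k \<in> ?V - {i}"
        have "f i l * f i m * (f k l * f k m) = cycle_weight f l i m k"
          unfolding cycle_weight_def using sym[of i l] sym[of k m] by simp
        moreover have "cycle_weight f l i m k = 0" if "\<not> distinct [l, i, m, k]"
          using that m k diag unfolding cycle_weight_def by auto
        ultimately show "f i l * f i m * (f k l * f k m)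
          \<le> of_bool (distinct [l, i, m, k]) * cycle_weight f l i m k"
          by (cases "distinct [l, i, m, k]") simp_all
      qed
      also have "\<dots> \<le> (\<Sum>k\<in>?V. of_bool (distinct [l, i, m, k]) * cycle_weight f l i m k)"
        by (rule sum_mono2) auto
      finally show "(\<Sum>k\<in>?V - {i}. f i l * f i m * (f k l * f k m))
        \<le> (\<Sum>k\<in>?V. of_bool (distinct [l, i, m, k]) * cycle_weight f l i m k)" .
    qed
    also have "\<dots> \<le> (\<Sum>m\<in>?V. \<Sum>i\<in>?V. \<Sum>k\<in>?V. of_bool (distinct [l, i, m, k]) * cycle_weight f l i m k)"
      by (rule sum_mono2) auto
    finally show "(\<Sum>m\<in>?V - {l}. \<Sum>i\<in>?V. \<Sum>k\<in>?V - {i}. f i l * f i m * (f k l * f k m))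
      \<le> (\<Sum>m\<in>?V. \<Sum>i\<in>?V. \<Sum>k\<in>?V. of_bool (distinct [l, i, m, k]) * cycle_weight f l i m k)" .
  qed
  also have "\<dots> = (\<Sum>l\<in>?V. \<Sum>i\<in>?V. \<Sum>m\<in>?V. \<Sum>k\<in>?V. of_bool (distinct [l, i, m, k]) * cycle_weight f l i m k)"
    by (intro sum.cong refl sum.swap)
  also have "\<dots> = (\<Sum>(l, i, m, k)\<in>?V \<times> ?V \<times> ?V \<times> ?V. of_bool (distinct [l, i, m, k]) * cycle_weight f l i m k)"
    by (simp only: sum.cartesian_product)
  also have "\<dots> = (\<Sum>(l, i, m, k)\<in>?D. cycle_weight f l i m k)"
  proof (rule sum.mono_neutral_cong_right)
    let ?F = "\<lambda>(l, i, m, k). of_bool (distinct [l, i, m, k]) * cycle_weight f l i m k"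
    show "\<forall>p\<in>?V \<times> ?V \<times> ?V \<times> ?V - ?D. ?F p = 0"
    proof
      fix p assume p: "p \<in> ?V \<times> ?V \<times> ?V \<times> ?V - ?D"
      obtain l i m k where q: "p = (l, i, m, k)" by (metis prod_cases4)
      have "\<not> distinct [l, i, m, k]" using p unfolding q by auto
      then show "?F p = 0" unfolding q by (simp only: prod.case of_bool_eq mult_zero_left)
    qed
    show "?F p = (\<lambda>(l, i, m, k). cycle_weight f l i m k) p" if "p \<in> ?D" for p
    proof -
      obtain l i m k where q: "p = (l, i, m, k)" by (metis prod_cases4)
      have "distinct [l, i, m, k]" using that unfolding q by simp
      then show ?thesis unfolding q by (simp only: prod.case of_bool_eq mult_1)
    qed
  qed auto
  also have "\<dots> \<le> (\<Sum>y\<in>?R. cycle_triple f (fst y))"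
  proof (rule sum_le_included[where i = snd, OF finD finR])
    show "\<forall>p\<in>?D. \<exists>y\<in>?R. snd y = p \<and> (case p of (l, i, m, k) \<Rightarrow> cycle_weight f l i m k) \<le> cycle_triple f (fst y)"
    proof
      fix p assume "p \<in> ?D"
      then obtain l i m k where p: "p = (l, i, m, k)" "{l, i, m, k} \<subseteq> ?V" "distinct [l, i, m, k]" by auto
      from sorted_cycle[where f = f, OF sym p(2,3)] obtain s where s: "s \<in> ?Q" "set4 s = {l, i, m, k}"
        "cycle_weight f l i m k \<le> cycle_triple f s" by blast
      then have "(s, p) \<in> ?R" unfolding p by simp
      then show "\<exists>y\<in>?R. snd y = p \<and> (case p of (l, i, m, k) \<Rightarrow> cycle_weight f l i m k) \<le> cycle_triple f (fst y)"
        using s(3) unfolding p(1) by (intro bexI[of _ "(s, (l, i, m, k))"]) auto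
    qed
  qed auto
  also have "\<dots> = (\<Sum>s\<in>?Q. \<Sum>p\<in>set4 s \<times> set4 s \<times> set4 s \<times> set4 s. cycle_triple f s)"
    using finite_increasing4 fin4 by (subst sum.Sigma) (auto simp: case_prod_unfold)
  also have "\<dots> = (\<Sum>s\<in>?Q. 256 * cycle_triple f s)"
  proof (rule sum.cong[OF refl])
    fix s assume "s \<in> ?Q"
    then have "card (set4 s) = 4" by (auto simp: increasing4_def set4_def card_insert_if)
    then show "(\<Sum>p\<in>set4 s \<times> set4 s \<times> set4 s \<times> set4 s. cycle_triple f s) = 256 * cycle_triple f s"
      by (simp add: card_cartesian_product)
  qed
  finally show ?thesis by (simp add: sum_distrib_left)
qed


subsection \<open>Triangles and pyramids in a graph\<close>

definition triangles :: "nat pair_pre_digraph \<Rightarrow> nat set set" where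
  "triangles G = {{u, v, w} | u v w. (u, v) \<in> parcs G \<and> (v, w) \<in> parcs G \<and> (u, w) \<in> parcs G}"

definition common :: "nat pair_pre_digraph \<Rightarrow> nat \<Rightarrow> nat \<Rightarrow> nat set" where
  "common G u v = {w. (u, w) \<in> parcs G \<and> (v, w) \<in> parcs G}"

text \<open>A pyramid with arbitrary labels, spine \<open>{u, v}\<close> and apex set
  \<open>P\<close>, by which the copies of pyramids in the graph are parametrized.\<close>

definition book :: "nat \<Rightarrow> nat \<Rightarrow> nat set \<Rightarrow> nat pair_pre_digraph" where
  "book u v P = \<lparr>pverts = {u, v} \<union> P, parcs = {(u, v), (v, u)} \<union> {u, v} \<times> P \<union> P \<times> {u, v}\<rparr>"

lemma pyramid_book: "pyramid s = book 1 2 {3..s + 2}"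
  unfolding pyramid_def book_def by simp

context
  fixes G :: "nat pair_pre_digraph"
  assumes graph: "pair_graph G"
begin

interpretation pair_graph G by (rule graph)

lemma arc_sym: "(u, v) \<in> parcs G \<Longrightarrow> (v, u) \<in> parcs G"
  using pair_sym_arcs by (auto simp: symmetric_def sym_def)

lemma arc_neq: "(u, v) \<in> parcs G \<Longrightarrow> u \<noteq> v"
  using pair_no_loops[of "(u, v)"] by simp

lemma arc_verts: "(u, v) \<in> parcs G \<Longrightarrow> u \<in> pverts G" "(u, v) \<in> parcs G \<Longrightarrow> v \<in> pverts G"
  using in_arcsD1 in_arcsD2 by blast+

lemma finite_pverts: "finite (pverts G)"
  by (rule pair_finite_verts)

lemma finite_common: "finite (common G u v)"
  by (rule finite_subset[OF _ finite_pverts]) (auto simp: common_def arc_verts)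

lemma triangles_sub: "t \<in> triangles G \<Longrightarrow> t \<subseteq> pverts G"
  unfolding triangles_def using arc_verts by blast

lemma triangles_card: "t \<in> triangles G \<Longrightarrow> card t = 3"
  unfolding triangles_def using arc_neq by (auto simp: card_insert_if)

lemma tri_deg_eq_card: "tri_deg G u v = (if (u, v) \<in> parcs G then card (common G u v) else 0)"
proof (cases "(u, v) \<in> parcs G")
  case True
  have "tri_deg G u v = (\<Sum>w\<in>pverts G - {u, v}. if w \<in> common G u v then 1 else 0)"
    unfolding tri_deg_def
  proof (rule sum.cong[OF refl])
    fix w
    have "(w, u) \<in> parcs G \<longleftrightarrow> (u, w) \<in> parcs G" using arc_sym by blast
    then show "adj G u v * adj G v w * adj G w u = (if w \<in> common G u v then 1 else 0)"
      using True by (auto simp: adj_def common_def)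
  qed
  also have "\<dots> = card ((pverts G - {u, v}) \<inter> common G u v)"
    using finite_pverts by (simp add: sum.If_cases)
  also have "(pverts G - {u, v}) \<inter> common G u v = common G u v"
    using arc_neq arc_verts unfolding common_def by blast
  finally show ?thesis using True by simp
next
  case False
  then show ?thesis unfolding tri_deg_def by (simp add: adj_def)
qed

lemma triangles_iff:
  assumes "u \<noteq> v" "u \<noteq> w" "v \<noteq> w"
  shows "{u, v, w} \<in> triangles G \<longleftrightarrow> (u, v) \<in> parcs G \<and> (v, w) \<in> parcs G \<and> (u, w) \<in> parcs G"
proof
  assume "{u, v, w} \<in> triangles G"
  then obtain a b e where abe: "{u, v, w} = {a, b, e}" "(a, b) \<in> parcs G" "(b, e) \<in> parcs G" "(a, e) \<in> parcs G"
    by (auto simp: triangles_def)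
  have all: "(x, y) \<in> parcs G" if "x \<in> {a, b, e}" "y \<in> {a, b, e}" "x \<noteq> y" for x y
    using that abe(2-4) arc_sym by blast
  have "u \<in> {a, b, e}" "v \<in> {a, b, e}" "w \<in> {a, b, e}" unfolding abe(1)[symmetric] by simp_all
  then show "(u, v) \<in> parcs G \<and> (v, w) \<in> parcs G \<and> (u, w) \<in> parcs G" using all assms by simp
qed (auto simp: triangles_def)

lemma pair_deg_triangles: "pair_deg (triangles G) u v = tri_deg G u v"
proof (cases "u = v")
  case True
  then have "(u, v) \<notin> parcs G" using arc_neq by blast
  then show ?thesis using True by (simp add: pair_deg_def tri_deg_eq_card)
next
  case False
  let ?C = "if (u, v) \<in> parcs G then common G u v else {}"
  have neq: "w \<noteq> u" "w \<noteq> v" if "w \<in> ?C" for w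
    using that arc_neq by (auto simp: common_def split: if_splits)
  have "bij_betw (\<lambda>w. {u, v, w}) ?C {t \<in> triangles G. {u, v} \<subseteq> t}"
    unfolding bij_betw_def
  proof (intro conjI equalityI subsetI)
    show "inj_on (\<lambda>w. {u, v, w}) ?C"
    proof (rule inj_onI)
      fix w w' assume "w \<in> ?C" "w' \<in> ?C" and eq: "{u, v, w} = {u, v, w'}"
      then have "w \<noteq> u" "w \<noteq> v" using neq by blast+
      moreover have "w \<in> {u, v, w'}" unfolding eq[symmetric] by simp
      ultimately show "w = w'" by simp
    qed
  next
    fix t assume "t \<in> (\<lambda>w. {u, v, w}) ` ?C"
    then obtain w where w: "w \<in> ?C" "t = {u, v, w}" by blast
    then have "{u, v, w} \<in> triangles G"
      using triangles_iff[of u v w] neq[OF w(1)] False by (auto simp: common_def split: if_splits)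
    then show "t \<in> {t \<in> triangles G. {u, v} \<subseteq> t}" using w by simp
  next
    fix t assume t: "t \<in> {t \<in> triangles G. {u, v} \<subseteq> t}"
    then have t3: "card t = 3" and uv: "{u, v} \<subseteq> t" and tri: "t \<in> triangles G"
      using triangles_card by auto
    have fin: "finite t" using t3 by (simp add: card_ge_0_finite)
    have "card (t - {u, v}) = 1" using False t3 uv fin by (simp add: card_Diff_subset)
    then obtain w where "t - {u, v} = {w}" by (auto simp: card_1_singleton_iff)
    then have w: "t = {u, v, w}" "w \<noteq> u" "w \<noteq> v" using uv by blast+
    then have "w \<in> ?C"
      using tri triangles_iff[of u v w] False by (simp add: common_def)
    then show "t \<in> (\<lambda>w. {u, v, w}) ` ?C" using w by blast
  qed
  then have "card ?C = codeg (triangles G) {u, v}"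
    unfolding codeg_def by (rule bij_betw_same_card)
  then show ?thesis using False by (simp add: pair_deg_def tri_deg_eq_card split: if_splits)
qed

section \<open>Counting copies of pyramids\<close>

lemma copies_book:
  assumes S: "S \<in> copies (book a b P) G"
  obtains h where "S = book (h a) (h b) (h ` P)" "(h a, h b) \<in> parcs G" "h ` P \<subseteq> common G (h a) (h b)"
proof -
  from S obtain f where iso: "pre_digraph.digraph_isomorphism (with_proj (book a b P)) f"
    and app: "with_proj S = app_iso f (with_proj (book a b P))"
    and sub: "subgraph (with_proj S) (with_proj G)"
    unfolding copies_def digraph_iso_def by blast
  define h where "h = iso_verts f"
  let ?B = "book a b P"
  have tails: "iso_tail f = fst" "iso_head f = snd"
    using arg_cong[OF app, of tail] arg_cong[OF app, of head] by simp_all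
  have V: "pverts S = h ` pverts ?B" using arg_cong[OF app, of verts] by (simp add: h_def)
  \<comment> \<open>An isomorphism carries its own arc map. Since head and tail are the projections
    on both sides, it must act on arcs as \<open>map_prod h h\<close>.\<close>
  have arc: "iso_arcs f e = map_prod h h e" if "e \<in> parcs ?B" for e
    using iso that tails unfolding pre_digraph.digraph_isomorphism_def h_def
    by (simp add: prod_eq_iff)
  have A: "parcs S = map_prod h h ` parcs ?B"
    using arg_cong[OF app, of arcs] arc by (simp cong: image_cong)
  have "S = \<lparr>pverts = pverts S, parcs = parcs S\<rparr>" by simp
  also have "\<dots> = book (h a) (h b) (h ` P)"
    unfolding V A unfolding book_def by (auto simp: image_Un image_iff)
  finally have Sb: "S = book (h a) (h b) (h ` P)" .
  have subA: "parcs S \<subseteq> parcs G" using sub by (simp add: subgraph_def)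
  show thesis
  proof (rule that[OF Sb])
    show "(h a, h b) \<in> parcs G" using subA unfolding Sb book_def by auto
    show "h ` P \<subseteq> common G (h a) (h b)" using subA unfolding Sb book_def common_def by auto
  qed
qed

lemma finite_copies: "finite (copies H G)"
proof -
  have "copies H G \<subseteq> (\<lambda>(A, B). \<lparr>pverts = A, parcs = B\<rparr>) ` (Pow (pverts G) \<times> Pow (parcs G))"
  proof
    fix S assume "S \<in> copies H G"
    then have "pverts S \<subseteq> pverts G" "parcs S \<subseteq> parcs G" by (simp_all add: copies_def subgraph_def)
    then show "S \<in> (\<lambda>(A, B). \<lparr>pverts = A, parcs = B\<rparr>) ` (Pow (pverts G) \<times> Pow (parcs G))"
      by (intro image_eqI[of _ _ "(pverts S, parcs S)"]) simp_all
  qed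
  then show ?thesis
    by (rule finite_subset) (simp add: finite_pverts pair_finite_arcs)
qed

text \<open>The apexes \<open>p\<close> and \<open>q\<close> may coincide, so triangles and
  2-pyramids are covered by the same count.\<close>

abbreviation small_books :: "nat pair_pre_digraph set" where
  "small_books \<equiv> {book u v {p, q} | u v p q. (u, v) \<in> parcs G \<and> p \<in> common G u v \<and> q \<in> common G u v}"

lemma card_books_le:
  "card small_books
     \<le> (\<Sum>u\<in>pverts G. \<Sum>v\<in>pverts G. (tri_deg G u v)\<^sup>2)"
proof -
  let ?S = "Sigma (parcs G) (\<lambda>(u, v). common G u v \<times> common G u v)"
  have fin: "finite ?S" using pair_finite_arcs finite_common by auto
  have "small_books
     \<subseteq> (\<lambda>((u, v), (p, q)). book u v {p, q}) ` ?S"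
  proof
    fix S assume "S \<in> small_books"
    then obtain u v p q where "S = book u v {p, q}" "((u, v), (p, q)) \<in> ?S" by auto
    then show "S \<in> (\<lambda>((u, v), (p, q)). book u v {p, q}) ` ?S"
      by (intro image_eqI[where x = "((u, v), (p, q))"]) simp_all
  qed
  then have "card small_books \<le> card ?S"
    using fin by (rule surj_card_le[rotated])
  also have "\<dots> = (\<Sum>(u, v)\<in>parcs G. card (common G u v) * card (common G u v))"
    using pair_finite_arcs finite_common
    by (subst card_SigmaI) (auto simp: card_cartesian_product case_prod_unfold)
  also have "\<dots> = (\<Sum>(u, v)\<in>parcs G. (tri_deg G u v)\<^sup>2)"
    by (intro sum.cong refl) (auto simp: tri_deg_eq_card power2_eq_square)
  also have "\<dots> \<le> (\<Sum>(u, v)\<in>pverts G \<times> pverts G. (tri_deg G u v)\<^sup>2)"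
    using finite_pverts arc_verts by (intro sum_mono2) auto
  finally show ?thesis by (simp add: sum.cartesian_product)
qed

lemma num_copies_small_pyramid_le:
  assumes "s = 1 \<or> s = 2"
  shows "num_copies (pyramid s) G \<le> (\<Sum>u\<in>pverts G. \<Sum>v\<in>pverts G. (tri_deg G u v)\<^sup>2)"
proof -
  let ?S = "small_books"
  have apex: "{3..s + 2} = {3, s + 2}" using assms by auto
  have sub: "copies (pyramid s) G \<subseteq> ?S"
  proof
    fix S assume "S \<in> copies (pyramid s) G"
    then have "S \<in> copies (book 1 2 {3, s + 2}) G" unfolding pyramid_book apex .
    then obtain h where h: "S = book (h 1) (h 2) (h ` {3, s + 2})" "(h 1, h 2) \<in> parcs G"
      "h ` {3, s + 2} \<subseteq> common G (h 1) (h 2)" by (rule copies_book)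
    then show "S \<in> ?S" by (intro CollectI exI[of _ "h 1"] exI[of _ "h 2"] exI[of _ "h 3"] exI[of _ "h (s + 2)"]) auto
  qed
  have "finite ?S"
  proof (rule finite_subset)
    show "?S \<subseteq> (\<lambda>(u, v, p, q). book u v {p, q}) ` (pverts G \<times> pverts G \<times> pverts G \<times> pverts G)"
      using arc_verts unfolding common_def by (auto simp: image_iff) fastforce
  qed (use finite_pverts in auto)
  then have "card (copies (pyramid s) G) \<le> card ?S" using sub by (rule card_mono)
  then show ?thesis unfolding num_copies_def using card_books_le by linarith
qed

lemma book_in_copies:
  assumes uv: "(u, v) \<in> parcs G" and P: "P \<subseteq> common G u v" and card: "card P = s" "finite P"
  shows "book u v P \<in> copies (pyramid s) G"
proof -
  have neq: "u \<noteq> v" "u \<notin> P" "v \<notin> P" using uv P arc_neq unfolding common_def by blast+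
  obtain k where k: "bij_betw k {3..s + 2} P"
    using finite_same_card_bij[of "{3..s + 2}" P] card by auto
  define h where "h i = (if i = 1 then u else if i = 2 then v else k i)" for i :: nat
  have h12: "h 1 = u" "h 2 = v" by (simp_all add: h_def)
  have hP: "h ` {3..s + 2} = P"
  proof -
    have "h ` {3..s + 2} = k ` {3..s + 2}" by (intro image_cong) (auto simp: h_def)
    then show ?thesis using k by (simp add: bij_betw_def)
  qed
  have injh: "inj_on h ({1, 2} \<union> {3..s + 2})"
  proof -
    have "inj_on h {3..s + 2}"
      using k by (subst inj_on_cong[of _ _ k]) (auto simp: h_def bij_betw_def)
    moreover have "h ` ({1, 2} - {3..s + 2}) \<inter> h ` ({3..s + 2} - {1, 2}) = {}"
      using hP h12 neq by auto
    moreover have "inj_on h {1, 2}" using neq by (auto simp: h_def)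
    ultimately show ?thesis by (subst inj_on_Un) blast
  qed
  have sub: "pverts (book u v P) \<subseteq> pverts G" "parcs (book u v P) \<subseteq> parcs G"
    using uv P arc_sym arc_verts unfolding book_def common_def by auto
  have graphB: "pair_graph (book u v P)"
  proof unfold_locales
    show "finite (pverts (book u v P))" "finite (parcs (book u v P))"
      using card by (auto simp: book_def)
    show "symmetric (with_proj (book u v P))"
      by (auto simp: symmetric_def sym_def book_def)
    show "fst e \<noteq> snd e" if "e \<in> parcs (book u v P)" for e
      using that neq by (auto simp: book_def)
  qed (auto simp: book_def)
  define f :: "(nat, nat \<times> nat, nat, nat \<times> nat) digraph_isomorphism"
    where "f = \<lparr>iso_verts = h, iso_arcs = map_prod h h, iso_head = snd, iso_tail = fst\<rparr>"
  have wfp: "wf_digraph (with_proj (pyramid s))"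
    by unfold_locales (auto simp: pyramid_def)
  have arcs_pyr: "parcs (pyramid s) \<subseteq> ({1, 2} \<union> {3..s + 2}) \<times> ({1, 2} \<union> {3..s + 2})"
    by (auto simp: pyramid_def)
  have "pre_digraph.digraph_isomorphism (with_proj (pyramid s)) f"
    unfolding pre_digraph.digraph_isomorphism_def
  proof (intro conjI ballI)
    show "inj_on (iso_verts f) (verts (with_proj (pyramid s)))"
      using injh by (simp add: f_def pyramid_def)
    have "inj_on (map_prod h h) (({1, 2} \<union> {3..s + 2}) \<times> ({1, 2} \<union> {3..s + 2}))"
      using injh by (rule map_prod_inj_on[OF _ injh])
    then have "inj_on (map_prod h h) (parcs (pyramid s))"
      using arcs_pyr by (rule inj_on_subset)
    then show "inj_on (iso_arcs f) (arcs (with_proj (pyramid s)))" by (simp add: f_def)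
  qed (auto simp: f_def wfp)
  moreover have "with_proj (book u v P) = app_iso f (with_proj (pyramid s))"
  proof -
    have "h ` pverts (pyramid s) = pverts (book u v P)"
      unfolding pyramid_book book_def using hP h12 by (simp add: image_Un)
    moreover have "map_prod h h ` parcs (pyramid s) = parcs (book u v P)"
      unfolding pyramid_book book_def hP[symmetric] h12[symmetric] by (auto simp: image_Un image_iff)
    ultimately show ?thesis by (simp add: app_iso_def with_proj_def f_def)
  qed
  ultimately have "digraph_iso (with_proj (pyramid s)) (with_proj (book u v P))"
    unfolding digraph_iso_def by blast
  moreover have "wf_digraph (with_proj (book u v P))"
    using graphB by (meson pair_graph.pair_graphD_graph graph.axioms(1) digraph.axioms(1) fin_digraph.axioms(1))
  moreover have "wf_digraph (with_proj G)"
    using graph by (meson pair_graph.pair_graphD_graph graph.axioms(1) digraph.axioms(1) fin_digraph.axioms(1))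
  ultimately show ?thesis
    using graphB sub by (simp add: copies_def subgraph_def compatible_def)
qed

text \<open>Different apex sets over the fixed spine \<open>{u, v}\<close> give different vertex
  sets and hence different copies. If \<open>u\<close> and \<open>v\<close> are not adjacent, the
  degree is 0 and the binomial coefficient vanishes for positive \<open>s\<close>.\<close>

lemma choose_le_num_copies: "tri_deg G u v choose s \<le> num_copies (pyramid s) G" if "0 < s"
proof (cases "(u, v) \<in> parcs G")
  case True
  let ?P = "{P. P \<subseteq> common G u v \<and> card P = s}"
  have neq: "u \<notin> P" "v \<notin> P" if "P \<subseteq> common G u v" for P
    using that arc_neq unfolding common_def by blast+
  have inj: "inj_on (book u v) ?P"
  proof (rule inj_onI)
    fix P Q assume PQ: "P \<in> ?P" "Q \<in> ?P" and "book u v P = book u v Q"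
    then have eq: "{u, v} \<union> P = {u, v} \<union> Q" by (simp add: book_def)
    have n: "u \<notin> P" "v \<notin> P" "u \<notin> Q" "v \<notin> Q" using PQ neq by blast+
    then have "P = ({u, v} \<union> P) - {u, v}" by auto
    also have "\<dots> = Q" unfolding eq using n by auto
    finally show "P = Q" .
  qed
  have "tri_deg G u v choose s = card ?P"
    using True by (simp add: tri_deg_eq_card n_subsets[OF finite_common])
  also have "\<dots> = card (book u v ` ?P)" by (rule card_image[OF inj, symmetric])
  also have "\<dots> \<le> num_copies (pyramid s) G"
    unfolding num_copies_def
  proof (rule card_mono[OF finite_copies], rule image_subsetI)
    fix P assume "P \<in> ?P"
    then show "book u v P \<in> copies (pyramid s) G"
      using True finite_common by (intro book_in_copies) (auto intro: finite_subset)
  qed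
  finally show ?thesis .
qed (use that in \<open>cases s; simp add: tri_deg_eq_card\<close>)

text \<open>From degree 4 on, (d / 4)^4 is at most d choose 4. Below that d^4 is at most 4^4, and
  there may be no 4-pyramid at all: this is covered by the 1 in the numerator of
  \<open>R1\<close>.\<close>

lemma tri_deg_power4_le: "tri_deg G u v ^ 4 \<le> 256 * (1 + num_copies (pyramid 4) G)"
proof (cases "4 \<le> tri_deg G u v")
  case True
  let ?d = "tri_deg G u v"
  have "(real ?d / 4) ^ 4 \<le> real (?d choose 4)"
    using binomial_ge_n_over_k_pow_k[OF True, where 'a = real] by simp
  then have "real (?d ^ 4) \<le> real (256 * (?d choose 4))" by (simp add: power_divide)
  then have "?d ^ 4 \<le> 256 * (?d choose 4)" by (simp only: of_nat_le_iff)
  also have "\<dots> \<le> 256 * (1 + num_copies (pyramid 4) G)"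
    using choose_le_num_copies[of 4 u v] by simp
  finally show ?thesis .
next
  case False
  then have "tri_deg G u v ^ 4 \<le> 4 ^ 4" by (intro power_mono) auto
  then show ?thesis by simp
qed

section \<open>\<open>b_term\<close> and \<open>T3\<close> as sums over increasing tuples and
  triangles\<close>

lemma b_term_eq: "b_term G = (\<Sum>s\<in>increasing4 (card (pverts G)). cycle_triple (tri_deg G) s)"
  unfolding b_term_def Let_def increasing4_def cycle_triple_def cycle_weight_def
  by (intro sum.cong refl)

lemma T3_eq:
  assumes V: "pverts G = {1..card (pverts G)}"
  shows "T3 G X = (\<Sum>t\<in>triangles G. of_bool (\<exists>a. \<forall>j\<in>t. X j = a))"
proof -
  let ?n = "card (pverts G)"
  let ?I = "{(s1, s2, s3). 1 \<le> s1 \<and> s1 < s2 \<and> s2 < s3 \<and> s3 \<le> ?n}"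
  let ?J = "{(s1, s2, s3). s1 < s2 \<and> s2 < s3 \<and> (s1, s2) \<in> parcs G \<and> (s2, s3) \<in> parcs G \<and> (s1, s3) \<in> parcs G}"
  let ?h = "\<lambda>(s1, s2, s3). {s1, s2, s3 :: nat}"
  have finI: "finite ?I" by (rule finite_subset[of _ "{1..?n} \<times> {1..?n} \<times> {1..?n}"]) auto
  have in_V: "1 \<le> i \<and> i \<le> ?n" if "i \<in> pverts G" for i using that V by (metis atLeastAtMost_iff)
  have JI: "?J \<subseteq> ?I" using in_V arc_verts by auto
  have inj: "inj_on ?h ?J"
  proof (rule inj_onI)
    fix p q assume p: "p \<in> ?J" and q: "q \<in> ?J" and eq: "?h p = ?h q"
    obtain a b e where pa: "p = (a, b, e)" by (cases p)
    obtain a' b' e' where qa: "q = (a', b', e')" by (cases q)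
    have ord: "a < b" "b < e" "a' < b'" "b' < e'" using p q unfolding pa qa by auto
    \<comment> \<open>An increasing triple is recovered from its set of entries by sorting.\<close>
    have "sorted_list_of_set (set [a, b, e]) = [a, b, e]"
      by (rule sorted_list_of_set.idem_if_sorted_distinct) (use ord in simp_all)
    moreover have "sorted_list_of_set (set [a', b', e']) = [a', b', e']"
      by (rule sorted_list_of_set.idem_if_sorted_distinct) (use ord in simp_all)
    moreover have "set [a, b, e] = set [a', b', e']" using eq unfolding pa qa by simp
    ultimately have "[a, b, e] = [a', b', e']" by metis
    then show "p = q" unfolding pa qa by simp
  qed
  have im: "triangles G = ?h ` ?J"
  proof (intro equalityI subsetI)
    fix t assume "t \<in> triangles G"
    then obtain a b e where t: "t = {a, b, e}" "(a, b) \<in> parcs G" "(b, e) \<in> parcs G" "(a, e) \<in> parcs G"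
      by (auto simp: triangles_def)
    have all: "(x, y) \<in> parcs G" if "x \<in> {a, b, e}" "y \<in> {a, b, e}" "x \<noteq> y" for x y
      using that t(2-4) arc_sym by blast
    have "a \<noteq> b" "b \<noteq> e" "a \<noteq> e" using t arc_neq by blast+
    then have "\<exists>x y z. {x, y, z} = {a, b, e} \<and> x < y \<and> y < z"
      by (metis insert_commute linorder_less_linear)
    then obtain x y z where xyz: "{x, y, z} = {a, b, e}" "x < y" "y < z" by blast
    have "x \<in> {a, b, e}" "y \<in> {a, b, e}" "z \<in> {a, b, e}" unfolding xyz(1)[symmetric] by simp_all
    then have "(x, y, z) \<in> ?J" using all xyz(2,3) by auto
    then show "t \<in> ?h ` ?J" using xyz t by (intro image_eqI[of _ _ "(x, y, z)"]) auto
  qed (auto simp: triangles_def)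
  have "T3 G X = (\<Sum>(s1, s2, s3)\<in>?J. of_bool (X s1 = X s2 \<and> X s2 = X s3))"
    unfolding T3_def
    by (rule sum.mono_neutral_cong_right[OF finI JI]) (auto simp: adj_def split: if_splits)
  also have "\<dots> = (\<Sum>t\<in>triangles G. of_bool (\<exists>a. \<forall>j\<in>t. X j = a))"
    unfolding im sum.reindex[OF inj] by (intro sum.cong refl) auto
  finally show ?thesis .
qed

end


subsection \<open>Monochromatic triangles\<close>

lemma coloring_pmf:
  assumes "color_space (pverts G) c"
  shows "coloring c G = pmf_of_set (color_space.colorings (pverts G) c)"
proof -
  interpret color_space "pverts G" c by fact
  show ?thesis
    unfolding coloring_def colorings_def using fin_V c_pos by (intro Pi_pmf_of_set) auto
qed

lemma coloring_expectation:
  assumes "color_space (pverts G) c"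
  shows "measure_pmf.expectation (coloring c G) f = color_space.avg (pverts G) c f"
proof -
  interpret color_space "pverts G" c by fact
  show ?thesis unfolding coloring_pmf[OF assms] avg_def
    by (rule integral_pmf_of_set[OF colorings_nonempty finite_colorings])
qed

lemma coloring_prob:
  assumes "color_space (pverts G) c"
  shows "measure_pmf.prob (coloring c G) {X. P X} = color_space.avg (pverts G) c (\<lambda>X. of_bool (P X))"
proof -
  interpret color_space "pverts G" c by fact
  show ?thesis unfolding coloring_pmf[OF assms] avg_def
    by (simp add: measure_pmf_of_set[OF colorings_nonempty finite_colorings] finite_colorings
        of_bool_def sum.If_cases)
qed

text \<open>For r \<ge> 1 the bound is trivial, since the left side is at most 1. Otherwise \<rho> =
  r^(1/10) is used. The constant 1024 is 256 * 2^2: 256 from the sorting of four-cycles, 2^2 from N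
  \<le> 2 * total squared.\<close>

lemma graph_normal_approximation:
  assumes c: "2 \<le> c" and G: "labelled_graph G" and K3: "1 \<le> num_copies K3 G"
  defines "r \<equiv> R1 G powr (1/4) + R2 G"
  shows "\<bar>measure_pmf.prob (coloring c G) {X. Z3 c G X \<le> z} - Phi z\<bar>
    \<le> (16 * normal_const c 1024 + 4) * r powr (1/5)"
proof -
  have graph: "pair_graph G" and V: "pverts G = {1..card (pverts G)}"
    using G by (auto simp: labelled_graph_def)
  define n where "n = card (pverts G)"
  note V' = V[folded n_def]
  let ?V = "pverts G" and ?T = "triangles G"
  have finV: "finite ?V" by (rule finite_pverts[OF graph])
  define I where "I = influence ?V ?T"
  \<comment> \<open>Two digits in base n + 1: the leading one decreases with the influence, the
    trailing one is the label \<open>i\<close> \<le> n and makes the rank injective. The subtraction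
    does not truncate on vertices, as \<open>I i\<close> is one of the summands.\<close>
  define rank where "rank i = ((\<Sum>j\<in>?V. I j) - I i) * (n + 1) + i" for i
  interpret triple_system ?V c ?T rank
  proof
    show "finite ?V" "2 \<le> c" by (fact finV, fact c)
    show "t \<subseteq> ?V" "card t = 3" if "t \<in> ?T" for t
      using that triangles_sub[OF graph] triangles_card[OF graph] by auto
    show "inj_on rank ?V"
    proof (rule inj_onI)
      fix i j assume ij: "i \<in> ?V" "j \<in> ?V" and eq: "rank i = rank j"
      have "i < n + 1" "j < n + 1" using ij V' by auto
      then have "rank i mod (n + 1) = i" "rank j mod (n + 1) = j"
        unfolding rank_def by (simp_all only: mod_mult_self3 mod_less)
      then show "i = j" using eq by simp
    qed
    fix i j assume ij: "i \<in> ?V" "j \<in> ?V" "rank j < rank i"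
    show "influence ?V ?T i \<le> influence ?V ?T j"
    proof (rule ccontr)
      let ?B = "\<Sum>j\<in>?V. I j"
      assume "\<not> ?thesis"
      then have "I j < I i" by (simp add: I_def)
      moreover have "I i \<le> ?B" using finV ij by (intro member_le_sum) auto
      ultimately have "Suc (?B - I i) \<le> ?B - I j" by simp
      then have "Suc (?B - I i) * (n + 1) \<le> (?B - I j) * (n + 1)" by (rule mult_right_mono) simp
      moreover have "i \<le> n" using ij V' by auto
      ultimately have "rank i < rank j + 1" unfolding rank_def by simp
      then show False using ij by simp
    qed
  qed
  have deg: "d i j = real (tri_deg G i j)" for i j by (simp add: pair_deg_triangles[OF graph])
  define N where "N = real (num_copies K3 G) + real (num_copies (pyramid 2) G)"
  define N4 where "N4 = real (num_copies (pyramid 4) G)"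
  have N1: "1 \<le> N" using K3 by (simp add: N_def)
  have total: "total = real (\<Sum>u\<in>?V. \<Sum>v\<in>?V. (tri_deg G u v)\<^sup>2)"
    unfolding total_def deg by simp
  have NQ: "N \<le> 2 * total"
  proof -
    have "real (num_copies (pyramid s) G) \<le> total" if "s = 1 \<or> s = 2" for s
      unfolding total of_nat_le_iff by (rule num_copies_small_pyramid_le[OF graph that])
    from this[of 1] this[of 2] show ?thesis unfolding N_def pyramid_1[symmetric] by simp
  qed
  have R1: "R1 G = (1 + N4) / N\<^sup>2" and R2: "R2 G = real (b_term G) / N\<^sup>2"
    unfolding R1_def R2_def N_def N4_def by simp_all
  have N40: "N4 \<ge> 0" by (simp add: N4_def)
  have R1pos: "0 < R1 G" unfolding R1 using N1 N40 by (intro divide_pos_pos) auto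
  have R20: "0 \<le> R2 G" unfolding R2 by simp
  have rpos: "0 < r" unfolding r_def using R1pos R20 by (intro add_pos_nonneg) auto
  have C0: "0 \<le> normal_const c 1024" unfolding normal_const_def by simp
  define v where "v = sqrt (avg (\<lambda>X. (centered_count X)\<^sup>2))"
  have prob: "measure_pmf.prob (coloring c G) {X. Z3 c G X \<le> z} = avg (\<lambda>X. of_bool (centered_count X / v \<le> z))"
  proof -
    have T3: "T3 G X = real (card ?T) / (real c)\<^sup>2 + centered_count X" if "X \<in> colorings" for X
      unfolding T3_eq[OF graph V] by (rule monochromatic_count[OF that])
    have mean: "avg (T3 G) = real (card ?T) / (real c)\<^sup>2"
    proof -
      have "avg (T3 G) = avg (\<lambda>X. real (card ?T) / (real c)\<^sup>2 + centered_count X)"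
        by (intro avg_cong T3)
      then show ?thesis by (simp add: avg_add avg_const avg_centered_count)
    qed
    have "avg (\<lambda>X. (T3 G X - avg (T3 G))\<^sup>2) = avg (\<lambda>X. (centered_count X)\<^sup>2)"
      by (intro avg_cong) (simp add: T3 mean)
    then have "Z3 c G X = centered_count X / v" if "X \<in> colorings" for X
      unfolding Z3_def coloring_expectation[OF color_space_axioms] v_def using T3[OF that] mean by simp
    then show ?thesis
      unfolding coloring_prob[OF color_space_axioms] by (intro avg_cong) simp
  qed
  show ?thesis
  proof (cases "r < 1")
    case False
    have "0 \<le> measure_pmf.prob (coloring c G) {X. Z3 c G X \<le> z}"
      "measure_pmf.prob (coloring c G) {X. Z3 c G X \<le> z} \<le> 1"
      by (simp_all add: measure_pmf.prob_le_1)
    then have "\<bar>measure_pmf.prob (coloring c G) {X. Z3 c G X \<le> z} - Phi z\<bar> \<le> 1"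
      using Phi_bounds[of z] by linarith
    also have "1 \<le> (16 * normal_const c 1024 + 4) * r powr (1/5)"
    proof -
      have "1 \<le> r powr (1/5)" using False by (simp add: ge_one_powr_ge_zero)
      then have "1 * 1 \<le> (16 * normal_const c 1024 + 4) * r powr (1/5)"
        using C0 by (intro mult_mono) auto
      then show ?thesis by simp
    qed
    finally show ?thesis .
  next
    case True
    define \<rho> where "\<rho> = r powr (1/10)"
    have \<rho>: "0 < \<rho>" "\<rho> \<le> 1" using rpos True by (auto simp: \<rho>_def powr_le1)
    have \<rho>10: "\<rho>^10 = r" and \<rho>2: "\<rho>\<^sup>2 = r powr (1/5)"
      unfolding \<rho>_def using rpos by (simp_all add: powr_power)
    \<comment> \<open>Chosen so that M^4 is the bound 256 * (1 + N4) of
      \<open>tri_deg_power4_le\<close>.\<close>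
    define M where "M = 4 * (1 + N4) powr (1/4)"
    have M0: "0 \<le> M" by (simp add: M_def)
    have M4: "M^4 = 256 * (1 + N4)"
      unfolding M_def using N40 by (simp add: power_mult_distrib powr_power)
    have dM: "d i j \<le> M" for i j
    proof -
      have "real (tri_deg G i j ^ 4) \<le> real (256 * (1 + num_copies (pyramid 4) G))"
        unfolding of_nat_le_iff by (rule tri_deg_power4_le[OF graph])
      then have "d i j ^ 4 \<le> M ^ 4" unfolding M4 N4_def deg by simp
      then show ?thesis using M0 by (simp add: power_mono_iff)
    qed
    have tot: "0 < total" using NQ N1 by linarith
    have cyc: "four_cycles \<le> 1024 * \<rho>^10 * total\<^sup>2"
    proof -
      have "four_cycles = real (\<Sum>l\<in>{1..n}. \<Sum>m\<in>{1..n} - {l}. \<Sum>i\<in>{1..n}. \<Sum>k\<in>{1..n} - {i}.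
          tri_deg G i l * tri_deg G i m * (tri_deg G k l * tri_deg G k m))"
        unfolding four_cycles_def deg V'[symmetric] by simp
      also have "\<dots> \<le> real (256 * (\<Sum>s\<in>increasing4 n. cycle_triple (tri_deg G) s))"
        unfolding of_nat_le_iff
      proof (rule sum_cycle_weight_le)
        show "tri_deg G x y = tri_deg G y x" for x y
          using pair_deg_commute[of x y] unfolding pair_deg_triangles[OF graph] .
        show "tri_deg G x x = 0" for x
          using pair_deg_triangles[OF graph, of x x] by (simp add: pair_deg_def)
      qed
      also have "\<dots> = 256 * R2 G * N\<^sup>2"
        unfolding R2 using N1 by (simp add: b_term_eq[OF graph] n_def)
      also have "\<dots> \<le> 256 * \<rho>^10 * (2 * total)\<^sup>2"
        using NQ N1 R20 unfolding \<rho>10 r_def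
        by (intro mult_mono power_mono) auto
      finally show ?thesis by (simp add: power_mult_distrib)
    qed
    have Mle: "M \<le> 1024 * \<rho>^10 * sqrt total"
    proof -
      have "R1 G powr (1/4) = (1 + N4) powr (1/4) / sqrt N"
      proof -
        have "N\<^sup>2 = N powr 2" using N1 by simp
        then have "(N\<^sup>2) powr (1/4) = N powr (1/2)" by (simp only: powr_powr) simp
        also have "\<dots> = sqrt N" using N1 by (simp add: powr_half_sqrt)
        finally have "(N\<^sup>2) powr (1/4) = sqrt N" .
        then show ?thesis unfolding R1 using N1 N40 by (simp add: powr_divide)
      qed
      then have "(1 + N4) powr (1/4) = R1 G powr (1/4) * sqrt N" using N1 by simp
      \<comment> \<open>N \<le> 2 * total is weakened to 4 * total, whose root is 2 * sqrt
        total.\<close>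
      also have "\<dots> \<le> r * sqrt (2\<^sup>2 * total)"
        unfolding r_def using R20 NQ N1 tot by (intro mult_mono real_sqrt_le_mono) auto
      also have "\<dots> = 2 * r * sqrt total" by (simp add: real_sqrt_mult)
      finally have "M \<le> 8 * (r * sqrt total)" unfolding M_def by simp
      also have "\<dots> \<le> 1024 * (r * sqrt total)"
        using rpos tot by (intro mult_right_mono) auto
      finally show ?thesis unfolding \<rho>10 by simp
    qed
    show ?thesis
      using normal_approximation[OF dM M0 tot \<rho> _ cyc Mle, of z]
      unfolding prob v_def \<rho>2 by simp
  qed
qed

theorem theorem1p1:
  shows "\<forall>c::nat. c \<ge> 2 \<longrightarrow> (\<exists>K::real. K > 0 \<and>
    (\<forall>G :: nat \<Rightarrow> nat pair_pre_digraph.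
      (\<forall>n\<ge>1. labelled_graph (G n) \<and> num_copies K3 (G n) \<ge> 1) \<longrightarrow>
      (\<forall>n\<ge>1.
        (SUP x::real. \<bar>measure_pmf.prob (coloring c (G n)) {X. Z3 c (G n) X \<le> x}
                       - cdf std_normal_distribution x\<bar>)
        \<le> K * ((R1 (G n)) powr (1/4) + R2 (G n)) powr (1/5))))"
proof (intro allI impI)
  fix c :: nat assume c: "2 \<le> c"
  have "0 \<le> normal_const c 1024" unfolding normal_const_def by simp
  then have K: "0 < 16 * normal_const c 1024 + 4" by simp
  show "\<exists>K::real. K > 0 \<and>
    (\<forall>G :: nat \<Rightarrow> nat pair_pre_digraph.
      (\<forall>n\<ge>1. labelled_graph (G n) \<and> num_copies K3 (G n) \<ge> 1) \<longrightarrow>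
      (\<forall>n\<ge>1.
        (SUP x::real. \<bar>measure_pmf.prob (coloring c (G n)) {X. Z3 c (G n) X \<le> x}
                       - cdf std_normal_distribution x\<bar>)
        \<le> K * ((R1 (G n)) powr (1/4) + R2 (G n)) powr (1/5)))"
    by (intro exI[of _ "16 * normal_const c 1024 + 4"] conjI K allI impI cSUP_least
        graph_normal_approximation c) auto
qed

end
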